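(* Let $\Omega\subset\mathbb{C}$ be a bounded domain bounded by finitely many disjoint $C^\infty$ simple closed curves, $\phi$ a positive $C^\infty$ weight on $b\Omega$, and $f$ a proper holomorphic map of $\Omega$ onto the unit disc whose zeroes $a_1,\dots,a_N$ are all simple. Then the matrix $[\sigma(a_k,a_j)]_{k,j=1}^N$ is invertible and, letting $[c_{ij}]$ be its inverse matrix, for all $z,w\in\Omega$ $$\sigma(z,w)=\frac{1}{1-f(z)\overline{f(w)}}\sum_{i,j=1}^N c_{ij}\,\sigma(z,a_i)\,\overline{\sigma(w,a_j)}.$$
   Context: $\sigma(z,w)$ is the weighted Szegő kernel with respect to $\phi$: the kernel of the orthogonal projection of $L^2(b\Omega,\phi\,ds)$ onto the Hardy space $H^2(b\Omega)$ (closure of boundary values of holomorphic functions on $\Omega$ smooth up to the boundary), so that $h(z)=\int_{b\Omega}\sigma(z,w)h(w)\phi(w)\,ds_w$ for $h\in H^2(b\Omega)$. *)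

theory Defs
  imports "HOL-Analysis.Analysis"
begin

definition smooth_fun :: "(real \<Rightarrow> 'a::real_normed_vector) \<Rightarrow> bool" where
  "smooth_fun g \<longleftrightarrow> (\<exists>D :: nat \<Rightarrow> real \<Rightarrow> 'a. D 0 = g \<and>
       (\<forall>n t. (D n has_vector_derivative D (Suc n) t) (at t)))"

definition smooth_simple_closed_curve :: "(real \<Rightarrow> complex) \<Rightarrow> bool" where
  "smooth_simple_closed_curve \<gamma> \<longleftrightarrow>
     smooth_fun \<gamma> \<and> (\<forall>t. \<gamma> (t + 1) = \<gamma> t) \<and>
     (\<forall>t. vector_derivative \<gamma> (at t) \<noteq> 0) \<and> inj_on \<gamma> {0..<1}"

definition curve_image :: "(real \<Rightarrow> complex) \<Rightarrow> complex set" where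
  "curve_image \<gamma> = \<gamma> ` {0..1}"

definition smooth_bounded_domain :: "complex set \<Rightarrow> (real \<Rightarrow> complex) list \<Rightarrow> bool" where
  "smooth_bounded_domain \<Omega> Gs \<longleftrightarrow>
     open \<Omega> \<and> connected \<Omega> \<and> \<Omega> \<noteq> {} \<and> bounded \<Omega> \<and>
     (\<forall>\<gamma>\<in>set Gs. smooth_simple_closed_curve \<gamma>) \<and>
     (\<forall>i<length Gs. \<forall>j<length Gs. i \<noteq> j \<longrightarrow> curve_image (Gs!i) \<inter> curve_image (Gs!j) = {}) \<and>
     frontier \<Omega> = (\<Union>\<gamma>\<in>set Gs. curve_image \<gamma>)"

definition smooth_pos_weight :: "(real \<Rightarrow> complex) list \<Rightarrow> (complex \<Rightarrow> real) \<Rightarrow> bool" where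
  "smooth_pos_weight Gs \<phi> \<longleftrightarrow>
     (\<forall>\<gamma>\<in>set Gs. smooth_fun (\<phi> \<circ> \<gamma>) \<and> (\<forall>t. \<phi> (\<gamma> t) > 0))"

definition bdry_integral :: "(real \<Rightarrow> complex) list \<Rightarrow> (complex \<Rightarrow> complex) \<Rightarrow> complex" where
  "bdry_integral Gs F = sum_list (map (\<lambda>\<gamma>.
      set_lebesgue_integral lborel {0..1}
        (\<lambda>t. F (\<gamma> t) * of_real (norm (vector_derivative \<gamma> (at t))))) Gs)"

definition L2_dist_sq :: "(real \<Rightarrow> complex) list \<Rightarrow> (complex \<Rightarrow> real) \<Rightarrow>
     (complex \<Rightarrow> complex) \<Rightarrow> (complex \<Rightarrow> complex) \<Rightarrow> ennreal" where
  "L2_dist_sq Gs \<phi> h g = sum_list (map (\<lambda>\<gamma>.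
      set_nn_integral lborel {0..1}
        (\<lambda>t. ennreal ((cmod (h (\<gamma> t) - g (\<gamma> t)))\<^sup>2 * \<phi> (\<gamma> t) *
                       norm (vector_derivative \<gamma> (at t))))) Gs)"

definition A_infty :: "complex set \<Rightarrow> (complex \<Rightarrow> complex) \<Rightarrow> bool" where
  "A_infty \<Omega> g \<longleftrightarrow> g holomorphic_on \<Omega> \<and> continuous_on (closure \<Omega>) g \<and>
     (\<forall>n. \<exists>G. continuous_on (closure \<Omega>) G \<and> (\<forall>z\<in>\<Omega>. G z = (deriv ^^ n) g z))"

text \<open>Hardy space H^2: closure in L^2(b Omega, phi ds) of boundary values of A_infty
  functions.  An element is represented by a function whose values on b Omega are the
  boundary function and whose values on Omega are those of its holomorphic extension
  (the pointwise limit of the approximating holomorphic functions).\<close>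
definition hardy2 :: "complex set \<Rightarrow> (real \<Rightarrow> complex) list \<Rightarrow> (complex \<Rightarrow> real) \<Rightarrow>
     (complex \<Rightarrow> complex) set" where
  "hardy2 \<Omega> Gs \<phi> = {h. (\<forall>\<gamma>\<in>set Gs. (\<lambda>t. h (\<gamma> t)) \<in> borel_measurable (restrict_space lborel {0..1})) \<and>
      (\<exists>g :: nat \<Rightarrow> complex \<Rightarrow> complex. (\<forall>n. A_infty \<Omega> (g n)) \<and>
         ((\<lambda>n. L2_dist_sq Gs \<phi> h (g n)) \<longlongrightarrow> 0) sequentially \<and>
         (\<forall>z\<in>\<Omega>. (\<lambda>n. g n z) \<longlonglongrightarrow> h z))}"

definition is_szego_kernel :: "complex set \<Rightarrow> (real \<Rightarrow> complex) list \<Rightarrow> (complex \<Rightarrow> real) \<Rightarrow>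
     (complex \<Rightarrow> complex \<Rightarrow> complex) \<Rightarrow> bool" where
  "is_szego_kernel \<Omega> Gs \<phi> \<sigma> \<longleftrightarrow>
     (\<forall>z\<in>\<Omega>. (\<lambda>w. cnj (\<sigma> z w)) \<in> hardy2 \<Omega> Gs \<phi>) \<and>
     (\<forall>z\<in>\<Omega>. \<forall>h\<in>hardy2 \<Omega> Gs \<phi>.
        h z = bdry_integral Gs (\<lambda>w. \<sigma> z w * h w * of_real (\<phi> w)))"

end

theory Submission
  imports Defs "HOL-Complex_Analysis.Complex_Analysis" "Jordan_Normal_Form.Determinant"
begin

text \<open>Write \<open>k\<^sub>z(w)\<close> for the conjugate of \<open>\<sigma>(z,w)\<close>. The functions of \<open>H\<^sup>2\<close> vanishing at all \<open>a\<^sub>j\<close> are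
  exactly \<open>f H\<^sup>2\<close>, and multiplication by \<open>f\<close> is an isometry since \<open>\<bar>f\<bar> = 1\<close> on the boundary. So
  \<open>k\<^sub>z\<close> minus \<open>f k\<^sub>z\<close> times the conjugate of \<open>f(z)\<close> is orthogonal to these functions, hence is the combination of the \<open>k\<^sub>a\<close>,
  \<open>a = a\<^sub>1, \<dots>, a\<^sub>N\<close>, that interpolates \<open>k\<^sub>z\<close> at these points.

  Instead of the smoothness of \<open>f\<close> up to the boundary it suffices that \<open>f g\<close> and \<open>g / f\<close>
  are uniform limits of functions holomorphic near the closure. A barrier built from exterior tangent discs gives
  \<open>1 - \<bar>f(z)\<bar> = O(dist(z, b\<Omega>))\<close>, so \<open>f'\<close> is bounded by the Schwarz-Pick lemma. A holomorphic function with
  bounded derivative is approximated by glueing its translates in inward directions with a partition of unity and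
  correcting the glued function by a Cauchy transform that solves a \<open>d\<close>-bar equation.\<close>

section \<open>Wirtinger derivatives and the Cauchy transform\<close>

text \<open>The obstacle is that the Hardy space is a closure of \<open>A_infty\<close>: for
  \<open>g\<close> in \<open>A_infty\<close> neither \<open>f g\<close> nor \<open>g / f\<close> is
  known to lie in \<open>A_infty\<close>, since derivatives of \<open>f\<close> beyond the first are
  not controlled at the boundary. A bounded derivative suffices for approximation because translates
  by \<open>t\<close> differ from the function by O(t) and the derivatives of the partition sum to
  zero. Hence the d-bar error of the glued function is O(t), and so is its Cauchy transform.
  Elements of \<open>hardy2\<close> carry boundary values and interior values in one function; a
  norm limit controls only the former, and the reproducing property of the kernel supplies the
  latter. The definition of the domain does not say on which side of each curve it lies; this has to
  be recovered topologically. Differentials are taken in the real sense: in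
  \<open>has_wirtinger\<close>, \<open>a\<close> is the derivative d/dz and \<open>b\<close> the
  d-bar derivative.\<close>

definition has_wirtinger :: "(complex \<Rightarrow> complex) \<Rightarrow> complex \<Rightarrow> complex \<Rightarrow> complex \<Rightarrow> bool" where
  "has_wirtinger g a b z \<longleftrightarrow> (g has_derivative (\<lambda>h. a * h + b * cnj h)) (at z)"

text \<open>The d-bar derivative \<open>B\<close> is named because equations are solved for it,
  while d/dz is only required to exist and be continuous. All functions live on the whole plane;
  local data are cut off before they enter.\<close>

definition C1_dbar :: "(complex \<Rightarrow> complex) \<Rightarrow> (complex \<Rightarrow> complex) \<Rightarrow> bool" where
  "C1_dbar g B \<longleftrightarrow> (\<exists>A. continuous_on UNIV A \<and> continuous_on UNIV B \<and>
     (\<forall>z. has_wirtinger g (A z) (B z) z))"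

lemma has_wirtinger_unique:
  assumes "has_wirtinger g a b z" "has_wirtinger g a' b' z"
  shows "a = a'" "b = b'"
proof -
  have "(\<lambda>h. a * h + b * cnj h) = (\<lambda>h. a' * h + b' * cnj h)"
    by (rule has_derivative_unique[OF assms[unfolded has_wirtinger_def]])
  then have 1: "a * h + b * cnj h = a' * h + b' * cnj h" for h by (rule fun_cong)
  have e1: "a + b = a' + b'" using 1[of 1] by simp
  have e2: "a * \<i> + b * (- \<i>) = a' * \<i> + b' * (- \<i>)" using 1[of \<i>] by (simp only: complex_cnj_i)
  have "a = ((a + b) - \<i> * (a * \<i> + b * (- \<i>))) / 2" by (simp add: complex_eq_iff)
  also have "\<dots> = ((a' + b') - \<i> * (a' * \<i> + b' * (- \<i>))) / 2" by (simp only: e1 e2)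
  also have "\<dots> = a'" by (simp add: complex_eq_iff)
  finally show aa: "a = a'" .
  show "b = b'" using e1 unfolding aa by (rule add_left_imp_eq)
qed

lemma has_wirtinger_transform:
  assumes "has_wirtinger g a b z" "open U" "z \<in> U" "\<And>w. w \<in> U \<Longrightarrow> g w = k w"
  shows "has_wirtinger k a b z"
  unfolding has_wirtinger_def
  by (rule has_derivative_transform_within_open[OF assms(1)[unfolded has_wirtinger_def] assms(2-4)])

lemma has_wirtinger_const: "has_wirtinger (\<lambda>_. c) 0 0 z"
  by (simp add: has_wirtinger_def)

lemma has_wirtinger_field:
  assumes "(g has_field_derivative a) (at z)"
  shows "has_wirtinger g a 0 z"
  using assms by (simp add: has_wirtinger_def has_field_derivative_def)

lemma has_wirtinger_imp_field:
  assumes "has_wirtinger g a 0 z"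
  shows "(g has_field_derivative a) (at z)"
  using assms by (simp add: has_wirtinger_def has_field_derivative_def)

lemma has_wirtinger_add:
  assumes "has_wirtinger g a b z" "has_wirtinger k a' b' z"
  shows "has_wirtinger (\<lambda>z. g z + k z) (a + a') (b + b') z"
proof -
  have "((\<lambda>z. g z + k z) has_derivative (\<lambda>h. (a * h + b * cnj h) + (a' * h + b' * cnj h))) (at z)"
    by (rule has_derivative_add[OF assms[unfolded has_wirtinger_def]])
  moreover have "(\<lambda>h. (a * h + b * cnj h) + (a' * h + b' * cnj h)) = (\<lambda>h. (a + a') * h + (b + b') * cnj h)"
    by (rule ext) (simp only: distrib_left distrib_right mult_ac add_ac)
  ultimately show ?thesis unfolding has_wirtinger_def by (simp only:)
qed

lemma has_wirtinger_mult:
  assumes "has_wirtinger g a b z" "has_wirtinger k a' b' z"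
  shows "has_wirtinger (\<lambda>z. g z * k z) (g z * a' + a * k z) (g z * b' + b * k z) z"
proof -
  have "((\<lambda>z. g z * k z) has_derivative
      (\<lambda>h. g z * (a' * h + b' * cnj h) + (a * h + b * cnj h) * k z)) (at z)"
    by (rule has_derivative_mult[OF assms[unfolded has_wirtinger_def]])
  moreover have "(\<lambda>h. g z * (a' * h + b' * cnj h) + (a * h + b * cnj h) * k z) = (\<lambda>h. (g z * a' + a * k z) * h + (g z * b' + b * k z) * cnj h)"
    by (rule ext) (simp only: distrib_left distrib_right mult_ac add_ac)
  ultimately show ?thesis unfolding has_wirtinger_def by (simp only:)
qed

lemma has_wirtinger_isCont: "has_wirtinger g a b z \<Longrightarrow> isCont g z"
  unfolding has_wirtinger_def by (rule has_derivative_continuous)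

lemma C1_dbarD: "C1_dbar g B \<Longrightarrow> \<exists>a. has_wirtinger g a (B z) z"
  unfolding C1_dbar_def by blast

lemma C1_dbar_cont: "C1_dbar g B \<Longrightarrow> continuous_on S g"
  unfolding C1_dbar_def
  by (metis continuous_at_imp_continuous_on has_wirtinger_isCont)

lemma C1_dbar_cont': "C1_dbar g B \<Longrightarrow> continuous_on S B"
  unfolding C1_dbar_def using continuous_on_subset by blast

lemma C1_dbar_const: "C1_dbar (\<lambda>_. c) (\<lambda>_. 0)"
  unfolding C1_dbar_def using has_wirtinger_const continuous_on_const by blast

lemma C1_dbar_add:
  assumes "C1_dbar g B" "C1_dbar k B'"
  shows "C1_dbar (\<lambda>z. g z + k z) (\<lambda>z. B z + B' z)"
proof -
  obtain A A' where A: "continuous_on UNIV A" "continuous_on UNIV A'" 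
    "\<And>z. has_wirtinger g (A z) (B z) z" "\<And>z. has_wirtinger k (A' z) (B' z) z"
    and B: "continuous_on UNIV B" "continuous_on UNIV B'"
    using assms unfolding C1_dbar_def by blast
  show ?thesis unfolding C1_dbar_def
    by (rule exI[of _ "\<lambda>z. A z + A' z"]) (intro conjI allI continuous_intros A B has_wirtinger_add)
qed

lemma C1_dbar_mult:
  assumes g: "C1_dbar g B" and k: "C1_dbar k B'"
  shows "C1_dbar (\<lambda>z. g z * k z) (\<lambda>z. g z * B' z + B z * k z)"
proof -
  obtain A A' where A: "continuous_on UNIV A" "continuous_on UNIV A'" 
    "\<And>z. has_wirtinger g (A z) (B z) z" "\<And>z. has_wirtinger k (A' z) (B' z) z"
    and B: "continuous_on UNIV B" "continuous_on UNIV B'"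
    using assms unfolding C1_dbar_def by blast
  show ?thesis unfolding C1_dbar_def
    by (rule exI[of _ "\<lambda>z. g z * A' z + A z * k z"])
      (intro conjI allI continuous_intros A B has_wirtinger_mult C1_dbar_cont[OF g] C1_dbar_cont[OF k])
qed

lemma C1_dbar_minus:
  assumes "C1_dbar g B" "C1_dbar k B'"
  shows "C1_dbar (\<lambda>z. g z - k z) (\<lambda>z. B z - B' z)"
  using C1_dbar_add[OF assms(1) C1_dbar_mult[OF C1_dbar_const[of "-1"] assms(2)]] by simp

lemma C1_dbar_sum:
  assumes "finite I" "\<And>i. i \<in> I \<Longrightarrow> C1_dbar (g i) (B i)"
  shows "C1_dbar (\<lambda>z. \<Sum>i\<in>I. g i z) (\<lambda>z. \<Sum>i\<in>I. B i z)"
  using assms by (induction I) (auto simp: C1_dbar_const intro: C1_dbar_add)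

lemma C1_dbar_zero_on:
  assumes "C1_dbar g B" "open U" "z \<in> U" "\<And>w. w \<in> U \<Longrightarrow> g w = c"
  shows "B z = 0"
proof -
  obtain a where "has_wirtinger g a (B z) z" using C1_dbarD[OF assms(1)] by blast
  moreover have "has_wirtinger g 0 0 z"
    by (rule has_wirtinger_transform[OF has_wirtinger_const[of c] assms(2,3)]) (simp add: assms(4))
  ultimately show ?thesis using has_wirtinger_unique by blast
qed

text \<open>Outside \<open>U\<close> the values of \<open>k\<close> are arbitrary, but
  \<open>g\<close> vanishes off the closed set \<open>S\<close> inside \<open>U\<close>, so the
  product extends by zero. The factor \<open>k\<close> contributes nothing to the d-bar derivative.
  This lets translates, which are holomorphic only locally, enter a global sum.\<close>

lemma C1_dbar_mult_holomorphic:
  assumes g: "C1_dbar g B" and k: "k holomorphic_on U" "open U"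
    and S: "closed S" "S \<subseteq> U" "\<And>z. z \<notin> S \<Longrightarrow> g z = 0"
  shows "C1_dbar (\<lambda>z. g z * k z) (\<lambda>z. B z * k z)"
proof -
  obtain A where A: "continuous_on UNIV A" "\<And>z. has_wirtinger g (A z) (B z) z"
    and B: "continuous_on UNIV B"
    using g unfolding C1_dbar_def by blast
  have opS: "open (- S)" using S by auto
  have z0: "A z = 0" "B z = 0" if "z \<notin> S" for z
  proof -
    have "has_wirtinger g 0 0 z"
      by (rule has_wirtinger_transform[OF has_wirtinger_const[of 0] opS]) (use that S in auto)
    then show "A z = 0" "B z = 0" using has_wirtinger_unique A(2) by blast+
  qed
  define A' where "A' z = (if z \<in> S then g z * deriv k z + A z * k z else 0)" for z
  \<comment> \<open>\<open>U\<close> and the complement of \<open>S\<close> are open and cover the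
    plane; continuity is checked on each of them.\<close>
  have UU: "U \<union> (- S) = UNIV" using S by auto
  have contk: "continuous_on U k" "continuous_on U (deriv k)"
    using k by (auto intro: holomorphic_on_imp_continuous_on holomorphic_deriv)
  have g0: "g z = 0" if "z \<notin> S" for z using S that by auto
  have ch: "continuous_on UNIV f" if "continuous_on U f" "\<And>z. z \<notin> S \<Longrightarrow> f z = 0" for f :: "complex \<Rightarrow> complex"
  proof -
    have "continuous_on (-S) f" using continuous_on_cong[of "-S" "-S" f "\<lambda>_. 0"] that(2) by auto
    then show ?thesis using continuous_on_open_Un[OF k(2) opS that(1)] UU by simp
  qed
  have cA': "continuous_on UNIV A'"
  proof (rule ch)
    have "continuous_on U (\<lambda>z. g z * deriv k z + A z * k z)"
      by (intro continuous_intros contk C1_dbar_cont[OF g] continuous_on_subset[OF A(1)]) auto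
    moreover have "A' z = g z * deriv k z + A z * k z" for z
      by (simp add: A'_def g0 z0)
    ultimately show "continuous_on U A'" by simp
  qed (simp add: A'_def)
  have cB': "continuous_on UNIV (\<lambda>z. B z * k z)"
    by (rule ch) (auto intro!: continuous_intros contk continuous_on_subset[OF B] simp: z0)
  have "has_wirtinger (\<lambda>z. g z * k z) (A' z) (B z * k z) z" for z
  proof (cases "z \<in> S")
    case True
    then have "has_wirtinger k (deriv k z) 0 z"
      using k S by (intro has_wirtinger_field) (meson holomorphic_derivI subsetD)
    from has_wirtinger_mult[OF A(2) this] show ?thesis using True by (simp add: A'_def)
  next
    case False
    have "has_wirtinger (\<lambda>z. g z * k z) 0 0 z"
      by (rule has_wirtinger_transform[OF has_wirtinger_const[of 0] opS]) (use False S in auto)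
    then show ?thesis using False z0 by (simp add: A'_def)
  qed
  then show ?thesis unfolding C1_dbar_def using cA' cB' by blast
qed

lemma C1_dbar_zero_imp_holomorphic:
  assumes "C1_dbar g B" "open U" "\<And>z. z \<in> U \<Longrightarrow> B z = 0"
  shows "g holomorphic_on U"
proof -
  have "\<exists>a. (g has_field_derivative a) (at z)" if "z \<in> U" for z
    using C1_dbarD[OF assms(1), of z] assms(3)[OF that] has_wirtinger_imp_field by auto
  then show ?thesis using holomorphic_on_open[OF assms(2)] by blast
qed

section \<open>The Cauchy transform in polar coordinates\<close>

definition polar_integrand :: "(complex \<Rightarrow> complex) \<Rightarrow> complex \<Rightarrow> real \<times> real \<Rightarrow> complex" where
  "polar_integrand g z p = g (z - of_real (fst p) * cis (snd p)) * cis (- snd p)"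

text \<open>This is 1/\<pi> times the integral of g(w)/(z - w) over the disc of radius
  \<open>R\<close> about \<open>z\<close>, with w = z - r e^(i\<theta>) and p = (r, \<theta>). The
  Jacobian r cancels the modulus of the kernel and leaves the factor e^(-i\<theta>) in
  \<open>polar_integrand\<close>. The rectangle of integration is the same for every
  \<open>z\<close>.\<close>

definition cauchy_transform :: "real \<Rightarrow> (complex \<Rightarrow> complex) \<Rightarrow> complex \<Rightarrow> complex" where
  "cauchy_transform R g z = integral (cbox (0, 0) (R, 2 * pi)) (polar_integrand g z) / of_real pi"

text \<open>The real-linear differential as a bounded linear operator, the form in which
  \<open>leibniz_rule\<close> takes the derivative of the integrand.\<close>

definition wblin :: "complex \<Rightarrow> complex \<Rightarrow> complex \<Rightarrow>\<^sub>L complex" where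
  "wblin a b = blinfun_mult_right a + (blinfun_mult_right b o\<^sub>L Blinfun cnj)"

lemma wblin_apply [simp]: "blinfun_apply (wblin a b) h = a * h + b * cnj h"
  by (simp add: wblin_def blinfun.add_left bounded_linear_Blinfun_apply bounded_linear_cnj)

lemma continuous_on_wblin [continuous_intros]:
  assumes "continuous_on S f" "continuous_on S g"
  shows "continuous_on S (\<lambda>x. wblin (f x) (g x))"
  unfolding wblin_def
  by (intro continuous_intros bounded_linear.continuous_on[OF bounded_linear_blinfun_mult_right] assms)

lemma continuous_polar_integrand:
  assumes "continuous_on UNIV g"
  shows "continuous_on S (\<lambda>(z, p). polar_integrand g z p)"
  unfolding split_beta polar_integrand_def
  by (intro continuous_intros continuous_on_compose2[OF assms]) auto

lemma continuous_polar_integrand2: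
  assumes "continuous_on UNIV g"
  shows "continuous_on S (polar_integrand g z)"
  unfolding polar_integrand_def[abs_def]
  by (intro continuous_intros continuous_on_compose2[OF assms]) auto

lemma polar_integrand_has_derivative:
  assumes "\<And>z. has_wirtinger g (A z) (B z) z"
  shows "((\<lambda>z. polar_integrand g z p) has_derivative
     blinfun_apply (wblin (polar_integrand A z p) (polar_integrand B z p))) (at z)"
proof -
  let ?w = "of_real (fst p) * cis (snd p)"
  have 1: "((\<lambda>z. z - ?w) has_derivative (\<lambda>h. h)) (at z)"
    by (auto intro!: derivative_eq_intros)
  have 2: "(g has_derivative (\<lambda>h. A (z - ?w) * h + B (z - ?w) * cnj h)) (at (z - ?w))"
    using assms unfolding has_wirtinger_def by blast
  have "((\<lambda>z. g (z - ?w)) has_derivative (\<lambda>h. A (z - ?w) * h + B (z - ?w) * cnj h)) (at z)"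
    using has_derivative_compose[OF 1 2] .
  then have "((\<lambda>z. g (z - ?w) * cis (- snd p)) has_derivative
       (\<lambda>h. (A (z - ?w) * h + B (z - ?w) * cnj h) * cis (- snd p))) (at z)"
    by (rule has_derivative_mult_left)
  moreover have "(\<lambda>h. (A (z - ?w) * h + B (z - ?w) * cnj h) * cis (- snd p)) =
      blinfun_apply (wblin (polar_integrand A z p) (polar_integrand B z p))"
    by (simp add: fun_eq_iff polar_integrand_def algebra_simps)
  ultimately show ?thesis unfolding polar_integrand_def by simp
qed

text \<open>In polar coordinates \<open>z\<close> enters only through the argument of
  \<open>g\<close> and the kernel is bounded, so one may differentiate under the integral sign: both
  Wirtinger derivatives commute with the transform.\<close>

lemma cauchy_transform_has_wirtinger:
  assumes A: "continuous_on UNIV A" and B: "continuous_on UNIV B"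
    and g: "\<And>z. has_wirtinger g (A z) (B z) z"
  shows "has_wirtinger (cauchy_transform R g) (cauchy_transform R A z) (cauchy_transform R B z) z"
proof -
  let ?I = "cbox (0::real, 0::real) (R, 2 * pi)"
  define fx where "fx = (\<lambda>z p. wblin (polar_integrand A z p) (polar_integrand B z p))"
  have cg: "continuous_on UNIV g"
    by (metis continuous_at_imp_continuous_on g has_wirtinger_isCont)
  have cfx: "continuous_on S (\<lambda>(x, t). fx x t)" for S
    using continuous_on_wblin[OF continuous_polar_integrand[OF A, of S] continuous_polar_integrand[OF B, of S]]
    by (simp add: fx_def split_beta')
  have 1: "((\<lambda>z. integral ?I (polar_integrand g z)) has_derivative
      blinfun_apply (integral ?I (fx z))) (at z within UNIV)"
  proof (rule leibniz_rule)
    fix w t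
    show "((\<lambda>x. polar_integrand g x t) has_derivative blinfun_apply (fx w t)) (at w within UNIV)"
      unfolding fx_def by (rule polar_integrand_has_derivative[OF g])
    show "polar_integrand g w integrable_on ?I"
      by (intro integrable_continuous continuous_polar_integrand2 cg)
    show "continuous_on (UNIV \<times> ?I) (\<lambda>(x, t). fx x t)"
      by (rule cfx)
  qed (rule UNIV_I convex_UNIV)+
  have int: "fx z integrable_on ?I"
    unfolding fx_def
    by (intro integrable_continuous continuous_on_wblin continuous_polar_integrand2 A B)
  have intA: "polar_integrand A z integrable_on ?I"
    and intB: "polar_integrand B z integrable_on ?I"
    by (intro integrable_continuous continuous_polar_integrand2 A B)+
  have 2: "blinfun_apply (integral ?I (fx z)) h =
      integral ?I (polar_integrand A z) * h + integral ?I (polar_integrand B z) * cnj h" for h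
  proof -
    have "blinfun_apply (integral ?I (fx z)) h = integral ?I (\<lambda>t. blinfun_apply (fx z t) h)"
      by (rule blinfun_apply_integral[OF int])
    also have "\<dots> = integral ?I (\<lambda>t. polar_integrand A z t * h + polar_integrand B z t * cnj h)"
      by (simp only: fx_def wblin_apply)
    also have "\<dots> = integral ?I (\<lambda>t. polar_integrand A z t * h) + integral ?I (\<lambda>t. polar_integrand B z t * cnj h)"
      by (intro integral_add integrable_on_mult_left intA intB)
    finally show ?thesis by (simp only: integral_mult_left)
  qed
  have "((\<lambda>z. inverse (of_real pi) * integral ?I (polar_integrand g z)) has_derivative
      (\<lambda>h. inverse (of_real pi) * blinfun_apply (integral ?I (fx z)) h)) (at z)"
    using 1 by (intro has_derivative_mult_right) simp
  moreover have "(\<lambda>h. inverse (of_real pi) * blinfun_apply (integral ?I (fx z)) h) =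
      (\<lambda>h. cauchy_transform R A z * h + cauchy_transform R B z * cnj h)"
    by (rule ext) (unfold 2 cauchy_transform_def divide_inverse, simp only: distrib_left mult_ac)
  moreover have "(\<lambda>z. inverse (of_real pi) * integral ?I (polar_integrand g z)) = cauchy_transform R g"
    by (rule ext) (simp only: cauchy_transform_def divide_inverse mult.commute[of "inverse _"])
  ultimately show ?thesis
    unfolding has_wirtinger_def by (simp only:)
qed

lemma continuous_cauchy_transform:
  assumes "continuous_on UNIV g"
  shows "continuous_on UNIV (cauchy_transform R g)"
proof -
  have "continuous_on UNIV (\<lambda>z. integral (cbox (0, 0) (R, 2 * pi)) (polar_integrand g z))"
    by (rule integral_continuous_on_param) (rule continuous_polar_integrand[OF assms])
  then show ?thesis unfolding cauchy_transform_def[abs_def] by (rule continuous_on_divide) auto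
qed

text \<open>The rectangle has area 2\<pi>R and the integrand is bounded by \<open>C\<close>;
  dividing by \<pi> gives the constant.\<close>

lemma norm_cauchy_transform_le:
  assumes cont: "continuous_on UNIV g" and le: "\<And>z. norm (g z) \<le> C" and R: "0 \<le> R"
  shows "norm (cauchy_transform R g z) \<le> 2 * R * C"
proof -
  let ?I = "cbox (0::real, 0::real) (R, 2 * pi)"
  have "norm (integral ?I (polar_integrand g z)) \<le> C * measure lborel ?I"
  proof (rule integrable_bound)
    show "0 \<le> C" using le[of 0] norm_ge_zero order_trans by blast
    show "polar_integrand g z integrable_on ?I"
      by (intro integrable_continuous continuous_polar_integrand2 cont)
    show "norm (polar_integrand g z x) \<le> C" for x
      using le by (simp add: polar_integrand_def norm_mult)
  qed
  also have "measure lborel ?I = R * (2 * pi)"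
    using R by (simp add: content_Pair)
  finally show ?thesis
    by (simp add: cauchy_transform_def norm_divide field_simps)
qed

text \<open>In polar coordinates around \<open>z\<close>, the \<open>d\<close>-bar derivative is a combination of a radial derivative, which
  integrates to \<open>g z\<close>, and an angular one, which integrates to zero over a period.\<close>
lemma cauchy_transform_dbar:
  assumes A: "continuous_on UNIV A" and B: "continuous_on UNIV B"
    and g: "\<And>z. has_wirtinger g (A z) (B z) z"
    and R: "0 < R" and far: "\<And>w. norm (z - w) = R \<Longrightarrow> g w = 0"
  shows "cauchy_transform R B z = g z"
proof -
  let ?P = "polar_integrand B z" and ?I = "cbox (0::real, 0::real) (R, 2 * pi)"
  \<comment> \<open>\<open>Q\<close> is the d/dz counterpart of \<open>?P\<close>: the derivative
    along the radius is -(\<open>Q\<close> + \<open>?P\<close>), the one along the circle is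
    -ir(\<open>Q\<close> - \<open>?P\<close>). A full turn equates the two integrals, and the radial
    derivative gives their sum.\<close>
  define Q where "Q = (\<lambda>(r, \<theta>). A (z - of_real r * cis \<theta>) * cis \<theta>)"
  have cg: "continuous_on UNIV g"
    by (metis continuous_at_imp_continuous_on g has_wirtinger_isCont)
  have cP: "continuous_on S ?P" for S by (rule continuous_polar_integrand2[OF B])
  have cQ: "continuous_on S Q" for S
    unfolding Q_def split_beta by (intro continuous_intros continuous_on_compose2[OF A]) auto
  have circ: "((\<lambda>\<theta>. g (z - of_real r * cis \<theta>)) has_vector_derivative
      (- of_real r * \<i>) * (Q (r, \<theta>) - ?P (r, \<theta>))) (at \<theta> within S)" for r \<theta> S
  proof -
    have 1: "((\<lambda>\<theta>. z - of_real r * cis \<theta>) has_derivative (\<lambda>x. x *\<^sub>R (- of_real r * (\<i> * cis \<theta>)))) (at \<theta> within S)"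
    proof -
      have "(cis has_derivative (\<lambda>x. x *\<^sub>R (\<i> * cis \<theta>))) (at \<theta> within S)"
        by (auto intro!: derivative_eq_intros)
      then show ?thesis by (auto intro!: derivative_eq_intros simp: scaleR_conv_of_real)
    qed
    have 2: "(g has_derivative (\<lambda>h. A (z - of_real r * cis \<theta>) * h + B (z - of_real r * cis \<theta>) * cnj h)) (at (z - of_real r * cis \<theta>))"
      using g unfolding has_wirtinger_def by blast
    from has_derivative_compose[OF 1 2] show ?thesis
      unfolding has_vector_derivative_def
      by (rule has_derivative_eq_rhs)
        (rule ext, simp add: scaleR_conv_of_real Q_def polar_integrand_def cis_cnj, simp add: algebra_simps)
  qed
  have rad: "((\<lambda>r. g (z - of_real r * cis \<theta>)) has_vector_derivative
      - (Q (r, \<theta>) + ?P (r, \<theta>))) (at r within S)" for r \<theta> S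
  proof -
    have 1: "((\<lambda>r. z - of_real r * cis \<theta>) has_derivative (\<lambda>x. x *\<^sub>R (- cis \<theta>))) (at r within S)"
      by (auto intro!: derivative_eq_intros simp: scaleR_conv_of_real)
    have 2: "(g has_derivative (\<lambda>h. A (z - of_real r * cis \<theta>) * h + B (z - of_real r * cis \<theta>) * cnj h)) (at (z - of_real r * cis \<theta>))"
      using g unfolding has_wirtinger_def by blast
    from has_derivative_compose[OF 1 2] show ?thesis
      unfolding has_vector_derivative_def
      by (rule has_derivative_eq_rhs)
        (rule ext, simp add: scaleR_conv_of_real Q_def polar_integrand_def cis_cnj, simp add: algebra_simps)
  qed
  have int1: "(\<lambda>\<theta>. ?P (r, \<theta>)) integrable_on cbox 0 (2 * pi)"
    "(\<lambda>\<theta>. Q (r, \<theta>)) integrable_on cbox 0 (2 * pi)" for r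
    by (intro integrable_continuous continuous_on_compose2[OF cP[of UNIV]] continuous_on_compose2[OF cQ[of UNIV]] continuous_intros; simp)+
  \<comment> \<open>The factor r degenerates at the centre, so the identity is shown for r \<noteq>
    0 only; the single radius 0 is discarded below as a null set.\<close>
  have angular: "integral (cbox 0 (2 * pi)) (\<lambda>\<theta>. Q (r, \<theta>)) = integral (cbox 0 (2 * pi)) (\<lambda>\<theta>. ?P (r, \<theta>))" if "r \<noteq> 0" for r
  proof -
    have "((\<lambda>\<theta>. (- of_real r * \<i>) * (Q (r, \<theta>) - ?P (r, \<theta>))) has_integral
       g (z - of_real r * cis (2 * pi)) - g (z - of_real r * cis 0)) {0..2 * pi}"
      by (rule fundamental_theorem_of_calculus[OF _ circ]) simp
    then have "integral (cbox 0 (2*pi)) (\<lambda>\<theta>. (- of_real r * \<i>) * (Q (r, \<theta>) - ?P (r, \<theta>))) = 0"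
      by (intro integral_unique) simp
    then have "(- of_real r * \<i>) * integral (cbox 0 (2*pi)) (\<lambda>\<theta>. Q (r, \<theta>) - ?P (r, \<theta>)) = 0"
      by (simp only: integral_mult_right)
    then have "integral (cbox 0 (2*pi)) (\<lambda>\<theta>. Q (r, \<theta>) - ?P (r, \<theta>)) = 0"
      using that by simp
    then show ?thesis using int1[of r] by (simp add: integral_diff)
  qed
  have swap: "integral ?I F = integral (cbox 0 R) (\<lambda>r. integral (cbox 0 (2 * pi)) (\<lambda>\<theta>. F (r, \<theta>)))"
    if "continuous_on UNIV F" for F :: "real \<times> real \<Rightarrow> complex"
    by (rule integral_prod_continuous) (use that continuous_on_subset in blast)
  have "integral ?I Q = integral ?I ?P"
    unfolding swap[OF cQ] swap[OF cP]
    by (rule integral_spike[of "{0}"]) (use angular in auto)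
  moreover have "integral ?I (\<lambda>p. - (Q p + ?P p)) = - (2 * of_real pi * g z)"
  proof -
    have c: "continuous_on S (\<lambda>p. - (Q p + ?P p))" for S by (intro continuous_intros cP cQ)
    have "integral ?I (\<lambda>p. - (Q p + ?P p)) = 
      integral (cbox 0 R) (\<lambda>r. integral (cbox 0 (2 * pi)) (\<lambda>\<theta>. - (Q (r, \<theta>) + ?P (r, \<theta>))))"
      by (rule swap[OF c])
    \<comment> \<open>The order is exchanged so that the fundamental theorem applies in r: for each
      angle the value at r = \<open>R\<close> vanishes and the value at r = 0 is
      \<open>g z\<close>.\<close>
    also have "\<dots> = integral (cbox 0 (2 * pi)) (\<lambda>\<theta>. integral (cbox 0 R) (\<lambda>r. - (Q (r, \<theta>) + ?P (r, \<theta>))))"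
      by (rule integral_swap_continuous) (use c in \<open>simp add: split_beta'\<close>)
    also have "\<dots> = integral (cbox 0 (2 * pi)) (\<lambda>\<theta>. - g z)"
    proof (rule integral_cong)
      fix \<theta> :: real
      have "((\<lambda>r. - (Q (r, \<theta>) + ?P (r, \<theta>))) has_integral
         g (z - of_real R * cis \<theta>) - g (z - of_real 0 * cis \<theta>)) {0..R}"
        by (rule fundamental_theorem_of_calculus[OF _ rad]) (use R in simp)
      moreover have "g (z - of_real R * cis \<theta>) = 0"
        by (rule far) (use R in \<open>simp add: norm_mult\<close>)
      ultimately show "integral (cbox 0 R) (\<lambda>r. - (Q (r, \<theta>) + ?P (r, \<theta>))) = - g z"
        by (simp add: integral_unique)
    qed
    also have "\<dots> = - (2 * of_real pi * g z)" by (simp add: scaleR_conv_of_real)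
    finally show ?thesis .
  qed
  moreover have "integral ?I (\<lambda>p. - (Q p + ?P p)) = - (integral ?I Q + integral ?I ?P)"
    by (subst integral_neg, subst integral_add) (auto intro!: integrable_continuous cP cQ)
  ultimately have "integral ?I ?P = of_real pi * g z" by (simp add: algebra_simps)
  then show ?thesis by (simp add: cauchy_transform_def)
qed

section \<open>Approximation by functions holomorphic near the closure\<close>

lemma has_real_derivative_pos_part_power:
  "((\<lambda>x::real. max 0 x ^ Suc (Suc n)) has_real_derivative real (Suc (Suc n)) * max 0 x ^ Suc n) (at x)"
proof -
  consider "x < 0" | "x > 0" | "x = 0" by linarith
  then show ?thesis
  proof cases
    case 1
    have "((\<lambda>x::real. 0) has_real_derivative 0) (at x)" by simp
    then have "((\<lambda>x::real. max 0 x ^ Suc (Suc n)) has_real_derivative 0) (at x)"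
      by (rule has_field_derivative_transform_within_open[of _ _ _ "{..<0}"]) (use 1 in auto)
    then show ?thesis using 1 by simp
  next
    case 2
    have "((\<lambda>x::real. x ^ Suc (Suc n)) has_real_derivative real (Suc (Suc n)) * x ^ Suc n) (at x)"
      by (rule derivative_eq_intros refl)+ simp
    then have "((\<lambda>x::real. max 0 x ^ Suc (Suc n)) has_real_derivative real (Suc (Suc n)) * x ^ Suc n) (at x)"
      by (rule has_field_derivative_transform_within_open[of _ _ _ "{0<..}"]) (use 2 in auto)
    then show ?thesis using 2 by (simp add: max_def)
  next
    case 3
    have "((\<lambda>h::real. max 0 h ^ Suc (Suc n) / h) \<longlongrightarrow> 0) (at 0)"
    proof (rule Lim_null_comparison)
      show "\<forall>\<^sub>F h::real in at 0. norm (max 0 h ^ Suc (Suc n) / h) \<le> \<bar>h\<bar> ^ Suc n"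
      proof (rule always_eventually, rule allI)
        fix h :: real
        show "norm (max 0 h ^ Suc (Suc n) / h) \<le> \<bar>h\<bar> ^ Suc n"
        proof (cases "h > 0")
          case False
          then have "norm (max 0 h ^ Suc (Suc n) / h) = 0" by (simp add: max.absorb1)
          then show ?thesis by (metis abs_ge_zero zero_le_power)
        qed (simp add: max.absorb2)
      qed
      show "((\<lambda>h::real. \<bar>h\<bar> ^ Suc n) \<longlongrightarrow> 0) (at 0)"
        by (rule tendsto_eq_intros refl)+ simp
    qed
    then show ?thesis using 3 by (simp add: DERIV_def)
  qed
qed

text \<open>The real differential of |z - p|^2 sends h to
  \<open>cnj (z - p) * h + (z - p) * cnj h\<close>, so its d-bar derivative is z - p; the rest is
  the chain rule.\<close>

lemma C1_dbar_radial:
  assumes s: "\<And>x. (s has_real_derivative s' x) (at x)" and cont: "continuous_on UNIV s'"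
  shows "C1_dbar (\<lambda>z. of_real (s ((cmod (z - p))\<^sup>2))) (\<lambda>z. of_real (s' ((cmod (z - p))\<^sup>2)) * (z - p))"
proof -
  have "has_wirtinger (\<lambda>z. of_real (s ((cmod (z - p))\<^sup>2))) (of_real (s' ((cmod (z - p))\<^sup>2)) * cnj (z - p))
      (of_real (s' ((cmod (z - p))\<^sup>2)) * (z - p)) z" for z
  proof -
    let ?d = "\<lambda>h. 2 * ((z - p) \<bullet> h)"
    have 1: "((\<lambda>z. (cmod (z - p))\<^sup>2) has_derivative ?d) (at z)"
      unfolding power2_norm_eq_inner
      by (rule derivative_eq_intros refl)+ (auto simp: inner_commute)
    have "(s has_derivative (\<lambda>h. s' ((cmod (z - p))\<^sup>2) * h)) (at ((cmod (z - p))\<^sup>2))"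
      using s unfolding has_field_derivative_def by blast
    from has_derivative_of_real[OF has_derivative_compose[OF 1 this]]
    have "((\<lambda>z. complex_of_real (s ((cmod (z - p))\<^sup>2))) has_derivative
       (\<lambda>h. of_real (s' ((cmod (z - p))\<^sup>2) * ?d h))) (at z)" .
    moreover have "(\<lambda>h. complex_of_real (s' ((cmod (z - p))\<^sup>2) * ?d h)) =
       (\<lambda>h. of_real (s' ((cmod (z - p))\<^sup>2)) * cnj (z - p) * h + of_real (s' ((cmod (z - p))\<^sup>2)) * (z - p) * cnj h)"
    proof
      fix h
      have "complex_of_real (?d h) = cnj (z - p) * h + (z - p) * cnj h"
        by (simp add: complex_eq_iff inner_complex_def algebra_simps)
      then show "complex_of_real (s' ((cmod (z - p))\<^sup>2) * ?d h) =
        of_real (s' ((cmod (z - p))\<^sup>2)) * cnj (z - p) * h + of_real (s' ((cmod (z - p))\<^sup>2)) * (z - p) * cnj h"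
        by (simp only: of_real_mult distrib_left mult.assoc)
    qed
    ultimately show ?thesis unfolding has_wirtinger_def by (simp only:)
  qed
  moreover have "continuous_on UNIV (\<lambda>z. complex_of_real (s' ((cmod (z - p))\<^sup>2)) * cnj (z - p))"
    "continuous_on UNIV (\<lambda>z. complex_of_real (s' ((cmod (z - p))\<^sup>2)) * (z - p))"
    by (intro continuous_intros continuous_on_compose2[OF cont]; simp)+
  ultimately show ?thesis unfolding C1_dbar_def
    by (intro exI[of _ "\<lambda>z. complex_of_real (s' ((cmod (z - p))\<^sup>2)) * cnj (z - p)"]) blast
qed

text \<open>Second order is asked of the d-bar derivative alone: it becomes the datum of a d-bar
  equation, and \<open>cauchy_transform_dbar\<close> requires that datum to be continuously
  differentiable itself.\<close>

definition C2_dbar :: "(complex \<Rightarrow> complex) \<Rightarrow> (complex \<Rightarrow> complex) \<Rightarrow> bool" where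
  "C2_dbar g B \<longleftrightarrow> C1_dbar g B \<and> (\<exists>B'. C1_dbar B B')"

lemma C2_dbar_imp_C1: "C2_dbar g B \<Longrightarrow> C1_dbar g B"
  by (simp add: C2_dbar_def)

lemma C2_dbar_const: "C2_dbar (\<lambda>_. c) (\<lambda>_. 0)"
  unfolding C2_dbar_def using C1_dbar_const by blast

lemma C2_dbar_add:
  assumes "C2_dbar g B" "C2_dbar k B'"
  shows "C2_dbar (\<lambda>z. g z + k z) (\<lambda>z. B z + B' z)"
  using assms unfolding C2_dbar_def by (blast intro: C1_dbar_add)

lemma C2_dbar_mult:
  assumes "C2_dbar g B" "C2_dbar k B'"
  shows "C2_dbar (\<lambda>z. g z * k z) (\<lambda>z. g z * B' z + B z * k z)"
  using assms C1_dbar_mult[of g B k B'] C1_dbar_add[OF C1_dbar_mult[of g B B'] C1_dbar_mult[of B _ k B']]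
  unfolding C2_dbar_def by blast

lemma C2_dbar_minus:
  assumes "C2_dbar g B" "C2_dbar k B'"
  shows "C2_dbar (\<lambda>z. g z - k z) (\<lambda>z. B z - B' z)"
  using C2_dbar_add[OF assms(1) C2_dbar_mult[OF C2_dbar_const[of "-1"] assms(2)]] by simp

lemma C2_dbar_sum:
  assumes "finite I" "\<And>i. i \<in> I \<Longrightarrow> C2_dbar (g i) (B i)"
  shows "C2_dbar (\<lambda>z. \<Sum>i\<in>I. g i z) (\<lambda>z. \<Sum>i\<in>I. B i z)"
  using assms by (induction I) (auto simp: C2_dbar_const intro: C2_dbar_add)

text \<open>The profile is h(1 - h(y)) in the squared distance, with h the cube of the positive part
  and y the affine function sending (\<rho>/2)^2 to 0 and (3\<rho>/4)^2 to 1. It equals 1 for y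
  \<le> 0 and 0 for y \<ge> 1. The exponent 3 makes two derivatives continuous.\<close>

lemma bump_exists:
  assumes "\<rho> > 0"
  shows "\<exists>b B. C2_dbar b B \<and> (\<forall>z\<in>ball p (\<rho>/2). b z = 1) \<and> (\<forall>z. z \<notin> cball p (3/4*\<rho>) \<longrightarrow> b z = 0) \<and>
     (\<forall>z. b z \<in> of_real ` {0..1})"
proof -
  define c where "c = (3/4 * \<rho>)\<^sup>2 - (\<rho>/2)\<^sup>2"
  have c: "c > 0" using assms by (simp add: c_def power2_eq_square)
  define h where "h = (\<lambda>x::real. max 0 x ^ 3)"
  define h1 where "h1 = (\<lambda>x::real. 3 * max 0 x ^ 2)"
  define h2 where "h2 = (\<lambda>x::real. 6 * max 0 x)"
  have dh: "(h has_real_derivative h1 x) (at x)" for x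
    using has_real_derivative_pos_part_power[of 1 x] by (simp add: h_def h1_def numeral_eq_Suc)
  have dh1: "(h1 has_real_derivative h2 x) (at x)" for x
    using DERIV_cmult[OF has_real_derivative_pos_part_power[of 0 x], of 3] by (simp add: h1_def h2_def numeral_eq_Suc)
  have ch2: "continuous_on S h2" for S unfolding h2_def by (intro continuous_intros)
  have ch1: "continuous_on S h1" for S unfolding h1_def by (intro continuous_intros)
  have ch: "continuous_on S h" for S unfolding h_def by (intro continuous_intros)
  define y where "y = (\<lambda>x. (x - (\<rho>/2)\<^sup>2) / c)"
  have dy: "(y has_real_derivative 1 / c) (at x)" for x
    unfolding y_def using c by (auto intro!: derivative_eq_intros)
  have cy: "continuous_on S y" for S unfolding y_def by (intro continuous_intros) (use c in auto)
  define s where "s = (\<lambda>x. h (1 - h (y x)))"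
  define s1 where "s1 = (\<lambda>x. h1 (1 - h (y x)) * (- (h1 (y x) * (1 / c))))"
  define s2 where "s2 = (\<lambda>x. h1 (1 - h (y x)) * (- (h2 (y x) * (1 / c) * (1/c)))
      + h2 (1 - h (y x)) * (- (h1 (y x) * (1 / c))) * (- (h1 (y x) * (1 / c))))"
  have dhy: "((\<lambda>x. 1 - h (y x)) has_real_derivative - (h1 (y x) * (1 / c))) (at x)" for x
    using DERIV_diff[OF DERIV_const DERIV_chain2[OF dh dy]] by simp
  have ds: "(s has_real_derivative s1 x) (at x)" for x
    unfolding s_def s1_def by (rule DERIV_chain2[OF dh dhy])
  have ds1: "(s1 has_real_derivative s2 x) (at x)" for x
    unfolding s1_def s2_def
    by (rule DERIV_mult'[OF DERIV_chain2[OF dh1 dhy] DERIV_minus[OF DERIV_cmult_right[OF DERIV_chain2[OF dh1 dy]]]])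
  have cs1: "continuous_on UNIV s1"
    using DERIV_isCont[OF ds1] by (simp add: continuous_at_imp_continuous_on)
  have chy: "continuous_on UNIV (\<lambda>x. h (y x))" "continuous_on UNIV (\<lambda>x. h1 (y x))" "continuous_on UNIV (\<lambda>x. h2 (y x))"
    by (rule continuous_on_compose2[OF ch[of UNIV] cy] continuous_on_compose2[OF ch1[of UNIV] cy] continuous_on_compose2[OF ch2[of UNIV] cy], simp)+
  have chh: "continuous_on UNIV (\<lambda>x. h1 (1 - h (y x)))" "continuous_on UNIV (\<lambda>x. h2 (1 - h (y x)))"
    by (rule continuous_on_compose2[OF ch1[of UNIV]] continuous_on_compose2[OF ch2[of UNIV]],
        intro continuous_intros chy, simp)+
  have cs2: "continuous_on UNIV s2" unfolding s2_def
    by (intro continuous_on_mult continuous_on_add continuous_on_minus chy chh continuous_on_const)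
  let ?b = "\<lambda>z. complex_of_real (s ((cmod (z - p))\<^sup>2))"
  let ?B = "\<lambda>z. complex_of_real (s1 ((cmod (z - p))\<^sup>2)) * (z - p)"
  have "C1_dbar (\<lambda>z. z - p) (\<lambda>_. 0)"
    unfolding C1_dbar_def
    by (rule exI[of _ "\<lambda>_. 1"]) (auto intro!: has_wirtinger_field derivative_eq_intros)
  then have 1: "C2_dbar ?b ?B"
    unfolding C2_dbar_def
    using C1_dbar_radial[OF ds cs1] C1_dbar_mult[OF C1_dbar_radial[OF ds1 cs2]] by blast
  have 2: "?b z = 1" if "z \<in> ball p (\<rho>/2)" for z
  proof -
    have "(cmod (z - p))\<^sup>2 \<le> (\<rho>/2)\<^sup>2"
      using that by (intro power_mono) (auto simp: dist_norm norm_minus_commute)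
    then have "y ((cmod (z - p))\<^sup>2) \<le> 0" using c by (simp add: y_def divide_le_0_iff)
    then show ?thesis by (simp add: s_def h_def max_def)
  qed
  have 3: "?b z = 0" if "z \<notin> cball p (3/4*\<rho>)" for z
  proof -
    have "(cmod (z - p))\<^sup>2 \<ge> (3/4 * \<rho>)\<^sup>2"
      using that assms by (intro power_mono) (auto simp: dist_norm norm_minus_commute)
    then have "y ((cmod (z - p))\<^sup>2) \<ge> 1" using c by (simp add: y_def c_def)
    then have "h (y ((cmod (z - p))\<^sup>2)) \<ge> 1" by (simp add: h_def max_def)
    then show ?thesis by (simp add: s_def h_def max_def)
  qed
  have "s x \<in> {0..1}" for x
  proof -
    have "0 \<le> h (y x)" by (simp add: h_def)
    then have "max 0 (1 - h (y x)) \<le> 1" by simp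
    then show ?thesis unfolding s_def by (simp add: h_def power_le_one)
  qed
  then have 4: "?b z \<in> of_real ` {0..1}" for z by blast
  show ?thesis using 1 2 3 4 by blast
qed

text \<open>Each \<open>\<psi> i\<close> is \<open>b i\<close> times the product of the factors 1 -
  \<open>b j\<close> of the indices treated before it, so the defect of the sum from 1 telescopes to
  a product. The sum is therefore 1 wherever some \<open>b i\<close> is 1, without division by a sum
  of bumps.\<close>

lemma partition_exists:
  assumes "finite I" "\<And>i. i \<in> I \<Longrightarrow> \<exists>B. C2_dbar (b i) B"
  shows "\<exists>\<psi> X. (\<forall>i\<in>I. C2_dbar (\<psi> i) (X i) \<and> (\<forall>z. b i z = 0 \<longrightarrow> \<psi> i z = 0)) \<and>
     (\<forall>z. 1 - (\<Sum>i\<in>I. \<psi> i z) = (\<Prod>i\<in>I. 1 - b i z))"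
  using assms
proof (induction I)
  case empty
  then show ?case by simp
next
  case (insert j I)
  then obtain \<psi> X where IH: "\<And>i. i \<in> I \<Longrightarrow> C2_dbar (\<psi> i) (X i)" "\<And>i z. i \<in> I \<Longrightarrow> b i z = 0 \<Longrightarrow> \<psi> i z = 0"
    "\<And>z. 1 - (\<Sum>i\<in>I. \<psi> i z) = (\<Prod>i\<in>I. 1 - b i z)"
    by (metis insertCI)
  obtain B where B: "C2_dbar (b j) B" using insert by blast
  define \<psi>j where "\<psi>j = (\<lambda>z. b j z * (1 - (\<Sum>i\<in>I. \<psi> i z)))"
  have "C2_dbar (\<lambda>z. \<Sum>i\<in>I. \<psi> i z) (\<lambda>z. \<Sum>i\<in>I. X i z)"
    by (rule C2_dbar_sum[OF insert(1) IH(1)])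
  from C2_dbar_mult[OF B C2_dbar_minus[OF C2_dbar_const[of 1] this]]
  obtain Xj where Xj: "C2_dbar \<psi>j Xj"
    unfolding \<psi>j_def by blast
  have sumI: "(\<Sum>i\<in>I. (\<psi>(j := \<psi>j)) i z) = (\<Sum>i\<in>I. \<psi> i z)" for z
    using insert(2) by (intro sum.cong) auto
  have "1 - (\<Sum>i\<in>insert j I. (\<psi>(j := \<psi>j)) i z) = (\<Prod>i\<in>insert j I. 1 - b i z)" for z
  proof -
    have "1 - (\<Sum>i\<in>insert j I. (\<psi>(j := \<psi>j)) i z) = 1 - (\<psi>j z + (\<Sum>i\<in>I. \<psi> i z))"
      using insert(1,2) sumI by simp
    also have "\<dots> = (1 - b j z) * (1 - (\<Sum>i\<in>I. \<psi> i z))"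
      unfolding \<psi>j_def by (simp add: algebra_simps)
    finally show ?thesis using insert(1,2) IH(3) by simp
  qed
  moreover have "C2_dbar ((\<psi>(j := \<psi>j)) i) ((X(j := Xj)) i) \<and> (\<forall>z. b i z = 0 \<longrightarrow> (\<psi>(j := \<psi>j)) i z = 0)"
    if "i \<in> insert j I" for i
    using that IH Xj insert(2) by (auto simp: \<psi>j_def)
  ultimately show ?case by blast
qed

text \<open>Three radii have three roles: the discs of radius \<rho>/2 cover and carry the sum 1,
  the functions live on the closed discs of radius 3\<rho>/4, and the open discs of radius \<rho>
  leave room for the data to be glued. The norm bound holds because the defect is a product of
  numbers in [0,1].\<close>

lemma subordinate_partition_exists:
  assumes K: "compact K" and \<rho>: "\<And>p. p \<in> K \<Longrightarrow> \<rho> p > 0"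
  obtains P \<psi> X where "P \<subseteq> K" "finite P" "K \<subseteq> (\<Union>p\<in>P. ball p (\<rho> p / 2))"
    "\<And>p. p \<in> P \<Longrightarrow> C2_dbar (\<psi> p) (X p)" "\<And>p z. p \<in> P \<Longrightarrow> z \<notin> cball p (3/4 * \<rho> p) \<Longrightarrow> \<psi> p z = 0"
    "\<And>z. z \<in> (\<Union>p\<in>P. ball p (\<rho> p / 2)) \<Longrightarrow> (\<Sum>p\<in>P. \<psi> p z) = 1" "\<And>z. norm (\<Sum>p\<in>P. \<psi> p z) \<le> 1"
proof -
  have "K \<subseteq> (\<Union>p\<in>K. ball p (\<rho> p / 2))" using \<rho> by force
  then obtain P where P: "P \<subseteq> K" "finite P" "K \<subseteq> (\<Union>p\<in>P. ball p (\<rho> p / 2))"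
    using compactE_image[OF K, of K "\<lambda>p. ball p (\<rho> p / 2)"] by auto
  have "\<forall>p\<in>P. \<exists>b. (\<exists>B. C2_dbar b B) \<and> (\<forall>z\<in>ball p (\<rho> p/2). b z = 1) \<and> (\<forall>z. z \<notin> cball p (3/4*\<rho> p) \<longrightarrow> b z = 0) \<and>
     (\<forall>z. b z \<in> of_real ` {0..1})"
  proof
    fix p assume "p \<in> P"
    then have "\<rho> p > 0" using \<rho> P(1) by blast
    from bump_exists[OF this, of p] show "\<exists>b. (\<exists>B. C2_dbar b B) \<and> (\<forall>z\<in>ball p (\<rho> p/2). b z = 1) \<and>
      (\<forall>z. z \<notin> cball p (3/4*\<rho> p) \<longrightarrow> b z = 0) \<and> (\<forall>z. b z \<in> of_real ` {0..1})" by blast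
  qed
  then obtain b where b: "\<And>p. p \<in> P \<Longrightarrow> \<exists>B. C2_dbar (b p) B" "\<And>p z. p \<in> P \<Longrightarrow> z\<in>ball p (\<rho> p/2) \<Longrightarrow> b p z = 1"
    "\<And>p z. p \<in> P \<Longrightarrow> z \<notin> cball p (3/4*\<rho> p) \<Longrightarrow> b p z = 0" "\<And>p z. p \<in> P \<Longrightarrow> b p z \<in> of_real ` {0..1}"
    by metis
  obtain \<psi> X where \<psi>: "\<And>i. i \<in> P \<Longrightarrow> C2_dbar (\<psi> i) (X i)" "\<And>i z. i \<in> P \<Longrightarrow> b i z = 0 \<Longrightarrow> \<psi> i z = 0"
     "\<And>z. 1 - (\<Sum>i\<in>P. \<psi> i z) = (\<Prod>i\<in>P. 1 - b i z)"
    using partition_exists[of P b] P b by blast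
  have sum_eq: "(\<Sum>i\<in>P. \<psi> i z) = 1 - (\<Prod>i\<in>P. 1 - b i z)" for z using \<psi>(3)[of z] by (simp add: algebra_simps)
  have "(\<Sum>p\<in>P. \<psi> p z) = 1" if z: "z \<in> (\<Union>p\<in>P. ball p (\<rho> p / 2))" for z
  proof -
    obtain p where "p \<in> P" "z \<in> ball p (\<rho> p / 2)" using z by blast
    then have "p \<in> P" "1 - b p z = 0" using b(2) by auto
    then have "(\<Prod>i\<in>P. 1 - b i z) = 0" using P(2) by (auto simp: prod_zero_iff)
    then show ?thesis by (simp add: sum_eq)
  qed
  moreover have "norm (\<Sum>p\<in>P. \<psi> p z) \<le> 1" for z
  proof -
    have "\<forall>p\<in>P. \<exists>t. b p z = of_real t \<and> t \<in> {0..1}" using b(4) by blast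
    then obtain t where t: "\<And>p. p \<in> P \<Longrightarrow> b p z = of_real (t p)" "\<And>p. p \<in> P \<Longrightarrow> t p \<in> {0..1}" by metis
    have "(\<Prod>i\<in>P. 1 - b i z) = of_real (\<Prod>i\<in>P. 1 - t i)"
      unfolding of_real_prod by (rule prod.cong) (use t in auto)
    moreover have "0 \<le> (\<Prod>i\<in>P. 1 - t i)" "(\<Prod>i\<in>P. 1 - t i) \<le> 1"
      using t(2) by (auto intro!: prod_nonneg prod_le_1)
    ultimately have "(\<Sum>p\<in>P. \<psi> p z) = of_real (1 - (\<Prod>i\<in>P. 1 - t i))" "\<bar>1 - (\<Prod>i\<in>P. 1 - t i)\<bar> \<le> 1"
      by (auto simp: sum_eq)
    then show ?thesis by (metis norm_of_real)
  qed
  moreover have "\<psi> p z = 0" if "p \<in> P" "z \<notin> cball p (3/4 * \<rho> p)" for p z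
    using \<psi>(2) b(3) that by blast
  ultimately show thesis by (intro that[OF P \<psi>(1)])
qed

text \<open>The cutoff is the sum of a partition subordinate to discs inside \<open>U\<close>; as
  the discs are finitely many, \<open>S\<close> is closed. It is 1 on an open set \<open>V\<close>,
  not just on \<open>K\<close>, so that its d-bar derivative vanishes near \<open>K\<close>.\<close>

lemma cutoff_exists:
  assumes K: "compact K" and U: "open U" "K \<subseteq> U"
  shows "\<exists>\<eta> E V S. C2_dbar \<eta> E \<and> open V \<and> K \<subseteq> V \<and> V \<subseteq> U \<and> (\<forall>z\<in>V. \<eta> z = 1) \<and>
     closed S \<and> S \<subseteq> U \<and> (\<forall>z. z \<notin> S \<longrightarrow> \<eta> z = 0) \<and> (\<forall>z. norm (\<eta> z) \<le> 1)"
proof -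
  have "\<forall>p\<in>K. \<exists>\<rho>>0. ball p \<rho> \<subseteq> U" using U by (meson openE subsetD)
  then obtain \<rho> where \<rho>: "\<And>p. p \<in> K \<Longrightarrow> \<rho> p > 0" "\<And>p. p \<in> K \<Longrightarrow> ball p (\<rho> p) \<subseteq> U" by metis
  obtain P \<psi> X where P: "P \<subseteq> K" "finite P" "K \<subseteq> (\<Union>p\<in>P. ball p (\<rho> p / 2))"
    and \<psi>: "\<And>p. p \<in> P \<Longrightarrow> C2_dbar (\<psi> p) (X p)" "\<And>p z. p \<in> P \<Longrightarrow> z \<notin> cball p (3/4 * \<rho> p) \<Longrightarrow> \<psi> p z = 0"
     "\<And>z. z \<in> (\<Union>p\<in>P. ball p (\<rho> p / 2)) \<Longrightarrow> (\<Sum>p\<in>P. \<psi> p z) = 1" "\<And>z. norm (\<Sum>p\<in>P. \<psi> p z) \<le> 1"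
    by (rule subordinate_partition_exists[OF K, of \<rho>]) (rule \<rho>(1), assumption, rule that)
  define \<eta> where "\<eta> = (\<lambda>z. \<Sum>i\<in>P. \<psi> i z)"
  define V where "V = (\<Union>p\<in>P. ball p (\<rho> p / 2))"
  define S where "S = (\<Union>p\<in>P. cball p (3/4 * \<rho> p))"
  have sub: "ball p (\<rho> p / 2) \<subseteq> U" "cball p (3/4 * \<rho> p) \<subseteq> U" if p: "p \<in> P" for p
  proof -
    have "\<rho> p > 0" "ball p (\<rho> p) \<subseteq> U" using p P(1) \<rho> by auto
    then have "ball p (\<rho> p / 2) \<subseteq> ball p (\<rho> p)" "cball p (3/4 * \<rho> p) \<subseteq> ball p (\<rho> p)" by auto
    then show "ball p (\<rho> p / 2) \<subseteq> U" "cball p (3/4 * \<rho> p) \<subseteq> U" using \<open>ball p (\<rho> p) \<subseteq> U\<close> by blast+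
  qed
  have "C2_dbar \<eta> (\<lambda>z. \<Sum>i\<in>P. X i z)" unfolding \<eta>_def by (rule C2_dbar_sum[OF P(2) \<psi>(1)])
  moreover have "open V" "K \<subseteq> V" using P(3) unfolding V_def by auto
  moreover have "V \<subseteq> U" "S \<subseteq> U" unfolding V_def S_def using sub by blast+
  moreover have "\<eta> z = 1" if "z \<in> V" for z using \<psi>(3) that unfolding \<eta>_def V_def .
  moreover have "closed S" unfolding S_def using P(2) by auto
  moreover have "\<eta> z = 0" if "z \<notin> S" for z
    unfolding \<eta>_def by (rule sum.neutral) (use that \<psi>(2) in \<open>auto simp: S_def\<close>)
  moreover have "norm (\<eta> z) \<le> 1" for z unfolding \<eta>_def by (rule \<psi>(4))
  ultimately show ?thesis
    by (intro exI[of _ \<eta>] exI[of _ "\<lambda>z. \<Sum>i\<in>P. X i z"] exI[of _ V] exI[of _ S]) simp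
qed

lemma bounded_support_bound:
  fixes X :: "complex \<Rightarrow> complex"
  assumes "continuous_on UNIV X" "\<And>z. z \<notin> cball p r \<Longrightarrow> X z = 0"
  shows "\<exists>C\<ge>0. \<forall>z. norm (X z) \<le> C"
proof -
  have "bounded (X ` cball p r)"
    by (intro compact_imp_bounded compact_continuous_image continuous_on_subset[OF assms(1)]) auto
  then obtain C where C: "\<And>z. z \<in> cball p r \<Longrightarrow> norm (X z) \<le> C"
    unfolding bounded_iff by blast
  show ?thesis
  proof (intro exI[of _ "max C 0"] conjI allI)
    show "cmod (X z) \<le> max C 0" for z
      using C[of z] assms(2)[of z] by (cases "z \<in> cball p r") auto
  qed simp
qed

section \<open>Glueing inward translates\<close>

definition inward_shiftable :: "complex set \<Rightarrow> bool" where
  "inward_shiftable \<Omega> \<longleftrightarrow> (\<forall>p\<in>closure \<Omega>. \<exists>n \<rho> \<epsilon>. \<rho> > 0 \<and> \<epsilon> > 0 \<and> norm n \<le> 1 \<and>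
     (\<forall>z\<in>closure \<Omega> \<inter> ball p \<rho>. \<forall>t. 0 < t \<and> t < \<epsilon> \<longrightarrow> z + of_real t * n \<in> \<Omega>))"

text \<open>The d-bar derivative of the glued function is the sum of
  \<open>X p z * (kk p z - k z)\<close> on \<Omega>, hence O(t) by the bound on
  \<open>deriv k\<close>. A cutoff makes this datum global without enlarging it, and its Cauchy
  transform over a disc of fixed radius is O(t) as well.\<close>

theorem holomorphic_approx_closure:
  assumes \<Omega>: "open \<Omega>" "bounded \<Omega>" "inward_shiftable \<Omega>"
    and k: "k holomorphic_on \<Omega>" and M: "\<And>z. z \<in> \<Omega> \<Longrightarrow> norm (deriv k z) \<le> M"
    and e: "e > 0"
  shows "\<exists>H V. open V \<and> closure \<Omega> \<subseteq> V \<and> H holomorphic_on V \<and> (\<forall>z\<in>\<Omega>. norm (H z - k z) \<le> e)"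
proof -
  obtain n \<rho> \<epsilon> where n: "\<And>p. p \<in> closure \<Omega> \<Longrightarrow> \<rho> p > 0" "\<And>p. p \<in> closure \<Omega> \<Longrightarrow> \<epsilon> p > 0"
    "\<And>p. p \<in> closure \<Omega> \<Longrightarrow> norm (n p) \<le> 1"
    "\<And>p z t. p \<in> closure \<Omega> \<Longrightarrow> z \<in> closure \<Omega> \<Longrightarrow> z \<in> ball p (\<rho> p) \<Longrightarrow> 0 < t \<Longrightarrow> t < \<epsilon> p \<Longrightarrow> z + of_real t * n p \<in> \<Omega>"
    using \<Omega>(3) unfolding inward_shiftable_def by (metis IntI)
  have K: "compact (closure \<Omega>)" using \<Omega>(2) by (simp add: compact_closure)
  obtain P \<psi> X where P: "P \<subseteq> closure \<Omega>" "finite P" "closure \<Omega> \<subseteq> (\<Union>p\<in>P. ball p (\<rho> p / 2))"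
    and \<psi>': "\<And>p. p \<in> P \<Longrightarrow> C2_dbar (\<psi> p) (X p)"
    and \<psi>0: "\<And>p z. p \<in> P \<Longrightarrow> z \<notin> cball p (3/4 * \<rho> p) \<Longrightarrow> \<psi> p z = 0"
    and sum1': "\<And>z. z \<in> (\<Union>p\<in>P. ball p (\<rho> p / 2)) \<Longrightarrow> (\<Sum>p\<in>P. \<psi> p z) = 1"
    by (rule subordinate_partition_exists[OF K, of \<rho>]) (rule n(1), assumption, rule that)
  have \<rho>P: "\<rho> p > 0" "\<epsilon> p > 0" "norm (n p) \<le> 1" if "p \<in> P" for p using n P that by auto
  define W where "W = (\<Union>p\<in>P. ball p (\<rho> p / 2))"
  have W: "open W" "closure \<Omega> \<subseteq> W" using P(3) by (auto simp: W_def)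
  have "bounded W" unfolding W_def using P(2) by auto
  then obtain R where R: "R > 0" "W \<subseteq> ball 0 R" using bounded_subset_ballD by blast
  have \<psi>: "C1_dbar (\<psi> i) (X i)" "C1_dbar (X i) (SOME B. C1_dbar (X i) B)" if "i \<in> P" for i
    using \<psi>'[OF that] someI_ex unfolding C2_dbar_def by (blast, metis)
  have X0: "X p z = 0" if "p \<in> P" "z \<notin> cball p (3/4 * \<rho> p)" for p z
    by (rule C1_dbar_zero_on[OF \<psi>(1)[OF that(1)], where U="- cball p (3/4 * \<rho> p)" and c=0]) (use that \<psi>0 in auto)
  have sum1: "(\<Sum>p\<in>P. \<psi> p z) = 1" if "z \<in> W" for z
    using sum1' that unfolding W_def .
  \<comment> \<open>The partition sums to the constant 1 on the open set \<open>W\<close>;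
    differentiating gives the cancellation that brings the differences \<open>kk p z - k z\<close>
    into the estimate of \<open>G\<close>.\<close>
  have sum0: "(\<Sum>p\<in>P. X p z) = 0" if "z \<in> W" for z
    by (rule C1_dbar_zero_on[OF C1_dbar_sum[OF P(2) \<psi>(1)] W(1) that, where c=1]) (use sum1 in auto)
  have "\<forall>p\<in>P. \<exists>C\<ge>0. \<forall>z. norm (X p z) \<le> C"
    using bounded_support_bound[OF C1_dbar_cont'[OF \<psi>(1)] X0] by blast
  then obtain C where C: "\<And>p. p \<in> P \<Longrightarrow> C p \<ge> 0" "\<And>p z. p \<in> P \<Longrightarrow> norm (X p z) \<le> C p" by metis
  have "\<forall>p\<in>P. \<exists>C\<ge>0. \<forall>z. norm (\<psi> p z) \<le> C"
    using bounded_support_bound[OF C1_dbar_cont[OF \<psi>(1)] \<psi>0] by blast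
  then obtain D where D: "\<And>p. p \<in> P \<Longrightarrow> D p \<ge> 0" "\<And>p z. p \<in> P \<Longrightarrow> norm (\<psi> p z) \<le> D p" by metis
  define CC where "CC = sum C P"
  define DD where "DD = sum D P"
  have CD: "CC \<ge> 0" "DD \<ge> 0" using C D by (auto simp: CC_def DD_def intro: sum_nonneg)
  define M' where "M' = max M 0"
  have M': "M' \<ge> 0" "\<And>z. z \<in> \<Omega> \<Longrightarrow> norm (deriv k z) \<le> M'" using M by (force simp: M'_def)+
  \<comment> \<open>\<open>L * t\<close> is the total error: \<open>DD * M' * t\<close> from
    replacing \<open>k\<close> by its translates, plus the bound on the Cauchy transform of a datum
    of size \<open>\<delta>\<close>, which is (\<open>CC * M' + 1\<close>) times t.\<close>
  define L where "L = DD * M' + 2 * (2 * R) * (CC * M' + 1)"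
  have L: "L \<ge> 0" using CD M' R by (simp add: L_def)
  \<comment> \<open>Halving the minimum yields the strict inequality t <
    \<open>\<epsilon> p\<close>; \<open>L + 1\<close> keeps the divisor positive.\<close>
  define t where "t = Min (insert (e / (L + 1)) (\<epsilon> ` P)) / 2"
  have t0: "t > 0" using P(2) e L \<rho>P(2) by (auto simp: t_def)
  have "2 * t \<le> x" if "x \<in> insert (e / (L + 1)) (\<epsilon> ` P)" for x
    using P(2) that by (auto simp: t_def)
  then have t: "2 * t \<le> e / (L + 1)" "\<And>p. p \<in> P \<Longrightarrow> 2 * t \<le> \<epsilon> p" by auto
  have Lt: "L * t \<le> e"
  proof -
    have "L * t \<le> (L + 1) * (2 * t)" using t0 L by (intro mult_mono) auto
    also have "\<dots> \<le> e" using t(1) L by (simp add: field_simps)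
    finally show ?thesis .
  qed
  have shift: "z + of_real s * n p \<in> \<Omega>" if "p \<in> P" "z \<in> closure \<Omega>" "z \<in> cball p (3/4 * \<rho> p)" "0 < s" "s \<le> t" for p z s
  proof (rule n(4))
    show "z \<in> ball p (\<rho> p)" using that \<rho>P(1)[OF that(1)] by auto
    show "s < \<epsilon> p" using t(2)[OF that(1)] that t0 by linarith
  qed (use that P in auto)
  define kk where "kk = (\<lambda>p z. k (z + of_real t * n p))"
  define Sh where "Sh = (\<lambda>p. {z. z + of_real t * n p \<in> \<Omega>})"
  have Sh: "open (Sh p)" for p
  proof -
    have "Sh p = (\<lambda>z. z + of_real t * n p) -` \<Omega>" by (auto simp: Sh_def)
    then show ?thesis using \<Omega>(1) by (simp add: open_vimage continuous_on_add)
  qed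
  have kkO: "kk p holomorphic_on Sh p" for p
  proof -
    have "(k \<circ> (\<lambda>z. z + of_real t * n p)) holomorphic_on Sh p"
      by (rule holomorphic_on_compose_gen[OF _ k]) (auto simp: Sh_def intro!: holomorphic_intros)
    then show ?thesis by (simp add: kk_def o_def)
  qed
  have close: "norm (kk p z - k z) \<le> M' * t" if "p \<in> P" "z \<in> \<Omega>" "z \<in> cball p (3/4 * \<rho> p)" for p z
  proof -
    \<comment> \<open>Mean value inequality along the path of the translation. The segment stays in
      \<Omega>: it starts at z, and its later points are shorter admissible shifts of z.\<close>
    let ?S = "closed_segment z (z + of_real t * n p)"
    have sub: "?S \<subseteq> \<Omega>"
    proof
      fix x assume "x \<in> ?S"
      then obtain u where u: "0 \<le> u" "u \<le> 1" "x = (1 - u) *\<^sub>R z + u *\<^sub>R (z + of_real t * n p)"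
        by (auto simp: in_segment)
      then have x: "x = z + of_real (u * t) * n p" by (simp add: scaleR_conv_of_real algebra_simps)
      show "x \<in> \<Omega>"
      proof (cases "u = 0")
        case False
        then show ?thesis unfolding x
          using u t0 that closure_subset[of \<Omega>] by (intro shift) (auto simp: mult_left_le_one_le)
      qed (use x that in simp)
    qed
    have "norm (k (z + of_real t * n p) - k z) \<le> M' * norm ((z + of_real t * n p) - z)"
    proof (rule field_differentiable_bound)
      show "convex ?S" by simp
      show "(k has_field_derivative deriv k x) (at x within ?S)" if "x \<in> ?S" for x
        using holomorphic_derivI[OF k \<Omega>(1)] sub that by (meson DERIV_subset subsetD has_field_derivative_at_within)
    qed (use sub M' in auto)
    also have "\<dots> \<le> M' * t"
    proof -
      have "norm (of_real t * n p) \<le> t * 1" unfolding norm_mult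
        using t0 \<rho>P(3)[OF that(1)] by (intro mult_mono) auto
      then show ?thesis using M' by (simp add: mult_left_mono)
    qed
    finally show ?thesis by (simp add: kk_def)
  qed
  \<comment> \<open>At a point of \<open>U0\<close> each summand is either defined, because the
    translate lands in \<Omega>, or zero, because the point lies off the closed disc that carries
    \<open>\<psi> p\<close> and \<open>X p\<close>.\<close>
  define U0 where "U0 = W \<inter> (\<Inter>p\<in>P. Sh p \<union> - cball p (3/4 * \<rho> p))"
  have U0: "open U0" unfolding U0_def using W(1) P(2) Sh by (intro open_Int open_INT) auto
  have KU0: "closure \<Omega> \<subseteq> U0"
    unfolding U0_def using W(2) shift[OF _ _ _ t0] by (auto simp: Sh_def)
  define G where "G = (\<lambda>z. \<Sum>p\<in>P. X p z * kk p z)"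
  have contG: "continuous_on U0 G"
    unfolding G_def
  proof (rule continuous_on_sum)
    fix p assume p: "p \<in> P"
    have "continuous_on (Sh p \<union> - cball p (3/4 * \<rho> p)) (\<lambda>z. X p z * kk p z)"
    proof (rule continuous_on_open_Un)
      show "continuous_on (Sh p) (\<lambda>z. X p z * kk p z)"
        by (intro continuous_intros C1_dbar_cont'[OF \<psi>(1)[OF p]] holomorphic_on_imp_continuous_on kkO)
      have "continuous_on (- cball p (3/4 * \<rho> p)) (\<lambda>z. 0 :: complex)" by simp
      then show "continuous_on (- cball p (3/4 * \<rho> p)) (\<lambda>z. X p z * kk p z)"
        by (rule continuous_on_eq) (use X0[OF p] in auto)
    qed (use Sh in auto)
    then show "continuous_on U0 (\<lambda>z. X p z * kk p z)"
      by (rule continuous_on_subset) (use p in \<open>auto simp: U0_def\<close>)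
  qed
  have G\<Omega>: "norm (G z) \<le> CC * (M' * t)" if "z \<in> \<Omega>" for z
  proof -
    have zW: "z \<in> W" using that W(2) closure_subset by blast
    have "G z = (\<Sum>p\<in>P. X p z * (kk p z - k z))"
      unfolding G_def right_diff_distrib sum_subtractf sum_distrib_right[symmetric] sum0[OF zW] by simp
    also have "norm \<dots> \<le> (\<Sum>p\<in>P. C p * (M' * t))"
    proof (rule sum_norm_le)
      fix p assume p: "p \<in> P"
      show "norm (X p z * (kk p z - k z)) \<le> C p * (M' * t)"
      proof (cases "z \<in> cball p (3/4 * \<rho> p)")
        case True
        then show ?thesis unfolding norm_mult using C[OF p] close[OF p that True] by (intro mult_mono) auto
      next
        case False
        then show ?thesis using X0[OF p False] C(1)[OF p] M' t0 by simp
      qed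
    qed
    also have "\<dots> = CC * (M' * t)" by (simp add: CC_def sum_distrib_right)
    finally show ?thesis .
  qed
  \<comment> \<open>The summand 1 makes this strictly larger than the bound
    \<open>CC * (M' * t)\<close>, which holds on the closure; so the open set \<open>U\<close> below
    contains the closure.\<close>
  define \<delta> where "\<delta> = (CC * M' + 1) * t"
  have \<delta>0: "\<delta> > 0" using CD M' t0 by (auto simp: \<delta>_def intro!: mult_pos_pos add_nonneg_pos)
  define U where "U = U0 \<inter> G -` ball 0 \<delta>"
  have U: "open U" unfolding U_def by (rule continuous_open_preimage[OF contG U0]) simp
  have KU: "closure \<Omega> \<subseteq> U"
  proof
    fix z assume z: "z \<in> closure \<Omega>"
    have "norm (G z) \<le> CC * (M' * t)"
      by (rule continuous_on_closure_norm_le[OF continuous_on_subset[OF contG KU0] _ z]) (use G\<Omega> in auto)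
    then have "norm (G z) < \<delta>" using t0 by (simp add: \<delta>_def algebra_simps)
    then show "z \<in> U" using z KU0 by (auto simp: U_def)
  qed
  \<comment> \<open>The cutoff is supported where |G| < \<open>\<delta>\<close>, so the product of
    \<open>\<eta>\<close> and \<open>G\<close> is small on the whole plane, although
    \<open>G\<close> itself is controlled only near the closure.\<close>
  obtain \<eta> E V S where \<eta>: "C2_dbar \<eta> E" "open V" "closure \<Omega> \<subseteq> V" "V \<subseteq> U" "\<And>z. z \<in> V \<Longrightarrow> \<eta> z = 1"
     "closed S" "S \<subseteq> U" "\<And>z. z \<notin> S \<Longrightarrow> \<eta> z = 0" "\<And>z. norm (\<eta> z) \<le> 1"
    using cutoff_exists[OF K U KU] by blast
  have \<eta>1: "C1_dbar \<eta> E" using \<eta>(1) by (rule C2_dbar_imp_C1)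
  have E0: "E z = 0" if "z \<in> V" for z
    by (rule C1_dbar_zero_on[OF \<eta>1 \<eta>(2) that \<eta>(5)])
  have SO: "S \<inter> cball p (3/4 * \<rho> p) \<subseteq> Sh p" if "p \<in> P" for p
    using \<eta>(7) that by (auto simp: U_def U0_def)
  have closedS: "closed (S \<inter> cball p (3/4 * \<rho> p))" for p using \<eta>(6) by auto
  have glue: "C1_dbar (\<lambda>z. (\<eta> z * Y z) * kk p z) (\<lambda>z. (\<eta> z * Y' z + E z * Y z) * kk p z)"
    if "p \<in> P" "C1_dbar Y Y'" "\<And>z. z \<notin> cball p (3/4 * \<rho> p) \<Longrightarrow> Y z = 0" for p Y Y'
    by (rule C1_dbar_mult_holomorphic[OF C1_dbar_mult[OF \<eta>1 that(2)] kkO Sh closedS SO[OF that(1)]])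
      (use \<eta>(8) that(3) in auto)
  define g where "g = (\<lambda>z. \<Sum>p\<in>P. (\<eta> z * X p z) * kk p z)"
  define F where "F = (\<lambda>z. \<Sum>p\<in>P. (\<eta> z * \<psi> p z) * kk p z)"
  define g' where "g' = (\<lambda>z. \<Sum>p\<in>P. (\<eta> z * (SOME B. C1_dbar (X p) B) z + E z * X p z) * kk p z)"
  have gC1: "C1_dbar g g'"
    unfolding g_def g'_def by (rule C1_dbar_sum[OF P(2)]) (rule glue[OF _ \<psi>(2)]; use X0 in simp)
  have FC1: "C1_dbar F (\<lambda>z. \<Sum>p\<in>P. (\<eta> z * X p z + E z * \<psi> p z) * kk p z)"
    unfolding F_def by (rule C1_dbar_sum[OF P(2)]) (rule glue[OF _ \<psi>(1)]; use \<psi>0 in simp)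
  have gG: "g z = \<eta> z * G z" for z by (simp add: g_def G_def sum_distrib_left mult.assoc)
  have g0: "g z = 0" if "z \<notin> S" for z using \<eta>(8)[OF that] by (simp add: gG)
  have gle: "norm (g z) \<le> \<delta>" for z
  proof (cases "z \<in> S")
    case True
    then have "norm (G z) \<le> \<delta>" using \<eta>(7) by (auto simp: U_def)
    then have "norm (\<eta> z) * norm (G z) \<le> 1 * \<delta>" using \<eta>(9) by (intro mult_mono) auto
    then show ?thesis by (simp add: gG norm_mult)
  qed (use g0 \<delta>0 in auto)
  obtain A where A: "continuous_on UNIV A" "continuous_on UNIV g'" "\<And>z. has_wirtinger g (A z) (g' z) z"
    using gC1 unfolding C1_dbar_def by blast
  have "C1_dbar (cauchy_transform (2 * R) g) (cauchy_transform (2 * R) g')"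
    unfolding C1_dbar_def
    using continuous_cauchy_transform[OF A(1)] continuous_cauchy_transform[OF A(2)] cauchy_transform_has_wirtinger[OF A]
    by blast
  note HC1 = C1_dbar_minus[OF FC1 this]
  \<comment> \<open>The radius is 2R because \<open>V\<close> and \<open>S\<close> both lie in the
    disc of radius R about 0: the circle of radius 2R about a point of \<open>V\<close> misses the
    support of \<open>g\<close>, which is the condition for solving the equation at that
    point.\<close>
  define H where "H = (\<lambda>z. F z - cauchy_transform (2 * R) g z)"
  have "H holomorphic_on V"
    unfolding H_def
  proof (rule C1_dbar_zero_imp_holomorphic[OF HC1 \<eta>(2)])
    fix z assume z: "z \<in> V"
    have zR: "norm z < R" using z \<eta>(4) R(2) by (auto simp: U_def U0_def)
    have "cauchy_transform (2 * R) g' z = g z"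
    proof (rule cauchy_transform_dbar[OF A])
      fix w assume w: "norm (z - w) = 2 * R"
      have "norm w \<ge> R" using norm_triangle_ineq4[of z w] zR w by linarith
      then have "w \<notin> W" using R(2) by auto
      then have "w \<notin> S" using \<eta>(7) by (auto simp: U_def U0_def)
      then show "g w = 0" by (rule g0)
    qed (use R in auto)
    then show "(\<Sum>p\<in>P. (\<eta> z * X p z + E z * \<psi> p z) * kk p z) - cauchy_transform (2 * R) g' z = 0"
      by (simp add: E0[OF z] g_def)
  qed
  moreover have "norm (H z - k z) \<le> e" if z: "z \<in> \<Omega>" for z
  proof -
    have zV: "z \<in> V" using z \<eta>(3) closure_subset by blast
    then have zW: "z \<in> W" using \<eta>(4) by (auto simp: U_def U0_def)
    have "F z - k z = (\<Sum>p\<in>P. \<psi> p z * kk p z) - (\<Sum>p\<in>P. \<psi> p z) * k z"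
      by (simp add: F_def \<eta>(5)[OF zV] sum1[OF zW])
    also have "\<dots> = (\<Sum>p\<in>P. \<psi> p z * (kk p z - k z))"
      by (simp add: right_diff_distrib sum_subtractf sum_distrib_right)
    finally have "norm (F z - k z) = norm (\<Sum>p\<in>P. \<psi> p z * (kk p z - k z))" by simp
    also have "\<dots> \<le> (\<Sum>p\<in>P. D p * (M' * t))"
    proof (rule sum_norm_le)
      fix p assume p: "p \<in> P"
      show "norm (\<psi> p z * (kk p z - k z)) \<le> D p * (M' * t)"
      proof (cases "z \<in> cball p (3/4 * \<rho> p)")
        case True
        then show ?thesis unfolding norm_mult using D[OF p] close[OF p z True] by (intro mult_mono) auto
      next
        case False
        then show ?thesis using \<psi>0[OF p False] D(1)[OF p] M' t0 by simp
      qed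
    qed
    also have "\<dots> = DD * M' * t" by (simp add: DD_def sum_distrib_right mult.assoc)
    finally have 1: "norm (F z - k z) \<le> DD * M' * t" .
    have 2: "norm (cauchy_transform (2 * R) g z) \<le> 2 * (2 * R) * \<delta>"
      by (rule norm_cauchy_transform_le) (use gle R C1_dbar_cont[OF gC1] in auto)
    have "norm (H z - k z) \<le> norm (F z - k z) + norm (cauchy_transform (2 * R) g z)"
      unfolding H_def using norm_triangle_ineq4[of "F z - k z" "cauchy_transform (2 * R) g z"]
      by (simp add: algebra_simps)
    also have "\<dots> \<le> L * t" using 1 2 by (simp add: L_def \<delta>_def algebra_simps)
    finally show ?thesis using Lt by simp
  qed
  ultimately show ?thesis using \<eta>(2,3) by blast
qed

section \<open>Tangent discs of smooth closed curves\<close>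

text \<open>The unit normal to the left of the direction of travel. The orientation of a boundary
  curve is not prescribed, so it may point into or out of the domain; a sign for each curve is
  determined later.\<close>

definition curve_normal :: "(real \<Rightarrow> complex) \<Rightarrow> real \<Rightarrow> complex" where
  "curve_normal \<gamma> t = \<i> * sgn (vector_derivative \<gamma> (at t))"

text \<open>The last estimate is Taylor's formula with quadratic error, from a Lipschitz bound on
  the derivative. The interval from -1 to 2 contains every s at distance at most 1/2 from some t in
  [0,1], and by periodicity such pairs represent all pairs of points.\<close>

lemma smooth_curve_derivs:
  assumes "smooth_simple_closed_curve \<gamma>"
  shows "(\<gamma> has_vector_derivative vector_derivative \<gamma> (at t)) (at t)"
    and "continuous_on S \<gamma>"
    and "continuous_on S (\<lambda>t. vector_derivative \<gamma> (at t))"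
    and "\<exists>K>0. \<forall>s\<in>{-1..2}. \<forall>t\<in>{-1..2}. norm (\<gamma> s - \<gamma> t - (s - t) *\<^sub>R vector_derivative \<gamma> (at t)) \<le> K * (s - t)\<^sup>2"
proof -
  obtain D where D: "D 0 = \<gamma>" "\<And>n t. (D n has_vector_derivative D (Suc n) t) (at t)"
    using assms unfolding smooth_simple_closed_curve_def smooth_fun_def by blast
  have v: "vector_derivative \<gamma> (at t) = D 1 t" for t
    using D(2)[of 0 t] D(1) by (simp add: vector_derivative_at)
  have cD: "continuous_on S (D n)" for n S
    using D(2) by (meson continuous_at_imp_continuous_on has_vector_derivative_continuous)
  show d1: "(\<gamma> has_vector_derivative vector_derivative \<gamma> (at t)) (at t)" for t
    using D(2)[of 0 t] D(1) by (simp add: v)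
  show "continuous_on S \<gamma>" using cD[of S 0] D(1) by simp
  show "continuous_on S (\<lambda>t. vector_derivative \<gamma> (at t))" using cD[of S 1] by (simp add: v)
  have "bounded (D 2 ` {-1..2})" by (intro compact_imp_bounded compact_continuous_image cD) auto
  then obtain K0 where K0: "\<And>x. x \<in> {-1..2} \<Longrightarrow> norm (D 2 x) \<le> K0" unfolding bounded_iff by blast
  define K where "K = max K0 1"
  have K: "K > 0" "\<And>x. x \<in> {-1..2} \<Longrightarrow> norm (D 2 x) \<le> K" using K0 by (auto simp: K_def intro: max.coboundedI1)
  have 1: "norm (D 1 s - D 1 t) \<le> K * norm (s - t)" if "s \<in> {-1..2}" "t \<in> {-1..2}" for s t :: real
  proof (rule differentiable_bound)
    show "(D 1 has_derivative (\<lambda>h. h *\<^sub>R D 2 x)) (at x within {-1..2})" for x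
      using D(2)[of 1 x] by (simp add: has_vector_derivative_def has_derivative_at_withinI numeral_2_eq_2)
    show "onorm (\<lambda>h. h *\<^sub>R D 2 x) \<le> K" if "x \<in> {-1..2}" for x
      using mult_left_mono[OF K(2)[OF that] abs_ge_zero] by (intro onorm_bound) (auto simp: K(1) less_imp_le mult.commute)
  qed (use that in auto)
  have "norm (\<gamma> s - \<gamma> t - (s - t) *\<^sub>R D 1 t) \<le> K * (s - t)\<^sup>2" if st: "s \<in> {-1..2}" "t \<in> {-1..2}" for s t
  proof -
    let ?S = "closed_segment s t"
    have sub: "?S \<subseteq> {-1..2}" using st by (auto simp: closed_segment_eq_real_ivl split: if_splits)
    have "norm ((\<gamma> s - s *\<^sub>R D 1 t) - (\<gamma> t - t *\<^sub>R D 1 t)) \<le> (K * \<bar>s - t\<bar>) * norm (s - t)"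
    proof (rule differentiable_bound)
      fix x assume x: "x \<in> ?S"
      have "((\<lambda>x. \<gamma> x - x *\<^sub>R D 1 t) has_vector_derivative D 1 x - D 1 t) (at x)"
        by (rule derivative_eq_intros d1 refl)+ (simp add: v)
      then show "((\<lambda>x. \<gamma> x - x *\<^sub>R D 1 t) has_derivative (\<lambda>h. h *\<^sub>R (D 1 x - D 1 t))) (at x within ?S)"
        by (simp add: has_vector_derivative_def has_derivative_at_withinI)
      have "norm (D 1 x - D 1 t) \<le> K * norm (x - t)" using 1 sub x st by blast
      also have "\<dots> \<le> K * \<bar>s - t\<bar>"
        using x K(1) by (intro mult_left_mono) (auto simp: closed_segment_eq_real_ivl split: if_splits)
      finally have "norm (D 1 x - D 1 t) \<le> K * \<bar>s - t\<bar>" .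
      then show "onorm (\<lambda>h. h *\<^sub>R (D 1 x - D 1 t)) \<le> K * \<bar>s - t\<bar>"
        using K(1) mult_left_mono[OF _ abs_ge_zero] by (intro onorm_bound) (auto simp: mult.commute)
    qed auto
    then show ?thesis by (simp add: algebra_simps power2_eq_square abs_mult_self_eq)
  qed
  then show "\<exists>K>0. \<forall>s\<in>{-1..2}. \<forall>t\<in>{-1..2}. norm (\<gamma> s - \<gamma> t - (s - t) *\<^sub>R vector_derivative \<gamma> (at t)) \<le> K * (s - t)\<^sup>2"
    using K(1) v by auto
qed

lemma smooth_curve_nonzero: "smooth_simple_closed_curve \<gamma> \<Longrightarrow> vector_derivative \<gamma> (at t) \<noteq> 0"
  by (simp add: smooth_simple_closed_curve_def)

lemma smooth_curve_periodic:
  assumes "smooth_simple_closed_curve \<gamma>"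
  shows "\<gamma> (t + of_int n) = \<gamma> t"
proof -
  have p: "\<gamma> (t + 1) = \<gamma> t" for t using assms by (simp add: smooth_simple_closed_curve_def)
  have nat: "\<gamma> (t + of_nat m) = \<gamma> t" for m t
  proof (induction m)
    case (Suc m)
    then show ?case using p[of "t + of_nat m"] by (simp add: add_ac)
  qed simp
  show ?thesis
  proof (cases "n \<ge> 0")
    case True
    then show ?thesis using nat[of t "nat n"] by simp
  next
    case False
    then show ?thesis using nat[of "t + of_int n" "nat (- n)"] by simp
  qed
qed

lemma smooth_curve_derivative_periodic:
  assumes "smooth_simple_closed_curve \<gamma>"
  shows "vector_derivative \<gamma> (at (t + of_int n)) = vector_derivative \<gamma> (at t)"
proof -
  have "((\<lambda>s. \<gamma> (s + of_int n)) has_vector_derivative vector_derivative \<gamma> (at (t + of_int n))) (at t)"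
    using vector_diff_chain_at[of "\<lambda>s. s + of_int n" 1 t \<gamma> "vector_derivative \<gamma> (at (t + of_int n))"]
      smooth_curve_derivs(1)[OF assms] has_vector_derivative_add[OF has_vector_derivative_id has_vector_derivative_const]
    by (simp add: o_def)
  then show ?thesis
    using smooth_curve_periodic[OF assms] by (simp add: vector_derivative_at)
qed

lemma curve_normal_periodic:
  "smooth_simple_closed_curve \<gamma> \<Longrightarrow> curve_normal \<gamma> (t + of_int n) = curve_normal \<gamma> t"
  by (simp add: curve_normal_def smooth_curve_derivative_periodic)

lemma curve_image_range:
  assumes "smooth_simple_closed_curve \<gamma>"
  shows "curve_image \<gamma> = range \<gamma>"
proof -
  have "\<gamma> t \<in> \<gamma> ` {0..1}" for t
    using smooth_curve_periodic[OF assms, of t "- \<lfloor>t\<rfloor>"] frac_ge_0[of t] frac_lt_1[of t]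
    by (intro image_eqI[of _ _ "frac t"]) (auto simp: frac_def)
  then show ?thesis by (auto simp: curve_image_def)
qed

lemma smooth_curve_inj:
  assumes \<gamma>: "smooth_simple_closed_curve \<gamma>" and "\<gamma> s = \<gamma> t" "\<bar>s - t\<bar> < 1"
  shows "s = t"
proof -
  have f: "\<gamma> (frac x) = \<gamma> x" for x
    using smooth_curve_periodic[OF \<gamma>, of x "- \<lfloor>x\<rfloor>"] by (simp add: frac_def)
  have "inj_on \<gamma> {0..<1}" using \<gamma> by (simp add: smooth_simple_closed_curve_def)
  then have "frac s = frac t"
    by (rule inj_onD) (use f assms(2) frac_lt_1 in auto)
  then have st: "s - t = of_int (\<lfloor>s\<rfloor> - \<lfloor>t\<rfloor>)" by (simp add: frac_def)
  then have "\<bar>of_int (\<lfloor>s\<rfloor> - \<lfloor>t\<rfloor>) :: real\<bar> < 1" using assms(3) by simp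
  then have "\<lfloor>s\<rfloor> - \<lfloor>t\<rfloor> = 0" by linarith
  then show ?thesis using st by simp
qed

text \<open>Near the diagonal the speed, bounded below by \<open>m\<close>, dominates the quadratic
  Taylor error. Away from it, injectivity and compactness of the set of pairs with
  \<open>\<delta>\<close> \<le> |s - t| \<le> 1/2 give the positive bound
  \<open>\<mu>\<close>.\<close>

lemma smooth_curve_bilipschitz:
  assumes \<gamma>: "smooth_simple_closed_curve \<gamma>"
  shows "\<exists>c>0. \<forall>t\<in>{0..1}. \<forall>s. \<bar>s - t\<bar> \<le> 1/2 \<longrightarrow> c * \<bar>s - t\<bar> \<le> norm (\<gamma> s - \<gamma> t)"
proof -
  let ?v = "\<lambda>t. vector_derivative \<gamma> (at t)"
  obtain K where K: "K > 0" "\<And>s t. s \<in> {-1..2} \<Longrightarrow> t \<in> {-1..2} \<Longrightarrow> norm (\<gamma> s - \<gamma> t - (s - t) *\<^sub>R ?v t) \<le> K * (s - t)\<^sup>2"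
    using smooth_curve_derivs(4)[OF \<gamma>] by blast
  have "\<exists>x\<in>{0..1}. \<forall>y\<in>{0..1}. norm (?v x) \<le> norm (?v y)"
    by (rule continuous_attains_inf) (auto intro!: continuous_intros smooth_curve_derivs(3)[OF \<gamma>])
  then obtain x where x: "\<And>y. y \<in> {0..1} \<Longrightarrow> norm (?v x) \<le> norm (?v y)" by blast
  define m where "m = norm (?v x)"
  have m: "m > 0" "\<And>t. t \<in> {0..1} \<Longrightarrow> m \<le> norm (?v t)" using x smooth_curve_nonzero[OF \<gamma>] by (auto simp: m_def)
  \<comment> \<open>Up to this distance the Taylor error K|s - t|^2 is at most half of m|s -
    t|.\<close>
  define \<delta> where "\<delta> = min (m / (2 * K)) (1/2)"
  have \<delta>: "\<delta> > 0" "\<delta> \<le> 1/2" "K * \<delta> \<le> m / 2" using m K by (auto simp: \<delta>_def min_def field_simps)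
  define C where "C = {(t, s). t \<in> {0..1} \<and> \<delta> \<le> \<bar>s - t\<bar> \<and> \<bar>s - t\<bar> \<le> (1/2::real)}"
  have "bounded C"
  proof (rule bounded_subset[of "cbox (0, -1) (1, 2)"])
    show "C \<subseteq> cbox (0, -1) (1, 2)"
    proof
      fix p assume "p \<in> C"
      then obtain t s where "p = (t, s)" "t \<in> {0..1}" "\<bar>s - t\<bar> \<le> 1/2" by (auto simp: C_def)
      then show "p \<in> cbox (0, -1) (1, 2)" by (simp, linarith)
    qed
  qed simp
  moreover have "closed C" unfolding C_def case_prod_beta'
    by (simp add: Collect_conj_eq) (intro closed_Int closed_Collect_le continuous_intros)
  ultimately have "compact C" by (simp add: compact_eq_bounded_closed)
  moreover have "(0, 1/2) \<in> C" using \<delta> by (simp add: C_def)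
  moreover have "continuous_on C (\<lambda>(t, s). norm (\<gamma> s - \<gamma> t))"
    unfolding case_prod_beta'
    by (intro continuous_intros continuous_on_compose2[OF smooth_curve_derivs(2)[OF \<gamma>, of UNIV]]) auto
  ultimately obtain p where p: "p \<in> C" "\<And>y. y \<in> C \<Longrightarrow> (\<lambda>(t, s). norm (\<gamma> s - \<gamma> t)) p \<le> (\<lambda>(t, s). norm (\<gamma> s - \<gamma> t)) y"
    using continuous_attains_inf[of C "\<lambda>(t, s). norm (\<gamma> s - \<gamma> t)"] by blast
  obtain t0 s0 where p0: "p = (t0, s0)" by (cases p) auto
  define \<mu> where "\<mu> = norm (\<gamma> s0 - \<gamma> t0)"
  have "s0 \<noteq> t0" "\<bar>s0 - t0\<bar> < 1" using p(1) \<delta> by (auto simp: p0 C_def)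
  then have \<mu>0: "\<mu> > 0" using smooth_curve_inj[OF \<gamma>, of s0 t0] by (auto simp: \<mu>_def)
  have \<mu>: "\<mu> \<le> norm (\<gamma> s - \<gamma> t)" if "(t, s) \<in> C" for t s
    using p(2)[OF that] by (simp add: p0 \<mu>_def)
  define c where "c = min (m / 2) \<mu>"
  have "c * \<bar>s - t\<bar> \<le> norm (\<gamma> s - \<gamma> t)" if t: "t \<in> {0..1}" and s: "\<bar>s - t\<bar> \<le> 1/2" for s t
  proof (cases "\<bar>s - t\<bar> \<le> \<delta>")
    case True
    have r: "s \<in> {-1..2}" "t \<in> {-1..2}" using s t by (simp_all, linarith+)
    have "m * \<bar>s - t\<bar> \<le> norm ((s - t) *\<^sub>R ?v t)" 
      using mult_right_mono[OF m(2)[OF t] abs_ge_zero[of "s - t"]] by (simp add: mult.commute)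
    moreover have "K * (s - t)\<^sup>2 \<le> m / 2 * \<bar>s - t\<bar>"
    proof -
      have "K * (s - t)\<^sup>2 = (K * \<bar>s - t\<bar>) * \<bar>s - t\<bar>" by (simp add: power2_eq_square)
      also have "\<dots> \<le> (K * \<delta>) * \<bar>s - t\<bar>" using True K by (intro mult_right_mono mult_left_mono) auto
      also have "\<dots> \<le> m / 2 * \<bar>s - t\<bar>" using \<delta> by (intro mult_right_mono) auto
      finally show ?thesis .
    qed
    moreover have "norm ((s - t) *\<^sub>R ?v t) \<le> norm (\<gamma> s - \<gamma> t) + norm (\<gamma> s - \<gamma> t - (s - t) *\<^sub>R ?v t)"
      using norm_triangle_ineq4[of "\<gamma> s - \<gamma> t" "\<gamma> s - \<gamma> t - (s - t) *\<^sub>R ?v t"] by simp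
    ultimately have "m / 2 * \<bar>s - t\<bar> \<le> norm (\<gamma> s - \<gamma> t)" using K(2)[OF r] by linarith
    moreover have "c * \<bar>s - t\<bar> \<le> m / 2 * \<bar>s - t\<bar>" by (intro mult_right_mono) (auto simp: c_def)
    ultimately show ?thesis by linarith
  next
    case False
    then have "\<mu> \<le> norm (\<gamma> s - \<gamma> t)" using s t by (intro \<mu>) (auto simp: C_def)
    moreover have "c * \<bar>s - t\<bar> \<le> \<mu> * 1" using s \<mu>0 by (intro mult_mono) (auto simp: c_def)
    ultimately show ?thesis by simp
  qed
  moreover have "c > 0" using m \<mu>0 by (simp add: c_def)
  ultimately show ?thesis by blast
qed

lemma norm_curve_normal:
  "smooth_simple_closed_curve \<gamma> \<Longrightarrow> norm (curve_normal \<gamma> t) = 1"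
  using smooth_curve_nonzero by (simp add: curve_normal_def norm_mult norm_sgn)

lemma curve_normal_orthogonal:
  "vector_derivative \<gamma> (at t) \<bullet> curve_normal \<gamma> t = 0"
  by (simp add: curve_normal_def inner_complex_def sgn_div_norm)

lemma continuous_curve_normal:
  assumes "smooth_simple_closed_curve \<gamma>"
  shows "continuous_on S (curve_normal \<gamma>)"
  unfolding curve_normal_def[abs_def]
  by (intro continuous_intros smooth_curve_derivs(3)[OF assms]) (use smooth_curve_nonzero[OF assms] in auto)

lemma real_shift_near:
  fixes s t :: real
  shows "\<exists>n::int. \<bar>s + of_int n - t\<bar> \<le> 1/2"
  using of_int_round_abs_le[of "t - s"] by (intro exI[of _ "round (t - s)"]) (simp add: abs_minus_commute algebra_simps)

lemma norm_sub_scaled_unit: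
  fixes x v :: complex
  assumes "norm v = 1"
  shows "(norm (x - a *\<^sub>R v))\<^sup>2 = (norm x)\<^sup>2 - 2 * a * (x \<bullet> v) + a\<^sup>2"
proof -
  have "v \<bullet> v = 1" using assms by (simp add: power2_norm_eq_inner[symmetric])
  then show ?thesis unfolding power2_norm_eq_inner
    by (simp add: inner_diff_left inner_diff_right inner_commute algebra_simps power2_eq_square)
qed

text \<open>Expanding the square, \<open>\<gamma> s\<close> avoids the disc when twice
  \<open>\<sigma>\<close> times the normal component of \<open>\<gamma> s - \<gamma> t\<close> is at
  most its squared length. As the tangent is orthogonal to the normal, that component is at most K(s
  - t)^2 in modulus, whereas the squared length is at least c^2(s - t)^2; hence r0 = c^2/(2K). Both
  signs of \<open>\<sigma>\<close> are covered.\<close>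

lemma tangent_ball_avoids_curve:
  assumes \<gamma>: "smooth_simple_closed_curve \<gamma>"
  shows "\<exists>r0>0. \<forall>r s t \<sigma>. 0 < r \<and> r \<le> r0 \<and> \<bar>\<sigma>\<bar> = r \<longrightarrow> r \<le> norm (\<gamma> s - (\<gamma> t + \<sigma> *\<^sub>R curve_normal \<gamma> t))"
proof -
  let ?v = "\<lambda>t. vector_derivative \<gamma> (at t)"
  obtain K where K: "K > 0" "\<And>s t. s \<in> {-1..2} \<Longrightarrow> t \<in> {-1..2} \<Longrightarrow> norm (\<gamma> s - \<gamma> t - (s - t) *\<^sub>R ?v t) \<le> K * (s - t)\<^sup>2"
    using smooth_curve_derivs(4)[OF \<gamma>] by blast
  obtain c where c: "c > 0" "\<And>s t. t \<in> {0..1} \<Longrightarrow> \<bar>s - t\<bar> \<le> 1/2 \<Longrightarrow> c * \<bar>s - t\<bar> \<le> norm (\<gamma> s - \<gamma> t)"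
    using smooth_curve_bilipschitz[OF \<gamma>] by blast
  define r0 where "r0 = c\<^sup>2 / (2 * K)"
  have r0: "r0 > 0" using c K by (simp add: r0_def)
  have main: "r \<le> norm (\<gamma> s - (\<gamma> t + \<sigma> *\<^sub>R curve_normal \<gamma> t))"
    if r: "0 < r" "r \<le> r0" "\<bar>\<sigma>\<bar> = r" and t: "t \<in> {0..1}" and s: "\<bar>s - t\<bar> \<le> 1/2" for r s t \<sigma>
  proof -
    have rg: "s \<in> {-1..2}" "t \<in> {-1..2}" using s t by (simp_all, linarith+)
    let ?D = "\<gamma> s - \<gamma> t" and ?n = "curve_normal \<gamma> t"
    have "?D \<bullet> ?n = (\<gamma> s - \<gamma> t - (s - t) *\<^sub>R ?v t) \<bullet> ?n"
      by (simp add: inner_diff_left curve_normal_orthogonal)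
    also have "\<bar>\<dots>\<bar> \<le> norm (\<gamma> s - \<gamma> t - (s - t) *\<^sub>R ?v t) * norm ?n" by (rule Cauchy_Schwarz_ineq2)
    also have "\<dots> \<le> K * (s - t)\<^sup>2" using K(2)[OF rg] norm_curve_normal[OF \<gamma>] by simp
    finally have 1: "\<bar>?D \<bullet> ?n\<bar> \<le> K * (s - t)\<^sup>2" .
    have "2 * \<sigma> * (?D \<bullet> ?n) \<le> \<bar>2 * \<sigma> * (?D \<bullet> ?n)\<bar>" by simp
    also have "\<dots> = 2 * r * \<bar>?D \<bullet> ?n\<bar>" using r by (simp add: abs_mult)
    also have "\<dots> \<le> 2 * r0 * (K * (s - t)\<^sup>2)" using 1 r K by (intro mult_mono) auto
    also have "\<dots> = (c * \<bar>s - t\<bar>)\<^sup>2" using K by (simp add: r0_def power_mult_distrib)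
    also have "\<dots> \<le> (norm ?D)\<^sup>2" using c(2)[OF t s] c(1) by (intro power_mono) auto
    finally have "r\<^sup>2 \<le> (norm (?D - \<sigma> *\<^sub>R ?n))\<^sup>2"
      using r by (simp add: norm_sub_scaled_unit[OF norm_curve_normal[OF \<gamma>]] power2_abs[of \<sigma>, symmetric])
    then have "r \<le> norm (?D - \<sigma> *\<^sub>R ?n)" by (rule power2_le_imp_le) simp
    then show ?thesis by (simp add: algebra_simps)
  qed
  have "r \<le> norm (\<gamma> s - (\<gamma> t + \<sigma> *\<^sub>R curve_normal \<gamma> t))" if r: "0 < r" "r \<le> r0" "\<bar>\<sigma>\<bar> = r" for r s t \<sigma>
  proof -
    \<comment> \<open>Periodicity brings t into [0,1] and s within half a period of it.\<close>
    define t' where "t' = t + of_int (- \<lfloor>t\<rfloor>)"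
    have t': "t' \<in> {0..1}" using frac_ge_0[of t] frac_lt_1[of t] by (auto simp: t'_def frac_def)
    obtain n where n: "\<bar>s + of_int n - t'\<bar> \<le> 1/2" using real_shift_near by blast
    show ?thesis using main[OF r t' n]
      unfolding t'_def smooth_curve_periodic[OF \<gamma>] curve_normal_periodic[OF \<gamma>] .
  qed
  then show ?thesis using r0 by blast
qed

section \<open>Geometry of smoothly bounded domains\<close>

lemma curve_image_compact:
  assumes "smooth_simple_closed_curve \<gamma>"
  shows "compact (curve_image \<gamma>)"
  unfolding curve_image_def
  by (intro compact_continuous_image smooth_curve_derivs(2)[OF assms]) simp

lemma smooth_curve_simple_path:
  assumes \<gamma>: "smooth_simple_closed_curve \<gamma>"
  shows "simple_path \<gamma>" "pathfinish \<gamma> = pathstart \<gamma>" "path_image \<gamma> = curve_image \<gamma>"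
proof -
  have "x = y \<or> x = 0 \<and> y = 1 \<or> x = 1 \<and> y = 0" if "x \<in> {0..1}" "y \<in> {0..1}" "\<gamma> x = \<gamma> y" for x y
  proof (cases "\<bar>x - y\<bar> < 1")
    case True
    then show ?thesis using smooth_curve_inj[OF \<gamma> that(3)] by simp
  next
    case False
    then show ?thesis using that(1,2) by auto
  qed
  then show "simple_path \<gamma>"
    unfolding simple_path_def loop_free_def path_def using smooth_curve_derivs(2)[OF \<gamma>] by blast
  show "pathfinish \<gamma> = pathstart \<gamma>"
    using smooth_curve_periodic[OF \<gamma>, of 0 1] by (simp add: pathfinish_def pathstart_def)
  show "path_image \<gamma> = curve_image \<gamma>" by (simp add: path_image_def curve_image_def)
qed

locale smooth_domain =
  fixes \<Omega> :: "complex set" and Gs :: "(real \<Rightarrow> complex) list"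
  assumes dom: "smooth_bounded_domain \<Omega> Gs"
begin

lemma open_dom: "open \<Omega>" and connected_dom: "connected \<Omega>" and nonempty_dom: "\<Omega> \<noteq> {}"
  and bounded_dom: "bounded \<Omega>" and frontier_dom: "frontier \<Omega> = (\<Union>\<gamma>\<in>set Gs. curve_image \<gamma>)"
  and curves: "\<gamma> \<in> set Gs \<Longrightarrow> smooth_simple_closed_curve \<gamma>"
  using dom by (auto simp: smooth_bounded_domain_def)

lemma curve_in_frontier: "\<gamma> \<in> set Gs \<Longrightarrow> \<gamma> t \<in> frontier \<Omega>"
  using curve_image_range[OF curves] frontier_dom by blast

lemma frontier_curve:
  assumes "w \<in> frontier \<Omega>"
  obtains \<gamma> t where "\<gamma> \<in> set Gs" "t \<in> {0..1}" "w = \<gamma> t"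
  using assms frontier_dom by (auto simp: curve_image_def)

lemma frontier_disjoint: "frontier \<Omega> \<inter> \<Omega> = {}"
  using open_dom by (auto simp: frontier_def interior_open)

lemma frontier_nonempty: "frontier \<Omega> \<noteq> {}"
proof -
  have "\<Omega> \<noteq> UNIV" using bounded_dom not_bounded_UNIV by blast
  then show ?thesis using nonempty_dom frontier_eq_empty by blast
qed

lemma curves_separated:
  "\<exists>\<delta>>0. \<forall>\<gamma>\<in>set Gs. \<forall>\<gamma>'\<in>set Gs. \<forall>s t. \<gamma> = \<gamma>' \<or> \<delta> \<le> dist (\<gamma> s) (\<gamma>' t)"
proof -
  have "\<exists>\<delta>>0. \<forall>s t. \<gamma> = \<gamma>' \<or> \<delta> \<le> dist (\<gamma> s) (\<gamma>' t)"
    if "p = (\<gamma>, \<gamma>')" "p \<in> set Gs \<times> set Gs" for p \<gamma> \<gamma>'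
  proof (cases "\<gamma> = \<gamma>'")
    case True
    then show ?thesis by (intro exI[of _ 1]) auto
  next
    case False
    have g: "\<gamma> \<in> set Gs" "\<gamma>' \<in> set Gs" using that by auto
    obtain i j where ij: "i < length Gs" "j < length Gs" "\<gamma> = Gs ! i" "\<gamma>' = Gs ! j"
      using g by (metis in_set_conv_nth)
    then have "i \<noteq> j" using False by auto
    then have "curve_image \<gamma> \<inter> curve_image \<gamma>' = {}"
      using dom ij by (simp add: smooth_bounded_domain_def)
    from separate_compact_closed[OF curve_image_compact[OF curves[OF g(1)]] compact_imp_closed[OF curve_image_compact[OF curves[OF g(2)]]] this]
    obtain d where "d > 0" "\<And>x y. x \<in> curve_image \<gamma> \<Longrightarrow> y \<in> curve_image \<gamma>' \<Longrightarrow> d \<le> dist x y" by blast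
    then show ?thesis
      using curve_image_range[OF curves[OF g(1)]] curve_image_range[OF curves[OF g(2)]] by blast
  qed
  then have "\<forall>p\<in>set Gs \<times> set Gs. \<exists>\<delta>>0. \<forall>s t. fst p = snd p \<or> \<delta> \<le> dist (fst p s) (snd p t)"
    by (metis prod.collapse)
  then obtain \<delta> where \<delta>: "\<And>p. p \<in> set Gs \<times> set Gs \<Longrightarrow> \<delta> p > 0"
    "\<And>p s t. p \<in> set Gs \<times> set Gs \<Longrightarrow> fst p = snd p \<or> \<delta> p \<le> dist (fst p s) (snd p t)"
    by metis
  define d where "d = Min (insert 1 (\<delta> ` (set Gs \<times> set Gs)))"
  have "d > 0" using \<delta>(1) by (auto simp: d_def)
  moreover have "\<gamma> = \<gamma>' \<or> d \<le> dist (\<gamma> s) (\<gamma>' t)" if "\<gamma> \<in> set Gs" "\<gamma>' \<in> set Gs" for \<gamma> \<gamma>' s t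
  proof -
    have "d \<le> \<delta> (\<gamma>, \<gamma>')" unfolding d_def using that by (intro Min_le) auto
    then show ?thesis using \<delta>(2)[of "(\<gamma>, \<gamma>')" s t] that by auto
  qed
  ultimately show ?thesis by blast
qed

text \<open>A disc of radius r tangent at \<open>\<gamma> t\<close> misses its own curve by the
  curvature bound, and the other curves because they stay at distance 2r from
  \<open>\<gamma> t\<close> while the centre is only r away. The separation by 2r is kept for
  recognising the nearest curve.\<close>

lemma tangent_balls:
  "\<exists>r>0. (\<forall>\<gamma>\<in>set Gs. \<forall>t \<sigma>. \<bar>\<sigma>\<bar> = r \<longrightarrow> ball (\<gamma> t + \<sigma> *\<^sub>R curve_normal \<gamma> t) r \<inter> frontier \<Omega> = {}) \<and>
     (\<forall>\<gamma>\<in>set Gs. \<forall>\<gamma>'\<in>set Gs. \<forall>s t. \<gamma> = \<gamma>' \<or> 2 * r \<le> dist (\<gamma> s) (\<gamma>' t))"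
proof -
  obtain \<delta> where \<delta>1: "\<delta> > 0"
    and \<delta>2: "\<forall>\<gamma>\<in>set Gs. \<forall>\<gamma>'\<in>set Gs. \<forall>s t. \<gamma> = \<gamma>' \<or> \<delta> \<le> dist (\<gamma> s) (\<gamma>' t)"
    using curves_separated by (elim exE conjE) (rule that)
  note \<delta> = \<delta>1 \<delta>2[rule_format]
  have "\<forall>\<gamma>\<in>set Gs. \<exists>r0>0. \<forall>r s t \<sigma>. 0 < r \<and> r \<le> r0 \<and> \<bar>\<sigma>\<bar> = r \<longrightarrow> r \<le> norm (\<gamma> s - (\<gamma> t + \<sigma> *\<^sub>R curve_normal \<gamma> t))"
    using tangent_ball_avoids_curve curves by blast
  then obtain r0 where r0: "\<And>\<gamma>. \<gamma> \<in> set Gs \<Longrightarrow> r0 \<gamma> > 0"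
    "\<And>\<gamma> r s t \<sigma>. \<gamma> \<in> set Gs \<Longrightarrow> 0 < r \<Longrightarrow> r \<le> r0 \<gamma> \<Longrightarrow> \<bar>\<sigma>\<bar> = r \<Longrightarrow> r \<le> norm (\<gamma> s - (\<gamma> t + \<sigma> *\<^sub>R curve_normal \<gamma> t))"
    by metis
  define r where "r = Min (insert (\<delta> / 2) (r0 ` set Gs))"
  have r: "r > 0" using \<delta>(1) r0(1) by (auto simp: r_def)
  have r1: "r \<le> \<delta> / 2" unfolding r_def by (intro Min_le) auto
  have r2: "r \<le> r0 \<gamma>" if "\<gamma> \<in> set Gs" for \<gamma> unfolding r_def using that by (intro Min_le) auto
  have far: "\<gamma> = \<gamma>' \<or> 2 * r \<le> dist (\<gamma> s) (\<gamma>' t)" if "\<gamma> \<in> set Gs" "\<gamma>' \<in> set Gs" for \<gamma> \<gamma>' s t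
    using \<delta>(2)[OF that, of s t] r1 by linarith
  have "r \<le> dist w (\<gamma> t + \<sigma> *\<^sub>R curve_normal \<gamma> t)" if \<gamma>: "\<gamma> \<in> set Gs" and \<sigma>: "\<bar>\<sigma>\<bar> = r" and w: "w \<in> frontier \<Omega>" for \<gamma> t \<sigma> w
  proof -
    obtain \<gamma>' s where g': "\<gamma>' \<in> set Gs" "w = \<gamma>' s" using frontier_curve[OF w] by metis
    show ?thesis
    proof (cases "\<gamma> = \<gamma>'")
      case True
      then show ?thesis using r0(2)[OF \<gamma> r r2[OF \<gamma>] \<sigma>] g'(2) by (simp add: dist_norm)
    next
      case False
      then have "2 * r \<le> dist (\<gamma> t) w" using far[OF \<gamma> g'(1)] g'(2) by blast
      moreover have "dist (\<gamma> t) (\<gamma> t + \<sigma> *\<^sub>R curve_normal \<gamma> t) = r"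
        using norm_curve_normal[OF curves[OF \<gamma>]] \<sigma> by (simp add: dist_norm)
      ultimately show ?thesis using dist_triangle2[of "\<gamma> t" w "\<gamma> t + \<sigma> *\<^sub>R curve_normal \<gamma> t"] by linarith
    qed
  qed
  then have "ball (\<gamma> t + \<sigma> *\<^sub>R curve_normal \<gamma> t) r \<inter> frontier \<Omega> = {}" if "\<gamma> \<in> set Gs" "\<bar>\<sigma>\<bar> = r" for \<gamma> t \<sigma>
  proof -
    have "r \<le> dist w (\<gamma> t + \<sigma> *\<^sub>R curve_normal \<gamma> t)" if "w \<in> frontier \<Omega>" for w
      using \<open>\<And>w t \<sigma> \<gamma>. \<gamma> \<in> set Gs \<Longrightarrow> \<bar>\<sigma>\<bar> = r \<Longrightarrow> w \<in> frontier \<Omega> \<Longrightarrow> r \<le> dist w (\<gamma> t + \<sigma> *\<^sub>R curve_normal \<gamma> t)\<close>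
        \<open>\<gamma> \<in> set Gs\<close> \<open>\<bar>\<sigma>\<bar> = r\<close> that by blast
    then show ?thesis by (force simp: dist_commute)
  qed
  then show ?thesis using r far by blast
qed

text \<open>At a nearest frontier point the derivative of the squared distance along the curve
  vanishes, so the connecting vector is orthogonal to the tangent and thus a real multiple of the
  normal.\<close>

lemma nearest_frontier_point:
  assumes "z \<notin> frontier \<Omega>"
  obtains \<gamma> t l where "\<gamma> \<in> set Gs" "t \<in> {0..1}" "z = \<gamma> t + l *\<^sub>R curve_normal \<gamma> t"
    "\<bar>l\<bar> = infdist z (frontier \<Omega>)" "l \<noteq> 0"
proof -
  obtain w where w: "w \<in> frontier \<Omega>" "infdist z (frontier \<Omega>) = dist z w"
    using infdist_attains_inf[OF frontier_closed frontier_nonempty] by metis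
  obtain \<gamma> t where g: "\<gamma> \<in> set Gs" "t \<in> {0..1}" "w = \<gamma> t" using frontier_curve[OF w(1)] by metis
  let ?v = "vector_derivative \<gamma> (at t)" and ?n = "curve_normal \<gamma> t"
  note \<gamma> = curves[OF g(1)]
  \<comment> \<open>Minimality holds for all real s, so t is an interior minimum even when it is 0
    or 1.\<close>
  have min: "(norm (\<gamma> t - z))\<^sup>2 \<le> (norm (\<gamma> s - z))\<^sup>2" for s
    using infdist_le[OF curve_in_frontier[OF g(1)], of z s] w(2) g(3)
    by (intro power_mono) (auto simp: dist_norm norm_minus_commute)
  have "((\<lambda>s. (norm (\<gamma> s - z))\<^sup>2) has_derivative (\<lambda>h. 2 * ((\<gamma> t - z) \<bullet> (h *\<^sub>R ?v)))) (at t)"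
    using smooth_curve_derivs(1)[OF \<gamma>, of t] unfolding power2_norm_eq_inner has_vector_derivative_def
    by (auto intro!: derivative_eq_intros simp: inner_commute)
  then have "((\<lambda>s. (norm (\<gamma> s - z))\<^sup>2) has_real_derivative 2 * ((\<gamma> t - z) \<bullet> ?v)) (at t)"
    by (rule has_derivative_imp_has_field_derivative) simp
  from DERIV_local_min[OF this, of 1] have orth: "(z - \<gamma> t) \<bullet> ?v = 0"
    using min by (simp add: inner_diff_left)
  define u where "u = sgn ?v"
  have u: "norm u = 1" using smooth_curve_nonzero[OF \<gamma>] by (simp add: u_def norm_sgn)
  have n: "?n = \<i> * u" by (simp add: curve_normal_def u_def)
  have "(z - \<gamma> t) \<bullet> u = 0" using orth by (simp add: u_def sgn_div_norm)
  then have re: "Re ((z - \<gamma> t) * cnj u) = 0" by (simp add: inner_complex_def)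
  define l where "l = Im ((z - \<gamma> t) * cnj u)"
  have "z - \<gamma> t = (z - \<gamma> t) * (cnj u * u)"
    using u by (simp add: complex_norm_square[symmetric] mult.commute[of "cnj u"])
  also have "\<dots> = ((z - \<gamma> t) * cnj u) * u" by simp
  also have "(z - \<gamma> t) * cnj u = of_real l * \<i>" using re by (simp add: l_def complex_eq_iff)
  finally have z: "z = \<gamma> t + l *\<^sub>R ?n" by (simp add: n scaleR_conv_of_real algebra_simps)
  have "dist z w = \<bar>l\<bar>"
    using norm_curve_normal[OF \<gamma>, of t] by (subst z) (simp add: g(3) dist_norm)
  moreover have "z \<noteq> w" using w assms by auto
  ultimately have "\<bar>l\<bar> = infdist z (frontier \<Omega>)" "l \<noteq> 0" using w(2) by auto
  then show ?thesis using that[OF g(1,2) z] by blast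
qed

lemma in_tangent_ball:
  assumes "\<gamma> \<in> set Gs" "l \<noteq> 0" "\<bar>l\<bar> < 2 * r"
  shows "\<gamma> t + l *\<^sub>R curve_normal \<gamma> t \<in> ball (\<gamma> t + (sgn l * r) *\<^sub>R curve_normal \<gamma> t) r"
proof -
  have "dist (\<gamma> t + (sgn l * r) *\<^sub>R curve_normal \<gamma> t) (\<gamma> t + l *\<^sub>R curve_normal \<gamma> t) = norm ((sgn l * r - l) *\<^sub>R curve_normal \<gamma> t)"
    by (simp add: dist_norm scaleR_diff_left)
  also have "\<dots> = \<bar>sgn l * r - l\<bar>" using norm_curve_normal[OF curves[OF assms(1)]] by simp
  also have "\<dots> < r" using assms by (auto simp: sgn_if abs_if split: if_splits)
  finally show ?thesis by simp
qed

text \<open>Both families of tangent balls are connected and avoid the frontier. They cannot both lie in the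
  domain, because by the Jordan curve theorem the domain would then meet both sides of the curve.\<close>
lemma one_sided:
  "\<exists>r>0. \<forall>\<gamma>\<in>set Gs. \<exists>\<sigma>. \<bar>\<sigma>\<bar> = (1::real) \<and>
     (\<forall>t. ball (\<gamma> t + (\<sigma> * r) *\<^sub>R curve_normal \<gamma> t) r \<subseteq> \<Omega>) \<and>
     (\<forall>t. ball (\<gamma> t - (\<sigma> * r) *\<^sub>R curve_normal \<gamma> t) r \<inter> \<Omega> = {})"
proof -
  obtain r where r1: "r > 0"
    and r2: "\<forall>\<gamma>\<in>set Gs. \<forall>t \<sigma>. \<bar>\<sigma>\<bar> = r \<longrightarrow> ball (\<gamma> t + \<sigma> *\<^sub>R curve_normal \<gamma> t) r \<inter> frontier \<Omega> = {}"
    and r3: "\<forall>\<gamma>\<in>set Gs. \<forall>\<gamma>'\<in>set Gs. \<forall>s t. \<gamma> = \<gamma>' \<or> 2 * r \<le> dist (\<gamma> s) (\<gamma>' t)"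
    using tangent_balls by (elim exE conjE) (rule that)
  note r = r1 r2[rule_format] r3[rule_format]
  have dich: "S \<subseteq> \<Omega> \<or> S \<inter> \<Omega> = {}" if "connected S" "S \<inter> frontier \<Omega> = {}" for S
    using connected_Int_frontier[OF that(1), of \<Omega>] that(2) by blast
  have "\<exists>\<sigma>. \<bar>\<sigma>\<bar> = (1::real) \<and>
     (\<forall>t. ball (\<gamma> t + (\<sigma> * r) *\<^sub>R curve_normal \<gamma> t) r \<subseteq> \<Omega>) \<and>
     (\<forall>t. ball (\<gamma> t - (\<sigma> * r) *\<^sub>R curve_normal \<gamma> t) r \<inter> \<Omega> = {})" if g: "\<gamma> \<in> set Gs" for \<gamma>
  proof -
    note \<gamma> = curves[OF g]
    define B where "B = (\<lambda>\<sigma> t. ball (\<gamma> t + (\<sigma> * r) *\<^sub>R curve_normal \<gamma> t) r)"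
    \<comment> \<open>The centres trace a connected set off the frontier, so all discs on one side
      share the same alternative; this makes the sign independent of t.\<close>
    have side: "(\<forall>t. B \<sigma> t \<subseteq> \<Omega>) \<or> (\<forall>t. B \<sigma> t \<inter> \<Omega> = {})" if "\<bar>\<sigma>\<bar> = 1" for \<sigma>
    proof -
      have \<sigma>: "\<bar>\<sigma> * r\<bar> = r" using that r by (simp add: abs_mult)
      have cen: "\<gamma> t + (\<sigma> * r) *\<^sub>R curve_normal \<gamma> t \<in> B \<sigma> t" for t using r(1) by (simp add: B_def)
      have Bf: "B \<sigma> t \<inter> frontier \<Omega> = {}" for t unfolding B_def using r(2)[OF g \<sigma>] .
      have Bd: "B \<sigma> t \<subseteq> \<Omega> \<or> B \<sigma> t \<inter> \<Omega> = {}" for t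
        by (rule dich[OF _ Bf]) (simp add: B_def)
      let ?C = "range (\<lambda>t. \<gamma> t + (\<sigma> * r) *\<^sub>R curve_normal \<gamma> t)"
      have "connected ?C"
        by (intro connected_continuous_image continuous_intros smooth_curve_derivs(2)[OF \<gamma>] continuous_curve_normal[OF \<gamma>]) simp
      moreover have "?C \<inter> frontier \<Omega> = {}" using cen Bf by blast
      ultimately have "?C \<subseteq> \<Omega> \<or> ?C \<inter> \<Omega> = {}" by (rule dich)
      then show ?thesis using Bd cen by blast
    qed
    \<comment> \<open>Within r of \<open>\<gamma> 0\<close> the nearest frontier point lies on the
      same curve, since the other curves are 2r away; hence x lies in a tangent disc of that
      curve.\<close>
    have near: "\<exists>\<sigma>\<in>{1, -1}. \<exists>t. x \<in> B \<sigma> t" if x: "x \<notin> frontier \<Omega>" "dist x (\<gamma> 0) < r" for x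
    proof -
      obtain \<gamma>' t l where n: "\<gamma>' \<in> set Gs" "x = \<gamma>' t + l *\<^sub>R curve_normal \<gamma>' t" "\<bar>l\<bar> = infdist x (frontier \<Omega>)" "l \<noteq> 0"
        using nearest_frontier_point[OF x(1)] by metis
      have l: "\<bar>l\<bar> < r" using n(3) infdist_le[OF curve_in_frontier[OF g], of x 0] x(2) by linarith
      have "dist x (\<gamma>' t) = \<bar>l\<bar>" using norm_curve_normal[OF curves[OF n(1)], of t] by (subst n(2)) (simp add: dist_norm)
      then have "dist (\<gamma> 0) (\<gamma>' t) < 2 * r" using dist_triangle3[of "\<gamma> 0" "\<gamma>' t" x] x(2) l by linarith
      then have gg: "\<gamma> = \<gamma>'" using r(3)[OF g n(1), of 0 t] by linarith
      have "x \<in> B (sgn l) t"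
        using in_tangent_ball[OF g n(4), of r t] l r(1) n(2) gg by (simp add: B_def)
      moreover have "sgn l \<in> {1, -1}" using n(4) by (auto simp: sgn_if)
      ultimately show ?thesis by blast
    qed
    have frc: "x \<in> curve_image \<gamma>" if x: "x \<in> frontier \<Omega>" "dist x (\<gamma> 0) < r" for x
    proof -
      obtain \<gamma>' s where g': "\<gamma>' \<in> set Gs" "x = \<gamma>' s" using frontier_curve[OF x(1)] by metis
      then have "\<gamma>' = \<gamma>" using r(3)[OF g'(1) g, of s 0] x(2) r(1) by auto
      then show ?thesis using g'(2) curve_image_range[OF \<gamma>] by auto
    qed
    have g0: "\<gamma> 0 \<in> curve_image \<gamma>" using curve_image_range[OF \<gamma>] by auto
    have Jordan: "inside (curve_image \<gamma>) \<inter> outside (curve_image \<gamma>) = {}"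
      "frontier (inside (curve_image \<gamma>)) = curve_image \<gamma>" "frontier (outside (curve_image \<gamma>)) = curve_image \<gamma>"
      using Jordan_inside_outside[OF smooth_curve_simple_path(1,2)[OF \<gamma>]] smooth_curve_simple_path(3)[OF \<gamma>] by auto
    have approach: "\<exists>x\<in>S. dist x (\<gamma> 0) < r" if "\<gamma> 0 \<in> frontier S" for S
    proof -
      have "\<gamma> 0 \<in> closure S" using that by (simp add: frontier_def)
      then show ?thesis using r(1) unfolding closure_approachable by blast
    qed
    have notboth: "\<not> ((\<forall>t. B 1 t \<subseteq> \<Omega>) \<and> (\<forall>t. B (-1) t \<subseteq> \<Omega>))"
    proof
      assume both: "(\<forall>t. B 1 t \<subseteq> \<Omega>) \<and> (\<forall>t. B (-1) t \<subseteq> \<Omega>)"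
      have inO: "x \<in> \<Omega>" if "dist x (\<gamma> 0) < r" "x \<notin> curve_image \<gamma>" for x
        using near[of x] frc[of x] that both by blast
      obtain x where x: "x \<in> inside (curve_image \<gamma>)" "dist x (\<gamma> 0) < r" using approach[of "inside (curve_image \<gamma>)"] Jordan g0 by blast
      obtain y where y: "y \<in> outside (curve_image \<gamma>)" "dist y (\<gamma> 0) < r" using approach[of "outside (curve_image \<gamma>)"] Jordan g0 by blast
      have "x \<notin> curve_image \<gamma>" using x inside_no_overlap by blast
      then have "x \<in> \<Omega>" using inO x by blast
      have "y \<notin> curve_image \<gamma>" using y outside_no_overlap by blast
      then have "y \<in> \<Omega>" using inO y by blast
      have "y \<notin> inside (curve_image \<gamma>)" using y Jordan by blast
      have "\<Omega> \<inter> frontier (inside (curve_image \<gamma>)) \<noteq> {}"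
        by (rule connected_Int_frontier[OF connected_dom]) (use x \<open>x \<in> \<Omega>\<close> \<open>y \<in> \<Omega>\<close> \<open>y \<notin> inside (curve_image \<gamma>)\<close> in auto)
      then show False using Jordan(2) frontier_disjoint g frontier_dom by blast
    qed
    \<comment> \<open>\<Omega> accumulates at its frontier point \<open>\<gamma> 0\<close>, and its
      points near there lie in one of the two families.\<close>
    have notnone: "\<not> ((\<forall>t. B 1 t \<inter> \<Omega> = {}) \<and> (\<forall>t. B (-1) t \<inter> \<Omega> = {}))"
    proof
      assume none: "(\<forall>t. B 1 t \<inter> \<Omega> = {}) \<and> (\<forall>t. B (-1) t \<inter> \<Omega> = {})"
      obtain x where x: "x \<in> \<Omega>" "dist x (\<gamma> 0) < r" using approach[OF curve_in_frontier[OF g]] by blast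
      have "x \<notin> frontier \<Omega>" using x frontier_disjoint by blast
      then show False using near[OF _ x(2)] none x(1) by blast
    qed
    have "(\<forall>t. B 1 t \<subseteq> \<Omega>) \<and> (\<forall>t. B (-1) t \<inter> \<Omega> = {}) \<or> (\<forall>t. B (-1) t \<subseteq> \<Omega>) \<and> (\<forall>t. B 1 t \<inter> \<Omega> = {})"
      using side[of 1] side[of "-1"] notboth notnone by auto
    then show ?thesis
    proof
      assume "(\<forall>t. B 1 t \<subseteq> \<Omega>) \<and> (\<forall>t. B (-1) t \<inter> \<Omega> = {})"
      then show ?thesis by (intro exI[of _ 1]) (simp add: B_def)
    next
      assume "(\<forall>t. B (-1) t \<subseteq> \<Omega>) \<and> (\<forall>t. B 1 t \<inter> \<Omega> = {})"
      then show ?thesis by (intro exI[of _ "-1"]) (simp add: B_def)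
    qed
  qed
  then show ?thesis using r(1) by blast
qed

text \<open>A point of \<Omega> at distance d < r from the frontier sits on the inner normal of its
  foot. The exterior tangent disc at the foot has its centre r beyond it on the other side, hence r
  + d away from the point.\<close>

lemma exterior_balls:
  "\<exists>r>0. \<forall>z\<in>\<Omega>. infdist z (frontier \<Omega>) < r \<longrightarrow>
     (\<exists>q. dist z q \<le> r + infdist z (frontier \<Omega>) \<and> ball q r \<inter> \<Omega> = {})"
proof -
  obtain r where r: "r > 0" "\<And>\<gamma>. \<gamma> \<in> set Gs \<Longrightarrow> \<exists>\<sigma>. \<bar>\<sigma>\<bar> = (1::real) \<and>
     (\<forall>t. ball (\<gamma> t + (\<sigma> * r) *\<^sub>R curve_normal \<gamma> t) r \<subseteq> \<Omega>) \<and>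
     (\<forall>t. ball (\<gamma> t - (\<sigma> * r) *\<^sub>R curve_normal \<gamma> t) r \<inter> \<Omega> = {})"
    using one_sided by blast
  have "\<exists>q. dist z q \<le> r + infdist z (frontier \<Omega>) \<and> ball q r \<inter> \<Omega> = {}"
    if z: "z \<in> \<Omega>" and d: "infdist z (frontier \<Omega>) < r" for z
  proof -
    have "z \<notin> frontier \<Omega>" using z frontier_disjoint by blast
    then obtain \<gamma> t l where n: "\<gamma> \<in> set Gs" "z = \<gamma> t + l *\<^sub>R curve_normal \<gamma> t"
      "\<bar>l\<bar> = infdist z (frontier \<Omega>)" "l \<noteq> 0"
      using nearest_frontier_point by metis
    obtain \<sigma> where \<sigma>: "\<bar>\<sigma>\<bar> = (1::real)" "\<And>t. ball (\<gamma> t - (\<sigma> * r) *\<^sub>R curve_normal \<gamma> t) r \<inter> \<Omega> = {}"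
      using r(2)[OF n(1)] by blast
    have zb: "z \<in> ball (\<gamma> t + (sgn l * r) *\<^sub>R curve_normal \<gamma> t) r"
      unfolding n(2) by (rule in_tangent_ball[OF n(1,4)]) (use n d r in auto)
    have "sgn l \<noteq> - \<sigma>"
    proof
      assume "sgn l = - \<sigma>"
      then have "z \<in> ball (\<gamma> t - (\<sigma> * r) *\<^sub>R curve_normal \<gamma> t) r" using zb by simp
      then show False using \<sigma>(2) z by blast
    qed
    then have s: "sgn l = \<sigma>" using \<sigma>(1) n(4) by (auto simp: sgn_if abs_if split: if_splits)
    have "dist z (\<gamma> t - (\<sigma> * r) *\<^sub>R curve_normal \<gamma> t) = norm ((l + \<sigma> * r) *\<^sub>R curve_normal \<gamma> t)"
      unfolding n(2) by (simp add: dist_norm scaleR_add_left)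
    also have "\<dots> = \<bar>l + \<sigma> * r\<bar>" using norm_curve_normal[OF curves[OF n(1)]] by simp
    also have "\<dots> \<le> r + infdist z (frontier \<Omega>)" using \<sigma>(1) r(1) n(3) by (auto simp: abs_if split: if_splits)
    finally show ?thesis using \<sigma>(2) by blast
  qed
  then show ?thesis using r(1) by blast
qed

text \<open>At a frontier point the direction is the inner unit normal there. Nearby normals make an
  angle below 60 degrees with it, so a short step along it from any nearby frontier point enters an
  interior tangent disc, and a step backwards enters an exterior one. A path starting in \<Omega>
  cannot leave: just before its earliest frontier point it would already be outside.\<close>

lemma inward_shiftable_dom: "inward_shiftable \<Omega>"
  unfolding inward_shiftable_def
proof
  obtain r where r: "r > 0" "\<And>\<gamma>. \<gamma> \<in> set Gs \<Longrightarrow> \<exists>\<sigma>. \<bar>\<sigma>\<bar> = (1::real) \<and>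
     (\<forall>t. ball (\<gamma> t + (\<sigma> * r) *\<^sub>R curve_normal \<gamma> t) r \<subseteq> \<Omega>) \<and>
     (\<forall>t. ball (\<gamma> t - (\<sigma> * r) *\<^sub>R curve_normal \<gamma> t) r \<inter> \<Omega> = {})"
    using one_sided by blast
  obtain \<delta> where \<delta>1: "\<delta> > 0"
    and \<delta>2: "\<forall>\<gamma>\<in>set Gs. \<forall>\<gamma>'\<in>set Gs. \<forall>s t. \<gamma> = \<gamma>' \<or> \<delta> \<le> dist (\<gamma> s) (\<gamma>' t)"
    using curves_separated by (elim exE conjE) (rule that)
  note \<delta> = \<delta>1 \<delta>2[rule_format]
  fix p assume p: "p \<in> closure \<Omega>"
  let ?Q = "\<lambda>n \<rho> \<epsilon>. \<rho> > 0 \<and> \<epsilon> > 0 \<and> norm n \<le> 1 \<and>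
     (\<forall>z\<in>closure \<Omega> \<inter> ball p \<rho>. \<forall>t. 0 < t \<and> t < \<epsilon> \<longrightarrow> z + of_real t * n \<in> \<Omega>)"
  show "\<exists>n \<rho> \<epsilon>. ?Q n \<rho> \<epsilon>"
  proof (cases "p \<in> \<Omega>")
    case True
    then obtain \<rho> where "\<rho> > 0" "ball p \<rho> \<subseteq> \<Omega>" using open_dom openE by blast
    \<comment> \<open>Interior points are left in place, which is why the direction may have norm
      less than 1.\<close>
    then have "?Q 0 \<rho> 1" by auto
    then show ?thesis by blast
  next
    case False
    then have "p \<in> frontier \<Omega>" using p closure_Un_frontier by blast
    then obtain \<gamma> t0 where g: "\<gamma> \<in> set Gs" "t0 \<in> {0..1}" "p = \<gamma> t0" using frontier_curve by metis
    note \<gamma> = curves[OF g(1)]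
    obtain \<sigma> where \<sigma>: "\<bar>\<sigma>\<bar> = (1::real)" "\<And>t. ball (\<gamma> t + (\<sigma> * r) *\<^sub>R curve_normal \<gamma> t) r \<subseteq> \<Omega>"
       "\<And>t. ball (\<gamma> t - (\<sigma> * r) *\<^sub>R curve_normal \<gamma> t) r \<inter> \<Omega> = {}"
      using r(2)[OF g(1)] by blast
    let ?N = "curve_normal \<gamma>"
    obtain c where c: "c > 0" "\<And>s t. t \<in> {0..1} \<Longrightarrow> \<bar>s - t\<bar> \<le> 1/2 \<Longrightarrow> c * \<bar>s - t\<bar> \<le> norm (\<gamma> s - \<gamma> t)"
      using smooth_curve_bilipschitz[OF \<gamma>] by blast
    have "isCont ?N t0" using continuous_curve_normal[OF \<gamma>, of UNIV] by (simp add: continuous_on_eq_continuous_at)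
    then have "\<exists>\<tau>>0. \<forall>s. dist s t0 < \<tau> \<longrightarrow> dist (?N s) (?N t0) < 1"
      unfolding continuous_at_eps_delta by (rule allE[of _ 1]) simp
    then obtain \<tau> where \<tau>: "\<tau> > 0" "\<And>s. dist s t0 < \<tau> \<Longrightarrow> dist (?N s) (?N t0) < 1" by blast
    \<comment> \<open>Frontier points within 2\<rho> of p lie on the same curve (by
      \<open>\<delta>\<close>) and have a parameter within \<open>\<tau>\<close> of
      \<open>t0\<close> (by \<open>c\<close> times \<open>\<tau>\<close>); steps shorter than \<rho>
      are shorter than r.\<close>
    define \<rho> where "\<rho> = min (min \<delta> (c * \<tau>)) r / 2"
    have \<rho>: "\<rho> > 0" "2 * \<rho> \<le> \<delta>" "2 * \<rho> \<le> c * \<tau>" "2 * \<rho> \<le> r" using \<delta> c \<tau> r by (auto simp: \<rho>_def)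
    define n where "n = \<sigma> *\<^sub>R ?N t0"
    have n1: "norm n = 1" using \<sigma>(1) norm_curve_normal[OF \<gamma>] by (simp add: n_def)
    have cone: "w + s *\<^sub>R n \<in> \<Omega>" "w - s *\<^sub>R n \<notin> \<Omega>" if w: "w \<in> frontier \<Omega>" "dist w p < 2 * \<rho>" and s: "0 < s" "s < r" for w s
    proof -
      obtain \<gamma>' u where u: "\<gamma>' \<in> set Gs" "w = \<gamma>' u" using frontier_curve[OF w(1)] by metis
      then have "\<gamma>' = \<gamma>" using \<delta>(2)[OF u(1) g(1), of u t0] w(2) \<rho>(2) g(3) by auto
      obtain m where m: "\<bar>u + of_int m - t0\<bar> \<le> 1/2" using real_shift_near by blast
      define v where "v = u + of_int m"
      have wv: "w = \<gamma> v" unfolding v_def using u(2) \<open>\<gamma>' = \<gamma>\<close> smooth_curve_periodic[OF \<gamma>] by simp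
      have "c * \<bar>v - t0\<bar> \<le> dist w p" using c(2)[OF g(2)] m wv g(3) by (simp add: v_def dist_norm)
      then have "c * \<bar>v - t0\<bar> < c * \<tau>" using w(2) \<rho>(3) by linarith
      then have "\<bar>v - t0\<bar> < \<tau>" using c(1) by simp
      then have Nv: "norm (?N v - ?N t0) < 1" using \<tau>(2)[of v] by (simp add: dist_norm)
      have in0: "?N v \<bullet> ?N t0 > 1/2"
      proof -
        have "(norm (?N v - 1 *\<^sub>R ?N t0))\<^sup>2 = 1 - 2 * (?N v \<bullet> ?N t0) + 1"
          using norm_sub_scaled_unit[OF norm_curve_normal[OF \<gamma>], of "?N v" 1 t0] norm_curve_normal[OF \<gamma>] by simp
        moreover have "(norm (?N v - 1 *\<^sub>R ?N t0))\<^sup>2 < 1" using Nv by (simp add: power_less_one_iff abs_square_less_1)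
        ultimately show ?thesis by linarith
      qed
      have \<sigma>pm: "\<sigma> = 1 \<or> \<sigma> = -1" using \<sigma>(1) by (auto simp: abs_if split: if_splits)
      have "(norm (s *\<^sub>R n - (\<sigma> * r) *\<^sub>R ?N v))\<^sup>2 = s\<^sup>2 - 2 * (\<sigma> * r) * (s * \<sigma> * (?N t0 \<bullet> ?N v)) + (\<sigma> * r)\<^sup>2"
        unfolding norm_sub_scaled_unit[OF norm_curve_normal[OF \<gamma>]] by (simp add: n_def norm_curve_normal[OF \<gamma>] \<sigma>(1) power_mult_distrib power2_abs[of \<sigma>, symmetric])
      also have "\<dots> = s\<^sup>2 - 2 * r * s * (?N v \<bullet> ?N t0) + r\<^sup>2"
        using \<sigma>pm by (elim disjE) (simp_all add: inner_commute)
      \<comment> \<open>The inner product exceeds 1/2 and s < r, so the cross term outweighs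
        s^2.\<close>
      also have "\<dots> < r\<^sup>2"
      proof -
        have "s\<^sup>2 < r * s" using s by (simp add: power2_eq_square)
        moreover have "2 * r * s * (1/2) < 2 * r * s * (?N v \<bullet> ?N t0)" using in0 s r(1) by (intro mult_strict_left_mono) auto
        ultimately show ?thesis by simp
      qed
      finally have lt: "norm (s *\<^sub>R n - (\<sigma> * r) *\<^sub>R ?N v) < r" using r(1) by (rule_tac power2_less_imp_less) auto
      have "w + s *\<^sub>R n \<in> ball (\<gamma> v + (\<sigma> * r) *\<^sub>R ?N v) r"
        using lt by (simp add: wv dist_norm norm_minus_commute algebra_simps)
      then show "w + s *\<^sub>R n \<in> \<Omega>" using \<sigma>(2) by blast
      have "w - s *\<^sub>R n \<in> ball (\<gamma> v - (\<sigma> * r) *\<^sub>R ?N v) r"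
        using lt by (simp add: wv dist_norm algebra_simps)
      then show "w - s *\<^sub>R n \<notin> \<Omega>" using \<sigma>(3) by blast
    qed
    have "z + of_real t * n \<in> \<Omega>" if z: "z \<in> closure \<Omega>" "z \<in> ball p \<rho>" and t: "0 < t" "t < \<rho>" for z t
    proof (cases "z \<in> \<Omega>")
      case False
      then have "z \<in> frontier \<Omega>" using z closure_Un_frontier by blast
      then show ?thesis using cone(1)[of z t] z t \<rho> by (simp add: scaleR_conv_of_real dist_commute)
    next
      case True
      show ?thesis
      proof (rule ccontr)
        assume out: "z + of_real t * n \<notin> \<Omega>"
        define S where "S = {s \<in> {0..t}. z + s *\<^sub>R n \<in> frontier \<Omega>}"
        have ind: "\<exists>s\<in>S. s \<le> u" if u: "0 \<le> u" "u \<le> t" "z + u *\<^sub>R n \<notin> \<Omega>" for u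
        proof -
          have "(\<lambda>s. z + s *\<^sub>R n) ` {0..u} \<inter> frontier \<Omega> \<noteq> {}"
          proof (rule connected_Int_frontier)
            show "connected ((\<lambda>s. z + s *\<^sub>R n) ` {0..u})"
              by (intro connected_continuous_image continuous_intros) simp
            show "(\<lambda>s. z + s *\<^sub>R n) ` {0..u} \<inter> \<Omega> \<noteq> {}" using True u(1) by force
            show "(\<lambda>s. z + s *\<^sub>R n) ` {0..u} - \<Omega> \<noteq> {}" using u by force
          qed
          then show ?thesis using u by (force simp: S_def)
        qed
        have "S \<noteq> {}" using ind[of t] out t by (auto simp: scaleR_conv_of_real)
        moreover have "compact S"
        proof -
          have "closed ((\<lambda>s. z + s *\<^sub>R n) -` frontier \<Omega>)" by (intro closed_vimage frontier_closed continuous_intros)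
          then have "compact ({0..t} \<inter> (\<lambda>s. z + s *\<^sub>R n) -` frontier \<Omega>)" by (intro compact_Int_closed) auto
          then show ?thesis by (simp add: S_def vimage_def Int_def conj_commute)
        qed
        ultimately obtain s1 where s1: "s1 \<in> S" "\<And>s. s \<in> S \<Longrightarrow> s1 \<le> s" using compact_attains_inf by metis
        let ?w = "z + s1 *\<^sub>R n"
        have w: "?w \<in> frontier \<Omega>" and s1': "0 \<le> s1" "s1 \<le> t" using s1(1) by (auto simp: S_def)
        have "s1 \<noteq> 0" using w True frontier_disjoint by auto
        then have s10: "0 < s1" using s1' by simp
        have "dist ?w p \<le> dist z p + s1" using norm_triangle_ineq[of "z - p" "s1 *\<^sub>R n"] s10 n1 by (simp add: dist_norm algebra_simps)
        then have dw: "dist ?w p < 2 * \<rho>" using z t s1' by (simp add: dist_commute)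
        \<comment> \<open>Half a step back from the earliest frontier point is already outside
          \<Omega>, which forces a frontier point at a parameter not above s1/2.\<close>
        have "?w - (s1/2) *\<^sub>R n \<notin> \<Omega>" by (rule cone(2)[OF w dw]) (use s10 s1' t \<rho> in auto)
        moreover have "?w - (s1/2) *\<^sub>R n = z + (s1/2) *\<^sub>R n"
          by (simp add: scaleR_conv_of_real algebra_simps)
        ultimately have "z + (s1/2) *\<^sub>R n \<notin> \<Omega>" by simp
        then obtain s where "s \<in> S" "s \<le> s1/2" using ind[of "s1/2"] s10 s1' by auto
        then show False using s1(2) s10 by force
      qed
    qed
    then have "?Q n \<rho> \<rho>" using \<rho>(1) n1 by auto
    then show ?thesis by blast
  qed
qed

end

section \<open>Uniform approximation in smooth domains\<close>

lemma A_infty_if_holomorphic_nbhd: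
  assumes V: "open V" "closure \<Omega> \<subseteq> V" "g holomorphic_on V"
  shows "A_infty \<Omega> g"
proof -
  have "continuous_on (closure \<Omega>) ((deriv ^^ n) g)" for n
    using holomorphic_higher_deriv[OF V(3,1)] V(2) holomorphic_on_imp_continuous_on continuous_on_subset by blast
  moreover have "g holomorphic_on \<Omega>" using V closure_subset holomorphic_on_subset by blast
  moreover have "continuous_on (closure \<Omega>) g"
    using V holomorphic_on_imp_continuous_on continuous_on_subset by blast
  ultimately show ?thesis unfolding A_infty_def by blast
qed

text \<open>The derivative is bounded on \<Omega> only, where it agrees with its continuous
  extension; off \<Omega> the value of \<open>deriv g\<close> carries no information.\<close>

lemma A_infty_bounds:
  assumes "A_infty \<Omega> g" "bounded \<Omega>"
  obtains M where "M \<ge> 0" "\<And>z. z \<in> closure \<Omega> \<Longrightarrow> norm (g z) \<le> M" "\<And>z. z \<in> \<Omega> \<Longrightarrow> norm (deriv g z) \<le> M"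
proof -
  have K: "compact (closure \<Omega>)" using assms(2) by (simp add: compact_closure)
  have bd: "\<exists>M. \<forall>z\<in>closure \<Omega>. norm (h z) \<le> M" if "continuous_on (closure \<Omega>) h" for h :: "complex \<Rightarrow> complex"
    using compact_imp_bounded[OF compact_continuous_image[OF that K]] unfolding bounded_iff by blast
  obtain M0 where M0: "\<And>z. z \<in> closure \<Omega> \<Longrightarrow> norm (g z) \<le> M0" using bd assms(1) unfolding A_infty_def by blast
  obtain G where G: "continuous_on (closure \<Omega>) G" "\<And>z. z \<in> \<Omega> \<Longrightarrow> G z = deriv g z"
    using assms(1) unfolding A_infty_def by (metis funpow_0 funpow_simps_right(2) comp_apply One_nat_def)
  obtain M1 where M1: "\<And>z. z \<in> closure \<Omega> \<Longrightarrow> norm (G z) \<le> M1" using bd[OF G(1)] by blast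
  show ?thesis
  proof (rule that[of "max 0 (max M0 M1)"])
    show "norm (deriv g z) \<le> max 0 (max M0 M1)" if "z \<in> \<Omega>" for z
      using M1[of z] G(2)[OF that] that closure_subset[of \<Omega>] by fastforce
    show "norm (g z) \<le> max 0 (max M0 M1)" if "z \<in> closure \<Omega>" for z
      using M0[OF that] by simp
  qed simp
qed

lemma A_infty_polynomial: "A_infty \<Omega> (poly p)"
  by (rule A_infty_if_holomorphic_nbhd[of UNIV]) (auto intro!: holomorphic_intros)

lemma A_infty_diff_poly:
  assumes "A_infty \<Omega> g" "open \<Omega>"
  shows "A_infty \<Omega> (\<lambda>z. g z - poly p z)"
proof -
  have g: "g holomorphic_on \<Omega>" "continuous_on (closure \<Omega>) g" using assms by (auto simp: A_infty_def)
  have p: "poly p holomorphic_on S" for S by (auto intro!: holomorphic_intros)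
  have "\<exists>G. continuous_on (closure \<Omega>) G \<and> (\<forall>z\<in>\<Omega>. G z = (deriv ^^ n) (\<lambda>z. g z - poly p z) z)" for n
  proof -
    obtain G where G: "continuous_on (closure \<Omega>) G" "\<And>z. z \<in> \<Omega> \<Longrightarrow> G z = (deriv ^^ n) g z"
      using assms(1) unfolding A_infty_def by blast
    have "continuous_on (closure \<Omega>) (\<lambda>z. G z - (deriv ^^ n) (poly p) z)"
      by (intro continuous_intros G holomorphic_on_imp_continuous_on holomorphic_on_subset[OF holomorphic_higher_deriv[OF p[of UNIV]]]) auto
    moreover have "G z - (deriv ^^ n) (poly p) z = (deriv ^^ n) (\<lambda>z. g z - poly p z) z" if "z \<in> \<Omega>" for z
      using higher_deriv_diff[OF g(1) p assms(2) that] G(2)[OF that] by simp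
    ultimately show ?thesis by blast
  qed
  then show ?thesis unfolding A_infty_def
    using g p by (auto intro!: holomorphic_intros continuous_intros)
qed

context smooth_domain
begin

lemma compact_closure_dom: "compact (closure \<Omega>)"
  using bounded_dom by (simp add: compact_closure)

lemma ball_infdist_frontier:
  assumes "z \<in> \<Omega>"
  shows "ball z (infdist z (frontier \<Omega>)) \<subseteq> \<Omega>" "infdist z (frontier \<Omega>) > 0"
proof -
  have z: "z \<notin> frontier \<Omega>" using assms frontier_disjoint by blast
  show pos: "infdist z (frontier \<Omega>) > 0"
    using infdist_pos_not_in_closed[OF frontier_closed frontier_nonempty z] .
  have "w \<notin> frontier \<Omega>" if "w \<in> ball z (infdist z (frontier \<Omega>))" for w
    using infdist_le[of w "frontier \<Omega>" z] that by auto
  then have "ball z (infdist z (frontier \<Omega>)) \<inter> frontier \<Omega> = {}" by blast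
  moreover have "ball z (infdist z (frontier \<Omega>)) \<inter> \<Omega> \<noteq> {}"
    using assms centre_in_ball[of z "infdist z (frontier \<Omega>)"] pos by blast
  ultimately show "ball z (infdist z (frontier \<Omega>)) \<subseteq> \<Omega>"
    using connected_Int_frontier[OF connected_ball] by blast
qed

lemma infdist_frontier_ge:
  assumes "ball z \<delta> \<subseteq> \<Omega>"
  shows "\<delta> \<le> infdist z (frontier \<Omega>)"
proof (rule ccontr)
  assume "\<not> \<delta> \<le> infdist z (frontier \<Omega>)"
  moreover obtain w where "w \<in> frontier \<Omega>" "infdist z (frontier \<Omega>) = dist z w"
    using infdist_attains_inf[OF frontier_closed frontier_nonempty] by metis
  ultimately have "w \<in> ball z \<delta>" by simp
  then show False using assms frontier_disjoint \<open>w \<in> frontier \<Omega>\<close> by blast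
qed

text \<open>On a nonconvex domain a bounded derivative gives no direct Lipschitz bound. Uniform
  continuity comes instead from the uniform approximants and yields the extension \<open>k'\<close>;
  the error bounds pass to the closure by continuity.\<close>

theorem uniform_approx:
  assumes k: "k holomorphic_on \<Omega>" and M: "\<And>z. z \<in> \<Omega> \<Longrightarrow> norm (deriv k z) \<le> M"
  obtains k' where "continuous_on (closure \<Omega>) k'" "\<And>z. z \<in> \<Omega> \<Longrightarrow> k' z = k z"
    "\<And>e. e > 0 \<Longrightarrow> \<exists>H. A_infty \<Omega> H \<and> (\<forall>z\<in>closure \<Omega>. norm (H z - k' z) \<le> e)"
proof -
  have ap: "\<exists>H. A_infty \<Omega> H \<and> (\<forall>z\<in>\<Omega>. norm (H z - k z) \<le> e)" if "e > 0" for e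
    using holomorphic_approx_closure[OF open_dom bounded_dom inward_shiftable_dom k M that] A_infty_if_holomorphic_nbhd
    by blast
  have "uniformly_continuous_on \<Omega> k"
    unfolding uniformly_continuous_on_def
  proof (intro allI impI)
    fix e :: real assume e: "e > 0"
    obtain H where H: "A_infty \<Omega> H" "\<And>z. z \<in> \<Omega> \<Longrightarrow> norm (H z - k z) \<le> e / 3" using ap[of "e/3"] e by auto
    have "uniformly_continuous_on (closure \<Omega>) H"
      using H(1) compact_closure_dom compact_uniformly_continuous unfolding A_infty_def by blast
    then obtain d where d: "d > 0" "\<And>x x'. x \<in> closure \<Omega> \<Longrightarrow> x' \<in> closure \<Omega> \<Longrightarrow> dist x' x < d \<Longrightarrow> dist (H x') (H x) < e / 3"
      unfolding uniformly_continuous_on_def using e by (metis divide_pos_pos zero_less_numeral)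
    have "dist (k x') (k x) < e" if x: "x \<in> \<Omega>" "x' \<in> \<Omega>" "dist x' x < d" for x x'
    proof -
      have "dist (H x') (H x) < e / 3" using d(2) x closure_subset by blast
      moreover have "dist (k x') (H x') \<le> e/3" "dist (H x) (k x) \<le> e/3"
        using H(2) x by (auto simp: dist_norm norm_minus_commute)
      ultimately show ?thesis
        using dist_triangle[of "k x'" "k x" "H x'"] dist_triangle[of "H x'" "k x" "H x"] by linarith
    qed
    then show "\<exists>d>0. \<forall>x\<in>\<Omega>. \<forall>x'\<in>\<Omega>. dist x' x < d \<longrightarrow> dist (k x') (k x) < e" using d(1) by blast
  qed
  then obtain k' where k': "uniformly_continuous_on (closure \<Omega>) k'" "\<And>x. x \<in> \<Omega> \<Longrightarrow> k x = k' x"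
    using uniformly_continuous_on_extension_on_closure by metis
  have ck: "continuous_on (closure \<Omega>) k'" using k'(1) by (rule uniformly_continuous_imp_continuous)
  have "\<exists>H. A_infty \<Omega> H \<and> (\<forall>z\<in>closure \<Omega>. norm (H z - k' z) \<le> e)" if e: "e > 0" for e
  proof -
    obtain H where H: "A_infty \<Omega> H" "\<And>z. z \<in> \<Omega> \<Longrightarrow> norm (H z - k z) \<le> e" using ap[OF e] by auto
    have "continuous_on (closure \<Omega>) (\<lambda>z. H z - k' z)"
      using H(1) ck unfolding A_infty_def by (intro continuous_intros) auto
    then have "norm (H z - k' z) \<le> e" if "z \<in> closure \<Omega>" for z
      by (rule continuous_on_closure_norm_le[OF _ _ that]) (use H(2) k'(2) in auto)
    then show ?thesis using H(1) by blast
  qed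
  then show ?thesis using that ck k'(2) by metis
qed

end

text \<open>The Schwarz-Pick inequality at the centre of a disc: rescale it to the unit disc, move
  \<open>f z\<close> to 0 by a Moebius map and apply the Schwarz lemma at 0.\<close>

lemma deriv_bound_unit_disc:
  assumes f: "f holomorphic_on ball z d" and d: "d > 0" and lt: "\<And>w. w \<in> ball z d \<Longrightarrow> norm (f w) < 1"
  shows "norm (deriv f z) * d \<le> 1 - (norm (f z))\<^sup>2"
proof -
  let ?a = "f z"
  have a: "norm ?a < 1" using lt d by auto
  define u where "u = (\<lambda>x::complex. z + of_real d * x)"
  have u: "u x \<in> ball z d" if "norm x < 1" for x
    using that d by (simp add: u_def dist_norm norm_mult)
  define g where "g = (\<lambda>x. Moebius_function 0 ?a (f (u x)))"
  have den: "1 - cnj ?a * y \<noteq> 0" if "norm y < 1" for y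
  proof
    assume "1 - cnj ?a * y = 0"
    then have "norm (cnj ?a * y) = 1" by (metis eq_iff_diff_eq_0 norm_one)
    moreover have "norm (cnj ?a * y) \<le> 1 * norm y" unfolding norm_mult using a by (intro mult_right_mono) auto
    ultimately show False using that by simp
  qed
  have hf: "(f \<circ> u) holomorphic_on ball 0 1"
    by (rule holomorphic_on_compose_gen[OF _ f]) (use u in \<open>auto simp: u_def[abs_def] intro!: holomorphic_intros\<close>)
  have "(Moebius_function 0 ?a \<circ> (f \<circ> u)) holomorphic_on ball 0 1"
    by (rule holomorphic_on_compose_gen[OF hf Moebius_function_holomorphic[OF a]]) (use lt u in auto)
  then have hg: "g holomorphic_on ball 0 1" by (simp add: g_def o_def)
  have g0: "g 0 = 0" by (simp add: g_def u_def Moebius_function_eq_zero)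
  have g1: "norm (g x) < 1" if "norm x < 1" for x
    unfolding g_def by (rule Moebius_function_norm_lt_1[OF a]) (use lt u that in blast)
  have le: "norm (deriv g 0) \<le> 1" by (rule Schwarz_Lemma(2)[OF hg g0 g1, of 0]) auto
  have df: "(f has_field_derivative deriv f z) (at (u 0))"
    using f d by (simp add: u_def holomorphic_derivI)
  have du: "(u has_field_derivative of_real d) (at 0)"
    unfolding u_def by (auto intro!: derivative_eq_intros)
  have dfu: "((\<lambda>x. f (u x)) has_field_derivative deriv f z * of_real d) (at 0)"
    by (rule DERIV_chain2[OF df du])
  have fu0: "f (u 0) = ?a" by (simp add: u_def)
  \<comment> \<open>The Moebius map sending \<open>?a\<close> to 0 has derivative 1/D at
    \<open>?a\<close>, and \<open>D\<close> is the positive number 1 -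
    |\<open>?a\<close>|^2.\<close>
  define D where "D = 1 - cnj ?a * ?a"
  have D0: "D \<noteq> 0" unfolding D_def by (rule den[OF a])
  have "((\<lambda>x. (f (u x) - ?a) / (1 - cnj ?a * f (u x))) has_field_derivative (deriv f z * of_real d) / D) (at 0)"
    by (rule derivative_eq_intros dfu refl | use D0 in \<open>simp add: fu0 D_def\<close>)+
  then have "deriv g 0 = (deriv f z * of_real d) / D"
    unfolding g_def Moebius_function_simple by (rule DERIV_imp_deriv)
  moreover have "norm D = 1 - (norm ?a)\<^sup>2"
  proof -
    have "D = of_real (1 - (norm ?a)\<^sup>2)" by (simp add: D_def complex_norm_square[symmetric] mult.commute)
    moreover have "1 - (norm ?a)\<^sup>2 \<ge> 0" using a by (simp add: power_le_one)
    ultimately show ?thesis by (metis norm_of_real abs_of_nonneg)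
  qed
  ultimately have "norm (deriv f z) * d / (1 - (norm ?a)\<^sup>2) \<le> 1"
    using le d by (simp add: norm_divide norm_mult)
  moreover have "1 - (norm ?a)\<^sup>2 > 0" using a by (simp add: power_less_one_iff abs_square_less_1)
  ultimately show ?thesis by (simp add: field_simps)
qed

section \<open>Boundary behaviour of proper maps onto the disc\<close>

locale proper_disc_map = smooth_domain +
  fixes f :: "complex \<Rightarrow> complex"
  assumes hol: "f holomorphic_on \<Omega>"
    and onto: "f ` \<Omega> = ball 0 1"
    and proper: "proper_map (top_of_set \<Omega>) (top_of_set (ball 0 1)) f"
begin

lemma norm_f_less: "z \<in> \<Omega> \<Longrightarrow> norm (f z) < 1"
  using onto by (metis image_eqI mem_ball_0)

text \<open>Properness enters in this form: the set where |f| is at most s < 1 stays away from the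
  frontier, so |f| tends to 1 there.\<close>

lemma compact_sublevel:
  assumes "s < 1"
  shows "compact {z \<in> \<Omega>. norm (f z) \<le> s}"
proof -
  have "compactin (top_of_set (ball 0 1)) (cball (0::complex) s)"
    using assms by (auto simp: compactin_subtopology)
  from compactin_proper_map_preimage[OF proper this]
  show ?thesis by (simp add: compactin_subtopology)
qed

lemma f_has_deriv: "z \<in> \<Omega> \<Longrightarrow> (f has_field_derivative deriv f z) (at z)"
  using hol open_dom by (rule holomorphic_derivI)

lemma continuous_f: "continuous_on \<Omega> f"
  using hol by (rule holomorphic_on_imp_continuous_on)

text \<open>Maximum principle for \<open>r\<^sup>n / (f (w) (w - q)\<^sup>n)\<close> on the compact sets
  \<open>{1/2 \<le> \<bar>f\<bar> \<le> s}\<close>, with \<open>s\<close> tending to 1.\<close>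
lemma exterior_ball_barrier:
  assumes r: "r > 0" and q: "ball q r \<inter> \<Omega> = {}"
    and n: "\<And>w. w \<in> \<Omega> \<Longrightarrow> norm (f w) = 1/2 \<Longrightarrow> 2 * r ^ n \<le> norm (w - q) ^ n"
    and z: "z \<in> \<Omega>" "1/2 \<le> norm (f z)"
  shows "r ^ n \<le> norm (f z) * norm (z - q) ^ n"
proof (rule ccontr)
  assume "\<not> r ^ n \<le> norm (f z) * norm (z - q) ^ n"
  then have less: "norm (f z) * norm (z - q) ^ n < r ^ n" by simp
  have far: "r \<le> norm (w - q)" if "w \<in> \<Omega>" for w
    using q that by (force simp: dist_norm norm_minus_commute not_less)
  define F where "F = (\<lambda>w. of_real (r ^ n) / (f w * (w - q) ^ n))"
  have zq: "norm (f z) * norm (z - q) ^ n > 0" using z far[OF z(1)] r by (intro mult_pos_pos zero_less_power) auto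
  have rn: "r ^ n > 0" using r by simp
  \<comment> \<open>If the claim fails then m < 1, and any s strictly between m and 1 contradicts |F
    z| = 1/m \<le> 1/s. Taking s at least |f z| puts z into \<open>S\<close>.\<close>
  define m where "m = norm (f z) * norm (z - q) ^ n / r ^ n"
  define s where "s = (1 + max (norm (f z)) m) / 2"
  have "max (norm (f z)) m < 1"
    using less rn norm_f_less[OF z(1)] by (simp add: m_def)
  then have s: "s < 1" "norm (f z) \<le> s" "m < s" "1/2 \<le> s"
    using z(2) by (auto simp: s_def max_def)
  define S where "S = {w \<in> \<Omega>. norm (f w) \<le> s} \<inter> {w \<in> \<Omega>. 1/2 \<le> norm (f w)}"
  have SO: "S \<subseteq> \<Omega>" by (auto simp: S_def)
  have KO: "{w \<in> \<Omega>. norm (f w) \<le> s} \<subseteq> \<Omega>" by auto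
  have "closed ({w \<in> \<Omega>. norm (f w) \<le> s} \<inter> (\<lambda>w. norm (f w)) -` {1/2..})"
    by (rule continuous_closed_preimage)
      (auto intro!: continuous_intros continuous_on_subset[OF continuous_f] compact_imp_closed compact_sublevel s)
  then have "compact ({w \<in> \<Omega>. norm (f w) \<le> s} \<inter> ({w \<in> \<Omega>. norm (f w) \<le> s} \<inter> (\<lambda>w. norm (f w)) -` {1/2..}))"
    by (intro compact_Int_closed compact_sublevel s)
  moreover have "S = {w \<in> \<Omega>. norm (f w) \<le> s} \<inter> ({w \<in> \<Omega>. norm (f w) \<le> s} \<inter> (\<lambda>w. norm (f w)) -` {1/2..})"
    by (auto simp: S_def)
  ultimately have S: "compact S" by simp
  have ne: "f w * (w - q) ^ n \<noteq> 0" if "w \<in> S" for w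
  proof -
    have "norm (w - q) > 0" using far[of w] SO that r by fastforce
    then show ?thesis using that by (auto simp: S_def)
  qed
  have holF: "F holomorphic_on interior S"
    unfolding F_def
    by (intro holomorphic_intros holomorphic_on_subset[OF hol]) (use SO interior_subset ne in blast)+
  have contF: "continuous_on (closure S) F"
    unfolding F_def using S SO ne
    by (intro continuous_intros continuous_on_subset[OF continuous_f]) (auto simp: compact_imp_closed)
  have "norm (F z) \<le> 1 / s"
  proof (rule maximum_modulus_frontier[OF holF contF compact_imp_bounded[OF S]])
    show "z \<in> S" using z s by (simp add: S_def)
    fix w assume w: "w \<in> frontier S"
    then have wS: "w \<in> S" "w \<notin> interior S" using S by (auto simp: frontier_def compact_imp_closed)
    have wO: "w \<in> \<Omega>" using wS SO by blast
    have "open (\<Omega> \<inter> (\<lambda>w. norm (f w)) -` {1/2<..<s})"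
      by (intro continuous_open_preimage continuous_intros continuous_f open_dom open_greaterThanLessThan)
    moreover have "\<Omega> \<inter> (\<lambda>w. norm (f w)) -` {1/2<..<s} \<subseteq> S" by (auto simp: S_def)
    ultimately have "w \<notin> \<Omega> \<inter> (\<lambda>w. norm (f w)) -` {1/2<..<s}" using wS(2) interior_maximal by blast
    \<comment> \<open>On the inner level |f| = 1/2 the factor 2 coming from 1/|f| is absorbed by the
      hypothesis on the power; on the outer level it suffices that w lies outside the disc about
      q.\<close>
    then have cases: "norm (f w) = 1/2 \<or> norm (f w) = s" using wS(1) wO by (auto simp: S_def)
    have Fw: "norm (F w) = r ^ n / (norm (f w) * norm (w - q) ^ n)"
      using r by (simp add: F_def norm_divide norm_mult norm_power)
    show "norm (F w) \<le> 1 / s"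
      using cases
    proof
      assume a: "norm (f w) = 1/2"
      have "norm (F w) \<le> 1"
      proof -
        have "0 < norm (w - q) ^ n" using far[OF wO] r by (intro zero_less_power) linarith
        then show ?thesis unfolding Fw a using n[OF wO a] by (simp add: divide_le_eq_1)
      qed
      also have "1 \<le> 1 / s" using s by simp
      finally show ?thesis .
    next
      assume a: "norm (f w) = s"
      have "r ^ n \<le> norm (w - q) ^ n" using far[OF wO] r by (intro power_mono) auto
      then have "r ^ n / norm (w - q) ^ n \<le> 1" using rn by simp
      then have "(r ^ n / norm (w - q) ^ n) / s \<le> 1 / s" using s by (intro divide_right_mono) auto
      then show ?thesis unfolding Fw a by (simp add: mult.commute)
    qed
  qed
  then have "r ^ n / (norm (f z) * norm (z - q) ^ n) \<le> 1 / s"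
    using r by (simp add: F_def norm_divide norm_mult norm_power)
  then have "s * r ^ n \<le> norm (f z) * norm (z - q) ^ n"
    using zq s by (simp add: field_simps)
  moreover have "norm (f z) * norm (z - q) ^ n < s * r ^ n" using s(3) rn by (simp add: m_def field_simps)
  ultimately show False by simp
qed

text \<open>A Hopf-type estimate. The level |f| = 1/2 keeps a positive distance from the frontier,
  so |w - q| is at least r + \<delta>/2 there and a large power n gains the factor 2. The barrier
  then gives |f z| \<ge> (r/(r + d))^n, with d the distance to the frontier, and Bernoulli's
  inequality makes this linear in d.\<close>

lemma one_minus_norm_f_le:
  "\<exists>C\<ge>0. \<forall>z\<in>\<Omega>. 1 - norm (f z) \<le> C * infdist z (frontier \<Omega>)"
proof -
  obtain r where r: "r > 0" "\<And>z. z \<in> \<Omega> \<Longrightarrow> infdist z (frontier \<Omega>) < r \<Longrightarrow>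
     \<exists>q. dist z q \<le> r + infdist z (frontier \<Omega>) \<and> ball q r \<inter> \<Omega> = {}"
    using exterior_balls by blast
  define K where "K = {z \<in> \<Omega>. norm (f z) \<le> 1/2}"
  have "compact K" unfolding K_def by (rule compact_sublevel) simp
  then obtain \<delta> where \<delta>: "\<delta> > 0" "(\<Union>x\<in>K. ball x \<delta>) \<subseteq> \<Omega>"
    using compact_subset_open_imp_ball_epsilon_subset[of K \<Omega>] open_dom by (auto simp: K_def)
  define x where "x = \<delta> / (2 * r)"
  have x: "x > 0" using \<delta> r by (simp add: x_def)
  obtain n where n: "2 < (1 + x) ^ n" using real_arch_pow[of "1 + x" 2] x by auto
  have far: "2 * r ^ n \<le> norm (w - q) ^ n" if w: "w \<in> \<Omega>" "norm (f w) = 1/2" and q: "ball q r \<inter> \<Omega> = {}" for w q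
  proof -
    have "w \<in> K" using w by (simp add: K_def)
    then have wK: "ball w \<delta> \<subseteq> \<Omega>" using \<delta>(2) by blast
    have qw: "norm (q - w) \<ge> \<delta>"
    proof (rule ccontr)
      assume "\<not> norm (q - w) \<ge> \<delta>"
      then have "q \<in> ball w \<delta>" by (simp add: dist_norm norm_minus_commute)
      then show False using wK q r(1) by (metis centre_in_ball disjoint_iff subsetD)
    qed
    \<comment> \<open>A point of the disc about w, pulled towards q: it lies in \<Omega>, hence
      outside the disc of radius r about q. Half of \<delta> keeps it inside the open disc.\<close>
    define y where "y = w + (\<delta>/2) *\<^sub>R sgn (q - w)"
    have ns: "norm (sgn (q - w)) = 1" using qw \<delta>(1) by (auto simp: norm_sgn)
    have "y \<in> ball w \<delta>" using \<delta>(1) ns by (simp add: y_def dist_norm)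
    then have "y \<notin> ball q r" using wK q by blast
    moreover have "dist q y = norm (q - w) - \<delta> / 2"
    proof -
      have qe: "q - w = norm (q - w) *\<^sub>R sgn (q - w)"
      proof -
        have "norm (q - w) \<noteq> 0" using qw \<delta>(1) by linarith
        then have e: "norm (q - w) * inverse (norm (q - w)) = 1" by (rule right_inverse)
        show ?thesis unfolding sgn_div_norm scaleR_scaleR e scaleR_one ..
      qed
      have "q - y = (norm (q - w) - \<delta> / 2) *\<^sub>R sgn (q - w)"
        unfolding scaleR_diff_left qe[symmetric] by (simp add: y_def)
      then show ?thesis using ns qw \<delta>(1) by (simp add: dist_norm)
    qed
    ultimately have "norm (w - q) \<ge> r + \<delta> / 2" by (simp add: norm_minus_commute)
    moreover have "r + \<delta> / 2 = (1 + x) * r" using r(1) by (simp add: x_def field_simps)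
    ultimately have "((1 + x) * r) ^ n \<le> norm (w - q) ^ n" using x r(1) by (intro power_mono) auto
    moreover have "2 * r ^ n \<le> (1 + x) ^ n * r ^ n" using n r(1) by (intro mult_right_mono) auto
    ultimately show ?thesis by (simp add: power_mult_distrib)
  qed
  \<comment> \<open>One summand for each case below: n/r near the frontier, 1/r when the distance is
    at least r, 1/\<delta> when |f| < 1/2.\<close>
  define C where "C = real n / r + 1 / r + 1 / \<delta>"
  have C0: "C \<ge> 0" "1 / r \<le> C" "1 / \<delta> \<le> C" "real n / r \<le> C" using r \<delta> by (auto simp: C_def)
  have "1 - norm (f z) \<le> C * infdist z (frontier \<Omega>)" if z: "z \<in> \<Omega>" for z
  proof -
    define d where "d = infdist z (frontier \<Omega>)"
    have d: "d > 0" using ball_infdist_frontier(2)[OF z] by (simp add: d_def)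
    have Cd: "c * d \<le> C * d" if "c \<le> C" for c using that d by (intro mult_right_mono) auto
    consider "r \<le> d" | "norm (f z) < 1/2" | "d < r" "1/2 \<le> norm (f z)" by linarith
    then have "1 - norm (f z) \<le> C * d"
    proof cases
      case 1
      have "1 - norm (f z) \<le> 1" by simp
      also have "\<dots> \<le> 1 / r * d" using 1 r(1) by (simp add: field_simps)
      also have "\<dots> \<le> C * d" using C0 by (intro Cd)
      finally show ?thesis .
    next
      case 2
      then have "z \<in> K" using z by (simp add: K_def)
      then have "ball z \<delta> \<subseteq> \<Omega>" using \<delta>(2) by blast
      then have "\<delta> \<le> d" unfolding d_def by (rule infdist_frontier_ge)
      have "1 - norm (f z) \<le> 1" by simp
      also have "\<dots> \<le> 1 / \<delta> * d" using \<open>\<delta> \<le> d\<close> \<delta>(1) by (simp add: field_simps)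
      also have "\<dots> \<le> C * d" using C0 by (intro Cd)
      finally show ?thesis .
    next
      case 3
      obtain q where q: "dist z q \<le> r + d" "ball q r \<inter> \<Omega> = {}" using r(2)[OF z] 3 by (auto simp: d_def)
      have "r ^ n \<le> norm (f z) * norm (z - q) ^ n"
        by (rule exterior_ball_barrier[OF r(1) q(2) far[OF _ _ q(2)] z 3(2)])
      also have "\<dots> \<le> norm (f z) * (r + d) ^ n"
        using q(1) by (intro mult_left_mono power_mono) (auto simp: dist_norm)
      finally have "(r / (r + d)) ^ n \<le> norm (f z)"
        using r(1) d by (simp add: power_divide divide_le_eq)
      moreover have "1 + real n * (- (d / (r + d))) \<le> (1 + (- (d / (r + d)))) ^ n"
        by (rule Bernoulli_inequality) (use r(1) d in \<open>simp add: field_simps\<close>)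
      moreover have "1 + (- (d / (r + d))) = r / (r + d)" using r(1) d by (simp add: field_simps)
      ultimately have "1 - norm (f z) \<le> real n * (d / (r + d))" by simp
      also have "\<dots> \<le> real n * (d / r)" using r(1) d by (intro mult_left_mono divide_left_mono) auto
      also have "\<dots> = real n / r * d" by simp
      also have "\<dots> \<le> C * d" using C0 by (intro Cd)
      finally show ?thesis .
    qed
    then show ?thesis by (simp add: d_def)
  qed
  then show ?thesis using C0(1) by blast
qed

lemma deriv_f_bounded: "\<exists>C\<ge>0. \<forall>z\<in>\<Omega>. norm (deriv f z) \<le> C"
proof -
  obtain C where C: "C \<ge> 0" "\<And>z. z \<in> \<Omega> \<Longrightarrow> 1 - norm (f z) \<le> C * infdist z (frontier \<Omega>)"
    using one_minus_norm_f_le by blast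
  have "norm (deriv f z) \<le> 2 * C" if z: "z \<in> \<Omega>" for z
  proof -
    define d where "d = infdist z (frontier \<Omega>)"
    have d: "d > 0" "ball z d \<subseteq> \<Omega>" using ball_infdist_frontier[OF z] by (auto simp: d_def)
    have "norm (deriv f z) * d \<le> 1 - (norm (f z))\<^sup>2"
      by (rule deriv_bound_unit_disc[OF holomorphic_on_subset[OF hol d(2)] d(1)]) (use d norm_f_less in auto)
    also have "\<dots> = (1 - norm (f z)) * (1 + norm (f z))" by (simp add: power2_eq_square algebra_simps)
    also have "\<dots> \<le> (1 - norm (f z)) * 2" using norm_f_less[OF z] by (intro mult_left_mono) auto
    also have "\<dots> \<le> 2 * C * d" using C(2)[OF z] by (simp add: d_def)
    finally show ?thesis using d(1) by simp
  qed
  then show ?thesis using C(1) by (intro exI[of _ "2 * C"]) auto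
qed

text \<open>Here \<open>f'\<close> is the continuous extension of \<open>f\<close>, not a
  derivative. Its modulus is at most 1 by continuity, and the bound of 1 - |f| by a multiple of the
  distance to the frontier extends to the closure; on the frontier that distance is 0.\<close>

lemma boundary_extension:
  obtains f' where "continuous_on (closure \<Omega>) f'" "\<And>z. z \<in> \<Omega> \<Longrightarrow> f' z = f z"
    "\<And>z. z \<in> frontier \<Omega> \<Longrightarrow> norm (f' z) = 1"
proof -
  obtain B where B: "\<And>z. z \<in> \<Omega> \<Longrightarrow> norm (deriv f z) \<le> B" using deriv_f_bounded by blast
  obtain f' where f': "continuous_on (closure \<Omega>) f'" "\<And>z. z \<in> \<Omega> \<Longrightarrow> f' z = f z"
    using uniform_approx[OF hol B] by metis
  obtain C where C: "C \<ge> 0" "\<And>z. z \<in> \<Omega> \<Longrightarrow> 1 - norm (f z) \<le> C * infdist z (frontier \<Omega>)"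
    using one_minus_norm_f_le by blast
  have "norm (f' w) = 1" if w: "w \<in> frontier \<Omega>" for w
  proof -
    have wc: "w \<in> closure \<Omega>" using w by (simp add: frontier_def)
    have "norm (f' w) \<le> 1"
      by (rule continuous_on_closure_norm_le[OF f'(1) _ wc]) (use f'(2) norm_f_less in \<open>auto simp: less_imp_le\<close>)
    moreover have "0 \<le> C * infdist w (frontier \<Omega>) - (1 - norm (f' w))"
      by (rule continuous_ge_on_closure[of \<Omega> "\<lambda>w. C * infdist w (frontier \<Omega>) - (1 - norm (f' w))", OF _ wc])
        (use f' C in \<open>auto intro!: continuous_intros\<close>)
    moreover have "infdist w (frontier \<Omega>) = 0" using w by simp
    ultimately show ?thesis by simp
  qed
  then show ?thesis using that f' by metis
qed

lemma mult_bounded_deriv: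
  assumes "A_infty \<Omega> g"
  shows "(\<lambda>z. f z * g z) holomorphic_on \<Omega>" "\<exists>M. \<forall>z\<in>\<Omega>. norm (deriv (\<lambda>z. f z * g z) z) \<le> M"
proof -
  have g: "g holomorphic_on \<Omega>" using assms by (simp add: A_infty_def)
  show "(\<lambda>z. f z * g z) holomorphic_on \<Omega>" by (intro holomorphic_intros hol g)
  obtain M where M: "M \<ge> 0" "\<And>z. z \<in> closure \<Omega> \<Longrightarrow> norm (g z) \<le> M" "\<And>z. z \<in> \<Omega> \<Longrightarrow> norm (deriv g z) \<le> M"
    using A_infty_bounds[OF assms bounded_dom] by blast
  obtain C where C: "C \<ge> 0" "\<And>z. z \<in> \<Omega> \<Longrightarrow> norm (deriv f z) \<le> C" using deriv_f_bounded by blast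
  have "norm (deriv (\<lambda>z. f z * g z) z) \<le> 1 * M + C * M" if z: "z \<in> \<Omega>" for z
  proof -
    have "((\<lambda>z. f z * g z) has_field_derivative f z * deriv g z + deriv f z * g z) (at z)"
      by (intro DERIV_mult' f_has_deriv[OF z] holomorphic_derivI[OF g open_dom z])
    then have "deriv (\<lambda>z. f z * g z) z = f z * deriv g z + deriv f z * g z" by (rule DERIV_imp_deriv)
    also have "norm \<dots> \<le> norm (f z) * norm (deriv g z) + norm (deriv f z) * norm (g z)"
      by (metis norm_mult norm_triangle_ineq)
    also have "\<dots> \<le> 1 * M + C * M"
      using norm_f_less[OF z] M C z closure_subset[of \<Omega>] by (intro add_mono mult_mono) (auto simp: less_imp_le)
    finally show ?thesis .
  qed
  then show "\<exists>M. \<forall>z\<in>\<Omega>. norm (deriv (\<lambda>z. f z * g z) z) \<le> M" by blast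
qed

text \<open>Simple zeros make the singularities of the quotient removable, with value
  \<open>deriv g z / deriv f z\<close>. The derivative of \<open>k\<close> is bounded on the compact
  set |f| \<le> 1/2 by continuity; elsewhere the product rule for f k = g is solved for it, as |f| >
  1/2.\<close>

lemma divide_bounded_deriv:
  assumes g: "A_infty \<Omega> g"
    and zeros: "finite {z \<in> \<Omega>. f z = 0}" "\<And>z. z \<in> \<Omega> \<Longrightarrow> f z = 0 \<Longrightarrow> deriv f z \<noteq> 0 \<and> g z = 0"
  obtains k M where "k holomorphic_on \<Omega>" "\<And>z. z \<in> \<Omega> \<Longrightarrow> f z * k z = g z"
    "\<And>z. z \<in> \<Omega> \<Longrightarrow> norm (deriv k z) \<le> M"
proof -
  have hg: "g holomorphic_on \<Omega>" using g by (simp add: A_infty_def)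
  define Z where "Z = {z \<in> \<Omega>. f z = 0}"
  define k where "k = (\<lambda>z. if f z = 0 then deriv g z / deriv f z else g z / f z)"
  have opZ: "open (\<Omega> - Z)" using open_dom zeros(1) by (simp add: Z_def finite_imp_closed open_Diff)
  have "(\<lambda>z. g z / f z) holomorphic_on \<Omega> - Z"
    by (intro holomorphic_intros holomorphic_on_subset[OF hg] holomorphic_on_subset[OF hol]) (auto simp: Z_def)
  then have h1: "k holomorphic_on \<Omega> - Z"
    by (rule holomorphic_transform) (auto simp: k_def Z_def)
  have kh: "k holomorphic_on \<Omega>"
  proof (rule no_isolated_singularity'[OF _ h1 open_dom])
    show "finite Z" using zeros(1) by (simp add: Z_def)
    fix z assume z: "z \<in> Z"
    then have zO: "z \<in> \<Omega>" "f z = 0" "deriv f z \<noteq> 0" "g z = 0" using zeros(2) by (auto simp: Z_def)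
    have "((\<lambda>y. (f y - f z) / (y - z)) \<longlongrightarrow> deriv f z) (at z)"
      using f_has_deriv[OF zO(1)] by (simp add: has_field_derivative_iff)
    moreover have "((\<lambda>y. (g y - g z) / (y - z)) \<longlongrightarrow> deriv g z) (at z)"
      using holomorphic_derivI[OF hg open_dom zO(1)] by (simp add: has_field_derivative_iff)
    ultimately have "((\<lambda>y. ((g y - g z) / (y - z)) / ((f y - f z) / (y - z))) \<longlongrightarrow> deriv g z / deriv f z) (at z)"
      by (intro tendsto_divide zO)
    moreover have "\<forall>\<^sub>F y in at z. ((g y - g z) / (y - z)) / ((f y - f z) / (y - z)) = k y"
    proof -
      have "\<forall>\<^sub>F y in at z. y \<notin> Z - {z}"
      proof -
        have "open (- (Z - {z}))" using zeros(1) by (intro open_Compl finite_imp_closed) (simp add: Z_def)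
        moreover have "z \<in> - (Z - {z})" by simp
        ultimately have "\<forall>\<^sub>F y in at z. y \<in> - (Z - {z})" by (rule eventually_at_in_open')
        then show ?thesis by (rule eventually_mono) auto
      qed
      moreover have "\<forall>\<^sub>F y in at z. y \<in> \<Omega>" using open_dom zO(1) eventually_at_in_open' by blast
      moreover have "\<forall>\<^sub>F y in at z. y \<noteq> z" by (simp add: eventually_at_filter)
      ultimately show ?thesis
        by eventually_elim (auto simp: k_def Z_def zO(2,4))
    qed
    ultimately have "(k \<longlongrightarrow> deriv g z / deriv f z) (at z)" by (rule Lim_transform_eventually)
    then have "(k \<longlongrightarrow> k z) (at z)" using zO by (simp add: k_def)
    then show "(k \<longlongrightarrow> k z) (at z within \<Omega>)" by (rule tendsto_within_subset) simp
  qed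
  have fk: "f z * k z = g z" if "z \<in> \<Omega>" for z using zeros(2)[OF that] by (auto simp: k_def)
  obtain M where M: "M \<ge> 0" "\<And>z. z \<in> closure \<Omega> \<Longrightarrow> norm (g z) \<le> M" "\<And>z. z \<in> \<Omega> \<Longrightarrow> norm (deriv g z) \<le> M"
    using A_infty_bounds[OF g bounded_dom] by blast
  obtain C where C: "C \<ge> 0" "\<And>z. z \<in> \<Omega> \<Longrightarrow> norm (deriv f z) \<le> C" using deriv_f_bounded by blast
  have "compact (deriv k ` {z \<in> \<Omega>. norm (f z) \<le> 1/2})"
    by (intro compact_continuous_image compact_sublevel holomorphic_on_imp_continuous_on
        holomorphic_on_subset[OF holomorphic_deriv[OF kh open_dom]]) auto
  then obtain L where L: "\<And>z. z \<in> \<Omega> \<Longrightarrow> norm (f z) \<le> 1/2 \<Longrightarrow> norm (deriv k z) \<le> L"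
  proof -
    assume *: "\<And>L. (\<And>z. z \<in> \<Omega> \<Longrightarrow> norm (f z) \<le> 1/2 \<Longrightarrow> norm (deriv k z) \<le> L) \<Longrightarrow> thesis"
    assume "compact (deriv k ` {z \<in> \<Omega>. norm (f z) \<le> 1/2})"
    from compact_imp_bounded[OF this] obtain L where "\<forall>x\<in>deriv k ` {z \<in> \<Omega>. norm (f z) \<le> 1/2}. norm x \<le> L"
      unfolding bounded_iff by (rule exE)
    then show thesis by (intro *[of L]) auto
  qed
  have "norm (deriv k z) \<le> max L (2 * (M + C * (2 * M)))" if z: "z \<in> \<Omega>" for z
  proof (cases "norm (f z) \<le> 1/2")
    case False
    have dk: "(k has_field_derivative deriv k z) (at z)" by (rule holomorphic_derivI[OF kh open_dom z])
    have "((\<lambda>z. f z * k z) has_field_derivative f z * deriv k z + deriv f z * k z) (at z)"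
      by (intro DERIV_mult' f_has_deriv[OF z] dk)
    then have "(g has_field_derivative f z * deriv k z + deriv f z * k z) (at z)"
      by (rule has_field_derivative_transform_within_open[OF _ open_dom z]) (use fk in auto)
    then have "f z * deriv k z = deriv g z - deriv f z * k z" by (simp add: DERIV_imp_deriv)
    then have "norm (f z) * norm (deriv k z) = norm (deriv g z - deriv f z * k z)" by (metis norm_mult)
    also have "\<dots> \<le> norm (deriv g z) + norm (deriv f z) * norm (k z)"
      by (metis norm_mult norm_triangle_ineq4)
    also have "\<dots> \<le> M + C * (2 * M)"
    proof (intro add_mono mult_mono)
      have "norm (f z) * norm (k z) = norm (g z)" using fk[OF z] by (metis norm_mult)
      moreover have "norm (g z) \<le> M" using M(2) z closure_subset by blast
      moreover have "1/2 * norm (k z) \<le> norm (f z) * norm (k z)" using False by (intro mult_right_mono) auto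
      ultimately show "norm (k z) \<le> 2 * M" by linarith
    qed (use M C z in auto)
    finally have "norm (f z) * norm (deriv k z) \<le> M + C * (2 * M)" .
    have "1/2 * norm (deriv k z) \<le> norm (f z) * norm (deriv k z)" using False by (intro mult_right_mono) auto
    also have "\<dots> \<le> M + C * (2 * M)" by fact
    finally have "norm (deriv k z) \<le> 2 * (M + C * (2 * M))" by simp
    then show ?thesis by (rule max.coboundedI2)
  qed (use L z in \<open>auto intro: max.coboundedI1\<close>)
  then show ?thesis using that[OF kh fk] by blast
qed

end

section \<open>Boundary integrals and the Hardy space\<close>

lemma sum_list_ennreal:
  assumes "\<And>x. x \<in> set xs \<Longrightarrow> 0 \<le> f x"
  shows "(\<Sum>x\<leftarrow>xs. ennreal (f x)) = ennreal (\<Sum>x\<leftarrow>xs. f x)"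
  using assms
proof (induction xs)
  case (Cons a xs)
  have "0 \<le> (\<Sum>x\<leftarrow>xs. f x)" using Cons.prems by (intro sum_list_nonneg) auto
  then show ?case using Cons by (simp add: ennreal_plus)
qed simp

lemma cnj_sum_list: "cnj (\<Sum>x\<leftarrow>xs. h x) = (\<Sum>x\<leftarrow>xs. cnj (h x))"
  by (induction xs) auto

lemma of_real_sum_list: "complex_of_real (\<Sum>x\<leftarrow>xs. h x) = (\<Sum>x\<leftarrow>xs. of_real (h x))"
  by (induction xs) auto

lemma norm_sum_list_le:
  fixes f :: "'a \<Rightarrow> 'b::real_normed_vector"
  assumes "\<And>x. x \<in> set xs \<Longrightarrow> norm (f x) \<le> g x"
  shows "norm (\<Sum>x\<leftarrow>xs. f x) \<le> (\<Sum>x\<leftarrow>xs. g x)"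
  using assms
proof (induction xs)
  case (Cons a xs)
  then show ?case by (auto intro!: norm_triangle_le add_mono)
qed simp

lemma A_infty_lincomb:
  assumes "A_infty \<Omega> g" "A_infty \<Omega> h" "open \<Omega>"
  shows "A_infty \<Omega> (\<lambda>z. g z + c * h z)"
proof -
  have g: "g holomorphic_on \<Omega>" "continuous_on (closure \<Omega>) g" using assms by (auto simp: A_infty_def)
  have h: "h holomorphic_on \<Omega>" "continuous_on (closure \<Omega>) h" using assms by (auto simp: A_infty_def)
  have "\<exists>G. continuous_on (closure \<Omega>) G \<and> (\<forall>z\<in>\<Omega>. G z = (deriv ^^ n) (\<lambda>z. g z + c * h z) z)" for n
  proof -
    obtain G where G: "continuous_on (closure \<Omega>) G" "\<And>z. z \<in> \<Omega> \<Longrightarrow> G z = (deriv ^^ n) g z"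
      using assms(1) unfolding A_infty_def by blast
    obtain H where H: "continuous_on (closure \<Omega>) H" "\<And>z. z \<in> \<Omega> \<Longrightarrow> H z = (deriv ^^ n) h z"
      using assms(2) unfolding A_infty_def by blast
    have ch: "(\<lambda>z. c * h z) holomorphic_on \<Omega>" by (intro holomorphic_intros h)
    have "continuous_on (closure \<Omega>) (\<lambda>z. G z + c * H z)" by (intro continuous_intros G H)
    moreover have "G z + c * H z = (deriv ^^ n) (\<lambda>z. g z + c * h z) z" if "z \<in> \<Omega>" for z
      using higher_deriv_add[OF g(1) ch assms(3) that] higher_deriv_cmult[OF h(1) that assms(3)] G(2)[OF that] H(2)[OF that]
      by simp
    ultimately show ?thesis by blast
  qed
  then show ?thesis unfolding A_infty_def
    using g h by (auto intro!: holomorphic_intros continuous_intros)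
qed

section \<open>Square-integrable boundary functions and their weighted inner product\<close>

locale weighted_domain = smooth_domain +
  fixes \<phi> :: "complex \<Rightarrow> real"
  assumes wt: "smooth_pos_weight Gs \<phi>"
begin

abbreviation "unit_measure \<equiv> restrict_space lborel {0..1::real}"

definition arc_weight :: "(real \<Rightarrow> complex) \<Rightarrow> real \<Rightarrow> real" where
  "arc_weight \<gamma> t = \<phi> (\<gamma> t) * norm (vector_derivative \<gamma> (at t))"

definition sq_integrable :: "(complex \<Rightarrow> complex) \<Rightarrow> bool" where
  "sq_integrable u \<longleftrightarrow> (\<forall>\<gamma>\<in>set Gs. (\<lambda>t. u (\<gamma> t)) \<in> borel_measurable unit_measure \<and>
     integrable unit_measure (\<lambda>t. (cmod (u (\<gamma> t)))\<^sup>2 * arc_weight \<gamma> t))"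

text \<open>Squared norms are used throughout. The triangle inequality takes the form
  \<open>norm_add_sq_le\<close>, whose factor 2 is harmless in limits to 0.\<close>

definition norm_sq :: "(complex \<Rightarrow> complex) \<Rightarrow> real" where
  "norm_sq u = (\<Sum>\<gamma>\<leftarrow>Gs. LINT t|unit_measure. (cmod (u (\<gamma> t)))\<^sup>2 * arc_weight \<gamma> t)"

definition ip :: "(complex \<Rightarrow> complex) \<Rightarrow> (complex \<Rightarrow> complex) \<Rightarrow> complex" where
  "ip u v = (\<Sum>\<gamma>\<leftarrow>Gs. LINT t|unit_measure. u (\<gamma> t) * cnj (v (\<gamma> t)) * of_real (arc_weight \<gamma> t))"

lemma arc_weight_nonneg: "\<gamma> \<in> set Gs \<Longrightarrow> 0 \<le> arc_weight \<gamma> t"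
  using wt by (simp add: arc_weight_def smooth_pos_weight_def less_imp_le)

lemma measurable_unit: "continuous_on {0..1} h \<Longrightarrow> h \<in> borel_measurable unit_measure"
  using borel_measurable_continuous_on_restrict[of "{0..1}" h]
  by (simp cong: measurable_cong_sets add: sets_restrict_space_cong[OF sets_lborel])

lemma continuous_arc_weight: "\<gamma> \<in> set Gs \<Longrightarrow> continuous_on S (arc_weight \<gamma>)"
proof -
  assume g: "\<gamma> \<in> set Gs"
  then have "smooth_fun (\<phi> \<circ> \<gamma>)" using wt by (simp add: smooth_pos_weight_def)
  then obtain D where D: "D 0 = \<phi> \<circ> \<gamma>" "\<And>n t. (D n has_vector_derivative D (Suc n) t) (at t)"
    unfolding smooth_fun_def by blast
  have "continuous_on S (D 0)"
    using D(2) by (meson continuous_at_imp_continuous_on has_vector_derivative_continuous)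
  then have "continuous_on S (\<lambda>t. \<phi> (\<gamma> t))" by (simp add: D(1) o_def)
  then show ?thesis unfolding arc_weight_def[abs_def]
    by (intro continuous_intros smooth_curve_derivs(3) curves g)
qed

lemma arc_weight_measurable [measurable]: "\<gamma> \<in> set Gs \<Longrightarrow> arc_weight \<gamma> \<in> borel_measurable unit_measure"
  by (intro measurable_unit continuous_arc_weight)

lemma integrable_unit_continuous:
  fixes h :: "real \<Rightarrow> real"
  assumes "continuous_on {0..1} h"
  shows "integrable unit_measure h"
  using borel_integrable_atLeastAtMost'[OF assms] by (simp add: integrable_restrict_space set_integrable_def)

lemma sq_integrable_continuous:
  assumes "continuous_on (frontier \<Omega>) g"
  shows "sq_integrable g"
  unfolding sq_integrable_def
proof (intro ballI conjI)
  fix \<gamma> assume g: "\<gamma> \<in> set Gs"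
  have c: "continuous_on {0..1} (\<lambda>t. g (\<gamma> t))"
    by (rule continuous_on_compose2[OF assms smooth_curve_derivs(2)[OF curves[OF g]]]) (use curve_in_frontier[OF g] in auto)
  then show "(\<lambda>t. g (\<gamma> t)) \<in> borel_measurable unit_measure" by (rule measurable_unit)
  show "integrable unit_measure (\<lambda>t. (cmod (g (\<gamma> t)))\<^sup>2 * arc_weight \<gamma> t)"
    by (intro integrable_unit_continuous continuous_intros c continuous_arc_weight g)
qed

lemma A_infty_sq_integrable: "A_infty \<Omega> g \<Longrightarrow> sq_integrable g"
  unfolding A_infty_def by (rule sq_integrable_continuous) (auto simp: frontier_def intro: continuous_on_subset)

lemma norm_sq_nonneg: "0 \<le> norm_sq u"
  unfolding norm_sq_def by (intro sum_list_nonneg) (auto intro!: Bochner_Integration.integral_nonneg mult_nonneg_nonneg arc_weight_nonneg)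

text \<open>A pointwise quadratic bound on the frontier gives integrability and the norm estimate
  together; sums and bounded multiples are its two instances.\<close>

lemma sq_integrable_dominated:
  assumes w: "\<And>\<gamma>. \<gamma> \<in> set Gs \<Longrightarrow> (\<lambda>t. w (\<gamma> t)) \<in> borel_measurable unit_measure"
    and u: "sq_integrable u" and v: "sq_integrable v"
    and le: "\<And>x. x \<in> frontier \<Omega> \<Longrightarrow> (cmod (w x))\<^sup>2 \<le> a * (cmod (u x))\<^sup>2 + b * (cmod (v x))\<^sup>2"
  shows "sq_integrable w" "norm_sq w \<le> a * norm_sq u + b * norm_sq v"
proof -
  define den where "den = (\<lambda>x \<gamma> t. (cmod (x (\<gamma> t)))\<^sup>2 * arc_weight \<gamma> t)"
  have le': "den w \<gamma> t \<le> a * den u \<gamma> t + b * den v \<gamma> t" if g: "\<gamma> \<in> set Gs" for \<gamma> t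
    using mult_right_mono[OF le[OF curve_in_frontier[OF g]] arc_weight_nonneg[OF g]]
    by (simp add: den_def distrib_right mult.assoc)
  have m: "integrable unit_measure (den u \<gamma>)" "integrable unit_measure (den v \<gamma>)" if "\<gamma> \<in> set Gs" for \<gamma>
    using u v that by (auto simp: sq_integrable_def den_def)
  have m': "integrable unit_measure (\<lambda>t. a * den u \<gamma> t + b * den v \<gamma> t)" if "\<gamma> \<in> set Gs" for \<gamma>
    using m[OF that] by (intro Bochner_Integration.integrable_add integrable_mult_right)
  have int: "integrable unit_measure (den w \<gamma>)" if g: "\<gamma> \<in> set Gs" for \<gamma>
  proof (rule Bochner_Integration.integrable_bound[OF m'[OF g]])
    note [measurable] = w[OF g] arc_weight_measurable[OF g]
    show "den w \<gamma> \<in> borel_measurable unit_measure" unfolding den_def by measurable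
    have "0 \<le> den w \<gamma> t" for t using arc_weight_nonneg[OF g] by (simp add: den_def)
    then show "AE t in unit_measure. norm (den w \<gamma> t) \<le> norm (a * den u \<gamma> t + b * den v \<gamma> t)"
      using le'[OF g] by (intro AE_I2) (simp add: order_trans[OF _ abs_ge_self])
  qed
  show "sq_integrable w" unfolding sq_integrable_def using w int by (simp add: den_def)
  have ns: "norm_sq x = (\<Sum>\<gamma>\<leftarrow>Gs. LINT t|unit_measure. den x \<gamma> t)" for x
    by (simp add: norm_sq_def den_def)
  have "norm_sq w \<le> (\<Sum>\<gamma>\<leftarrow>Gs. a * (LINT t|unit_measure. den u \<gamma> t) + b * (LINT t|unit_measure. den v \<gamma> t))"
    unfolding ns
  proof (rule sum_list_mono)
    fix \<gamma> assume g: "\<gamma> \<in> set Gs"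
    have "(LINT t|unit_measure. den w \<gamma> t) \<le> (LINT t|unit_measure. a * den u \<gamma> t + b * den v \<gamma> t)"
      by (rule integral_mono[OF int[OF g] m'[OF g] le'[OF g]])
    then show "(LINT t|unit_measure. den w \<gamma> t) \<le>
        a * (LINT t|unit_measure. den u \<gamma> t) + b * (LINT t|unit_measure. den v \<gamma> t)"
      using m[OF g] by simp
  qed
  also have "\<dots> = a * norm_sq u + b * norm_sq v"
    by (simp add: ns sum_list_addf sum_list_const_mult)
  finally show "norm_sq w \<le> a * norm_sq u + b * norm_sq v" .
qed

lemma sq_integrable_measurable:
  "sq_integrable u \<Longrightarrow> \<gamma> \<in> set Gs \<Longrightarrow> (\<lambda>t. u (\<gamma> t)) \<in> borel_measurable unit_measure"
  by (simp add: sq_integrable_def)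

lemma norm_add_sq_le: "(cmod (x + y))\<^sup>2 \<le> 2 * (cmod x)\<^sup>2 + 2 * (cmod y)\<^sup>2"
proof -
  have "(cmod (x + y))\<^sup>2 \<le> (cmod x + cmod y)\<^sup>2" by (intro power_mono norm_triangle_ineq) auto
  also have "\<dots> \<le> 2 * (cmod x)\<^sup>2 + 2 * (cmod y)\<^sup>2"
    using sum_squares_bound[of "cmod x" "cmod y"] by (simp add: power2_sum)
  finally show ?thesis .
qed

lemma sq_integrable_add:
  assumes u: "sq_integrable u" and v: "sq_integrable v"
  shows "sq_integrable (\<lambda>w. u w + v w)" "norm_sq (\<lambda>w. u w + v w) \<le> 2 * norm_sq u + 2 * norm_sq v"
  by (rule sq_integrable_dominated[OF _ u v],
      intro borel_measurable_add sq_integrable_measurable[OF u] sq_integrable_measurable[OF v],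
      assumption+, rule norm_add_sq_le)+

lemma sq_integrable_bounded_mult:
  assumes u: "sq_integrable u" and b: "continuous_on (frontier \<Omega>) b" and C: "\<And>w. w \<in> frontier \<Omega> \<Longrightarrow> norm (b w) \<le> C"
  shows "sq_integrable (\<lambda>w. b w * u w)" "norm_sq (\<lambda>w. b w * u w) \<le> C\<^sup>2 * norm_sq u"
proof -
  have "(cmod (b w * u w))\<^sup>2 \<le> C\<^sup>2 * (cmod (u w))\<^sup>2 + 0 * (cmod (u w))\<^sup>2" if "w \<in> frontier \<Omega>" for w
    using C[OF that] by (simp add: norm_mult power_mult_distrib mult_right_mono power_mono)
  note dom = sq_integrable_dominated[OF _ u u this]
  have "(\<lambda>t. b (\<gamma> t) * u (\<gamma> t)) \<in> borel_measurable unit_measure" if "\<gamma> \<in> set Gs" for \<gamma>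
    using sq_integrable_measurable[OF sq_integrable_continuous[OF b] that] sq_integrable_measurable[OF u that]
    by (rule borel_measurable_times)
  from dom[OF this] show "sq_integrable (\<lambda>w. b w * u w)" "norm_sq (\<lambda>w. b w * u w) \<le> C\<^sup>2 * norm_sq u"
    by simp_all
qed

lemma sq_integrable_cmult: "sq_integrable u \<Longrightarrow> sq_integrable (\<lambda>w. c * u w)"
  using sq_integrable_bounded_mult(1)[of u "\<lambda>_. c" "norm c"] by simp

lemma sq_integrable_diff:
  assumes "sq_integrable u" "sq_integrable v"
  shows "sq_integrable (\<lambda>w. u w - v w)"
  using sq_integrable_add(1)[OF assms(1) sq_integrable_cmult[OF assms(2), of "-1"]] by simp

lemma sq_integrable_sum:
  assumes "finite I" "\<And>i. i \<in> I \<Longrightarrow> sq_integrable (u i)"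
  shows "sq_integrable (\<lambda>w. \<Sum>i\<in>I. u i w)"
  using assms by (induction I) (auto intro: sq_integrable_add sq_integrable_continuous)

lemma norm_sq_cong: "(\<And>w. w \<in> frontier \<Omega> \<Longrightarrow> u w = v w) \<Longrightarrow> norm_sq u = norm_sq v"
  unfolding norm_sq_def by (intro arg_cong[where f=sum_list] map_cong refl) (simp add: curve_in_frontier)

lemma ip_cong:
  "(\<And>w. w \<in> frontier \<Omega> \<Longrightarrow> u w * cnj (v w) = u' w * cnj (v' w)) \<Longrightarrow> ip u v = ip u' v'"
  unfolding ip_def by (intro arg_cong[where f=sum_list] map_cong refl) (simp add: curve_in_frontier)

lemma sq_integrable_cong:
  assumes "\<And>w. w \<in> frontier \<Omega> \<Longrightarrow> u w = v w"
  shows "sq_integrable u \<longleftrightarrow> sq_integrable v"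
  unfolding sq_integrable_def by (rule ball_cong) (use curve_in_frontier assms in auto)

lemma norm_sq_bounded:
  assumes "continuous_on (frontier \<Omega>) b" "\<And>w. w \<in> frontier \<Omega> \<Longrightarrow> norm (b w) \<le> C"
  shows "norm_sq b \<le> C\<^sup>2 * norm_sq (\<lambda>_. 1)"
  using sq_integrable_bounded_mult(2)[OF sq_integrable_continuous assms, of "\<lambda>_. 1"] by simp

lemma ip_integrable:
  assumes u: "sq_integrable u" and v: "sq_integrable v" and g: "\<gamma> \<in> set Gs"
  shows "integrable unit_measure (\<lambda>t. u (\<gamma> t) * cnj (v (\<gamma> t)) * of_real (arc_weight \<gamma> t))"
proof (rule Bochner_Integration.integrable_bound)
  have m: "(\<lambda>t. u (\<gamma> t)) \<in> borel_measurable unit_measure" "(\<lambda>t. v (\<gamma> t)) \<in> borel_measurable unit_measure"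
    "integrable unit_measure (\<lambda>t. (cmod (u (\<gamma> t)))\<^sup>2 * arc_weight \<gamma> t)"
    "integrable unit_measure (\<lambda>t. (cmod (v (\<gamma> t)))\<^sup>2 * arc_weight \<gamma> t)"
    using u v g by (auto simp: sq_integrable_def)
  show "integrable unit_measure (\<lambda>t. (cmod (u (\<gamma> t)))\<^sup>2 * arc_weight \<gamma> t + (cmod (v (\<gamma> t)))\<^sup>2 * arc_weight \<gamma> t)"
    using m(3,4) by (rule Bochner_Integration.integrable_add)
  note [measurable] = m(1,2) arc_weight_measurable[OF g]
  have [measurable]: "(\<lambda>t. cnj (v (\<gamma> t))) \<in> borel_measurable unit_measure"
    using borel_measurable_continuous_onI[of cnj] m(2) by (auto intro: measurable_compose simp: continuous_on_cnj)
  show "(\<lambda>t. u (\<gamma> t) * cnj (v (\<gamma> t)) * of_real (arc_weight \<gamma> t)) \<in> borel_measurable unit_measure" by measurable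
  have "norm (u (\<gamma> t) * cnj (v (\<gamma> t)) * of_real (arc_weight \<gamma> t)) \<le> (cmod (u (\<gamma> t)))\<^sup>2 * arc_weight \<gamma> t + (cmod (v (\<gamma> t)))\<^sup>2 * arc_weight \<gamma> t" for t
  proof -
    have "cmod (u (\<gamma> t)) * cmod (v (\<gamma> t)) \<le> (cmod (u (\<gamma> t)))\<^sup>2 + (cmod (v (\<gamma> t)))\<^sup>2"
      using sum_squares_bound[of "cmod (u (\<gamma> t))" "cmod (v (\<gamma> t))"]
        mult_nonneg_nonneg[OF norm_ge_zero[of "u (\<gamma> t)"] norm_ge_zero[of "v (\<gamma> t)"]] by linarith
    from mult_right_mono[OF this arc_weight_nonneg[OF g, of t]] show ?thesis
      using arc_weight_nonneg[OF g, of t] by (simp add: norm_mult distrib_right)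
  qed
  note bound = this
  show "AE t in unit_measure. norm (u (\<gamma> t) * cnj (v (\<gamma> t)) * of_real (arc_weight \<gamma> t))
     \<le> norm ((cmod (u (\<gamma> t)))\<^sup>2 * arc_weight \<gamma> t + (cmod (v (\<gamma> t)))\<^sup>2 * arc_weight \<gamma> t)"
    by (intro AE_I2) (rule order_trans[OF bound], simp only: real_norm_def abs_ge_self)
qed

lemma ip_add_left:
  assumes "sq_integrable u" "sq_integrable u'" "sq_integrable v"
  shows "ip (\<lambda>w. u w + u' w) v = ip u v + ip u' v"
proof -
  have "(LINT t|unit_measure. (u (\<gamma> t) + u' (\<gamma> t)) * cnj (v (\<gamma> t)) * of_real (arc_weight \<gamma> t)) =
     (LINT t|unit_measure. u (\<gamma> t) * cnj (v (\<gamma> t)) * of_real (arc_weight \<gamma> t)) +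
     (LINT t|unit_measure. u' (\<gamma> t) * cnj (v (\<gamma> t)) * of_real (arc_weight \<gamma> t))" if "\<gamma> \<in> set Gs" for \<gamma>
    unfolding distrib_right by (rule Bochner_Integration.integral_add) (intro ip_integrable assms that)+
  then have "ip (\<lambda>w. u w + u' w) v = (\<Sum>\<gamma>\<leftarrow>Gs. (LINT t|unit_measure. u (\<gamma> t) * cnj (v (\<gamma> t)) * of_real (arc_weight \<gamma> t)) +
     (LINT t|unit_measure. u' (\<gamma> t) * cnj (v (\<gamma> t)) * of_real (arc_weight \<gamma> t)))"
    unfolding ip_def by (intro arg_cong[where f=sum_list] map_cong) auto
  then show ?thesis by (simp add: ip_def sum_list_addf)
qed

lemma ip_cmult_left: "ip (\<lambda>w. c * u w) v = c * ip u v"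
  by (simp add: ip_def mult.assoc sum_list_const_mult)

lemma ip_commute: "ip v u = cnj (ip u v)"
proof -
  have "(LINT t|unit_measure. v (\<gamma> t) * cnj (u (\<gamma> t)) * of_real (arc_weight \<gamma> t)) =
     cnj (LINT t|unit_measure. u (\<gamma> t) * cnj (v (\<gamma> t)) * of_real (arc_weight \<gamma> t))" for \<gamma>
    by (subst Bochner_Integration.integral_cnj[symmetric]) (intro Bochner_Integration.integral_cong refl, simp)
  then show ?thesis
    unfolding ip_def cnj_sum_list by (simp only:)
qed

lemma ip_diff_left:
  assumes "sq_integrable u" "sq_integrable u'" "sq_integrable v"
  shows "ip (\<lambda>w. u w - u' w) v = ip u v - ip u' v"
  using ip_add_left[OF assms(1) sq_integrable_cmult[OF assms(2), of "-1"] assms(3)] ip_cmult_left[of "-1" u' v] by simp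

lemma ip_diff_right:
  assumes "sq_integrable u" "sq_integrable v" "sq_integrable v'"
  shows "ip u (\<lambda>w. v w - v' w) = ip u v - ip u v'"
  using ip_diff_left[OF assms(2,3,1)] ip_commute[of u] by (metis complex_cnj_diff)

lemma ip_cmult_right: "ip u (\<lambda>w. c * v w) = cnj c * ip u v"
  using ip_cmult_left[of c v u] ip_commute[of u] by (metis complex_cnj_mult)

lemma ip_sum_left:
  assumes "finite I" "\<And>i. i \<in> I \<Longrightarrow> sq_integrable (u i)" "sq_integrable v"
  shows "ip (\<lambda>w. \<Sum>i\<in>I. u i w) v = (\<Sum>i\<in>I. ip (u i) v)"
  using assms
proof (induction I)
  case empty
  then show ?case by (simp add: ip_def sum_list_const_mult[of 0, symmetric])
next
  case (insert j I)
  then show ?case by (simp add: ip_add_left sq_integrable_sum)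
qed

lemma ip_sum_right:
  assumes "finite I" "\<And>i. i \<in> I \<Longrightarrow> sq_integrable (v i)" "sq_integrable u"
  shows "ip u (\<lambda>w. \<Sum>i\<in>I. v i w) = (\<Sum>i\<in>I. ip u (v i))"
  using ip_sum_left[OF assms] ip_commute[of u] by (simp add: cnj_sum)

lemma ip_self: "ip u u = of_real (norm_sq u)"
proof -
  have "(LINT t|unit_measure. u (\<gamma> t) * cnj (u (\<gamma> t)) * of_real (arc_weight \<gamma> t)) =
    of_real (LINT t|unit_measure. (cmod (u (\<gamma> t)))\<^sup>2 * arc_weight \<gamma> t)" for \<gamma>
    unfolding integral_complex_of_real[symmetric]
    by (intro Bochner_Integration.integral_cong refl) (simp only: of_real_mult complex_norm_square)
  then show ?thesis unfolding ip_def norm_sq_def of_real_sum_list by (simp only:)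
qed

text \<open>A weighted arithmetic-geometric mean inequality in the role of Cauchy-Schwarz. The free
  parameter s lets a small \<open>norm_sq u\<close> beat any fixed \<open>norm_sq v\<close>.\<close>

lemma norm_ip_le:
  assumes u: "sq_integrable u" and v: "sq_integrable v" and s: "s > 0"
  shows "norm (ip u v) \<le> s * norm_sq u + norm_sq v / s"
proof -
  have "norm (ip u v) \<le> (\<Sum>\<gamma>\<leftarrow>Gs. s * (LINT t|unit_measure. (cmod (u (\<gamma> t)))\<^sup>2 * arc_weight \<gamma> t)
     + (1/s) * (LINT t|unit_measure. (cmod (v (\<gamma> t)))\<^sup>2 * arc_weight \<gamma> t))"
    unfolding ip_def
  proof (rule norm_sum_list_le)
    fix \<gamma> assume g: "\<gamma> \<in> set Gs"
    have m: "integrable unit_measure (\<lambda>t. (cmod (u (\<gamma> t)))\<^sup>2 * arc_weight \<gamma> t)"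
      "integrable unit_measure (\<lambda>t. (cmod (v (\<gamma> t)))\<^sup>2 * arc_weight \<gamma> t)"
      using u v g by (auto simp: sq_integrable_def)
    have "norm (LINT t|unit_measure. u (\<gamma> t) * cnj (v (\<gamma> t)) * of_real (arc_weight \<gamma> t)) \<le>
      (LINT t|unit_measure. s * ((cmod (u (\<gamma> t)))\<^sup>2 * arc_weight \<gamma> t) + (1/s) * ((cmod (v (\<gamma> t)))\<^sup>2 * arc_weight \<gamma> t))"
    proof (rule Bochner_Integration.integral_norm_bound_integral)
      fix t
      let ?x = "cmod (u (\<gamma> t))" and ?y = "cmod (v (\<gamma> t))"
      have "0 \<le> (s * ?x - ?y)\<^sup>2 + (s * ?x)\<^sup>2 + ?y\<^sup>2" by simp
      then have "2 * (s * ?x * ?y) \<le> 2 * (s * ?x)\<^sup>2 + 2 * ?y\<^sup>2" by (simp add: power2_diff)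
      then have "?x * ?y \<le> s * ?x\<^sup>2 + (1/s) * ?y\<^sup>2" using s by (simp add: field_simps power2_eq_square)
      from mult_right_mono[OF this arc_weight_nonneg[OF g, of t]]
      show "norm (u (\<gamma> t) * cnj (v (\<gamma> t)) * of_real (arc_weight \<gamma> t)) \<le> s * (?x\<^sup>2 * arc_weight \<gamma> t) + (1/s) * (?y\<^sup>2 * arc_weight \<gamma> t)"
        using arc_weight_nonneg[OF g, of t] by (simp add: norm_mult distrib_right mult.assoc)
    qed (intro ip_integrable u v g Bochner_Integration.integrable_add integrable_mult_right m)+
    also have "\<dots> = s * (LINT t|unit_measure. (cmod (u (\<gamma> t)))\<^sup>2 * arc_weight \<gamma> t)
     + (1/s) * (LINT t|unit_measure. (cmod (v (\<gamma> t)))\<^sup>2 * arc_weight \<gamma> t)"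
      using m by simp
    finally show "norm (LINT t|unit_measure. u (\<gamma> t) * cnj (v (\<gamma> t)) * of_real (arc_weight \<gamma> t)) \<le> \<dots>" .
  qed
  also have "\<dots> = s * norm_sq u + norm_sq v / s"
    unfolding norm_sq_def sum_list_addf sum_list_const_mult by simp
  finally show ?thesis .
qed

lemma ip_tendsto:
  assumes "\<And>n. sq_integrable (F n)" "sq_integrable u" "sq_integrable v"
    and lim: "(\<lambda>n. norm_sq (\<lambda>w. u w - F n w)) \<longlonglongrightarrow> 0"
  shows "(\<lambda>n. ip (F n) v) \<longlonglongrightarrow> ip u v"
proof (rule LIMSEQ_I)
  fix e :: real assume e: "e > 0"
  \<comment> \<open>This makes \<open>norm_sq v / s\<close> smaller than e/2; the summand 1 covers
    the case \<open>norm_sq v = 0\<close>.\<close>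
  define s where "s = 2 * (norm_sq v + 1) / e"
  have s: "s > 0" using e norm_sq_nonneg[of v] by (simp add: s_def add_nonneg_pos)
  have "norm_sq v / s < e / 2" using e norm_sq_nonneg[of v] s by (simp add: s_def field_simps add_nonneg_pos)
  moreover have "e / (2 * s) > 0" using e s by simp
  then obtain n0 where "\<forall>n\<ge>n0. norm (norm_sq (\<lambda>w. u w - F n w) - 0) < e / (2 * s)"
    using LIMSEQ_D[OF lim] by blast
  then have n0: "s * norm_sq (\<lambda>w. u w - F n w) < e / 2" if "n \<ge> n0" for n
    using that s norm_sq_nonneg[of "\<lambda>w. u w - F n w"] by (auto simp: field_simps)
  have "norm (ip (F n) v - ip u v) < e" if "n \<ge> n0" for n
  proof -
    have "norm (ip (F n) v - ip u v) = norm (ip (\<lambda>w. u w - F n w) v)"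
      using ip_diff_left[OF assms(2) assms(1) assms(3)] by (simp add: norm_minus_commute)
    also have "\<dots> \<le> s * norm_sq (\<lambda>w. u w - F n w) + norm_sq v / s"
      by (rule norm_ip_le[OF sq_integrable_diff[OF assms(2,1)] assms(3) s])
    also have "\<dots> < e" using n0[OF that] \<open>norm_sq v / s < e / 2\<close> by linarith
    finally show ?thesis .
  qed
  then show "\<exists>n0. \<forall>n\<ge>n0. norm (ip (F n) v - ip u v) < e" by blast
qed

lemma ip_zero_norm:
  assumes "sq_integrable u" "sq_integrable v" "norm_sq u = 0"
  shows "ip u v = 0"
proof -
  \<comment> \<open>As \<open>u\<close> has norm 0, the constant sequence 0 converges to it in
    norm.\<close>
  have "(\<lambda>n::nat. ip (\<lambda>_. 0) v) \<longlonglongrightarrow> ip u v"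
    by (rule ip_tendsto) (use assms in \<open>auto intro: sq_integrable_continuous\<close>)
  moreover have "ip (\<lambda>_. 0) v = 0" using ip_cmult_left[of 0 u v] by simp
  ultimately show ?thesis by (simp add: LIMSEQ_const_iff)
qed

lemma bdry_integral_ip: "bdry_integral Gs (\<lambda>w. v w * u w * of_real (\<phi> w)) = ip u (\<lambda>w. cnj (v w))"
  unfolding bdry_integral_def ip_def arc_weight_def set_lebesgue_integral_def
  by (simp add: integral_restrict_space mult_ac)

lemma L2_dist_sq_eq:
  assumes "sq_integrable (\<lambda>w. h w - g w)"
  shows "L2_dist_sq Gs \<phi> h g = ennreal (norm_sq (\<lambda>w. h w - g w))"
proof -
  have "set_nn_integral lborel {0..1} (\<lambda>t. ennreal ((cmod (h (\<gamma> t) - g (\<gamma> t)))\<^sup>2 * \<phi> (\<gamma> t) * norm (vector_derivative \<gamma> (at t))))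
     = ennreal (LINT t|unit_measure. (cmod (h (\<gamma> t) - g (\<gamma> t)))\<^sup>2 * arc_weight \<gamma> t)" if "\<gamma> \<in> set Gs" for \<gamma>
    using assms that arc_weight_nonneg[OF that]
    by (subst nn_integral_eq_integral[symmetric])
      (auto simp: sq_integrable_def nn_integral_restrict_space arc_weight_def mult.assoc)
  then have "L2_dist_sq Gs \<phi> h g = (\<Sum>\<gamma>\<leftarrow>Gs. ennreal (LINT t|unit_measure. (cmod (h (\<gamma> t) - g (\<gamma> t)))\<^sup>2 * arc_weight \<gamma> t))"
    unfolding L2_dist_sq_def by (intro arg_cong[where f=sum_list] map_cong) auto
  also have "\<dots> = ennreal (norm_sq (\<lambda>w. h w - g w))"
    unfolding norm_sq_def by (rule sum_list_ennreal) (auto intro!: Bochner_Integration.integral_nonneg mult_nonneg_nonneg arc_weight_nonneg)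
  finally show ?thesis .
qed

text \<open>Membership in \<open>hardy2\<close> asks explicitly for measurability only; square
  integrability is hidden in the finite distance to a square-integrable function.\<close>

lemma sq_integrable_if_L2_dist_finite:
  assumes h: "\<And>\<gamma>. \<gamma> \<in> set Gs \<Longrightarrow> (\<lambda>t. h (\<gamma> t)) \<in> borel_measurable unit_measure"
    and g: "sq_integrable g" and fin: "L2_dist_sq Gs \<phi> h g < \<infinity>"
  shows "sq_integrable h"
proof -
  have "sq_integrable (\<lambda>w. h w - g w)"
    unfolding sq_integrable_def
  proof (intro ballI conjI)
    fix \<gamma> assume \<gamma>: "\<gamma> \<in> set Gs"
    have [measurable]: "(\<lambda>t. g (\<gamma> t)) \<in> borel_measurable unit_measure" using g \<gamma> by (simp add: sq_integrable_def)
    note [measurable] = h[OF \<gamma>] arc_weight_measurable[OF \<gamma>]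
    show "(\<lambda>t. h (\<gamma> t) - g (\<gamma> t)) \<in> borel_measurable unit_measure" by measurable
    show "integrable unit_measure (\<lambda>t. (cmod (h (\<gamma> t) - g (\<gamma> t)))\<^sup>2 * arc_weight \<gamma> t)"
    proof (rule integrableI_nonneg)
      show "(\<lambda>t. (cmod (h (\<gamma> t) - g (\<gamma> t)))\<^sup>2 * arc_weight \<gamma> t) \<in> borel_measurable unit_measure" by measurable
      have "(\<integral>\<^sup>+ t. ennreal ((cmod (h (\<gamma> t) - g (\<gamma> t)))\<^sup>2 * arc_weight \<gamma> t) \<partial>unit_measure) =
         set_nn_integral lborel {0..1} (\<lambda>t. ennreal ((cmod (h (\<gamma> t) - g (\<gamma> t)))\<^sup>2 * \<phi> (\<gamma> t) * norm (vector_derivative \<gamma> (at t))))"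
        by (simp add: nn_integral_restrict_space arc_weight_def mult.assoc)
      also have "\<dots> \<le> L2_dist_sq Gs \<phi> h g"
        unfolding L2_dist_sq_def by (rule member_le_sum_list) (use \<gamma> in auto)
      finally show "(\<integral>\<^sup>+ t. ennreal ((cmod (h (\<gamma> t) - g (\<gamma> t)))\<^sup>2 * arc_weight \<gamma> t) \<partial>unit_measure) < \<infinity>"
        using fin by (rule le_less_trans)
    qed (use arc_weight_nonneg[OF \<gamma>] in \<open>auto intro!: AE_I2\<close>)
  qed
  from sq_integrable_add(1)[OF this g] show ?thesis by simp
qed

text \<open>Replaces the extended-real distances by \<open>norm_sq\<close>. Since they tend to 0,
  one of them is below 1, and this yields the square integrability of \<open>h\<close>.\<close>

lemma hardy2_iff:
  "h \<in> hardy2 \<Omega> Gs \<phi> \<longleftrightarrow> sq_integrable h \<and> (\<exists>g. (\<forall>n. A_infty \<Omega> (g n)) \<and>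
     (\<lambda>n. norm_sq (\<lambda>w. h w - g n w)) \<longlonglongrightarrow> 0 \<and> (\<forall>z\<in>\<Omega>. (\<lambda>n. g n z) \<longlonglongrightarrow> h z))"
proof
  assume "h \<in> hardy2 \<Omega> Gs \<phi>"
  then obtain g where h: "\<And>\<gamma>. \<gamma> \<in> set Gs \<Longrightarrow> (\<lambda>t. h (\<gamma> t)) \<in> borel_measurable unit_measure"
    and g: "\<And>n. A_infty \<Omega> (g n)" "(\<lambda>n. L2_dist_sq Gs \<phi> h (g n)) \<longlonglongrightarrow> 0" "\<forall>z\<in>\<Omega>. (\<lambda>n. g n z) \<longlonglongrightarrow> h z"
    unfolding hardy2_def by blast
  have "\<forall>\<^sub>F n in sequentially. L2_dist_sq Gs \<phi> h (g n) < 1" by (rule order_tendstoD(2)[OF g(2)]) simp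
  then obtain n where "L2_dist_sq Gs \<phi> h (g n) < 1" by (auto simp: eventually_sequentially)
  then have sq: "sq_integrable h"
    by (intro sq_integrable_if_L2_dist_finite[OF h A_infty_sq_integrable[OF g(1)]]) (auto intro: less_trans)
  have "L2_dist_sq Gs \<phi> h (g n) = ennreal (norm_sq (\<lambda>w. h w - g n w))" for n
    by (intro L2_dist_sq_eq sq_integrable_diff sq A_infty_sq_integrable g)
  then have "(\<lambda>n. ennreal (norm_sq (\<lambda>w. h w - g n w))) \<longlonglongrightarrow> ennreal 0" using g(2) by simp
  then have "(\<lambda>n. norm_sq (\<lambda>w. h w - g n w)) \<longlonglongrightarrow> 0"
    by (subst (asm) tendsto_ennreal_iff) (auto simp: norm_sq_nonneg)
  then show "sq_integrable h \<and> (\<exists>g. (\<forall>n. A_infty \<Omega> (g n)) \<and>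
     (\<lambda>n. norm_sq (\<lambda>w. h w - g n w)) \<longlonglongrightarrow> 0 \<and> (\<forall>z\<in>\<Omega>. (\<lambda>n. g n z) \<longlonglongrightarrow> h z))"
    using sq g(1,3) by blast
next
  assume "sq_integrable h \<and> (\<exists>g. (\<forall>n. A_infty \<Omega> (g n)) \<and>
     (\<lambda>n. norm_sq (\<lambda>w. h w - g n w)) \<longlonglongrightarrow> 0 \<and> (\<forall>z\<in>\<Omega>. (\<lambda>n. g n z) \<longlonglongrightarrow> h z))"
  then obtain g where sq: "sq_integrable h" and g: "\<And>n. A_infty \<Omega> (g n)"
     "(\<lambda>n. norm_sq (\<lambda>w. h w - g n w)) \<longlonglongrightarrow> 0" "\<forall>z\<in>\<Omega>. (\<lambda>n. g n z) \<longlonglongrightarrow> h z" by blast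
  have "L2_dist_sq Gs \<phi> h (g n) = ennreal (norm_sq (\<lambda>w. h w - g n w))" for n
    by (intro L2_dist_sq_eq sq_integrable_diff sq A_infty_sq_integrable g)
  moreover have "(\<lambda>n. ennreal (norm_sq (\<lambda>w. h w - g n w))) \<longlonglongrightarrow> ennreal 0" using g(2) by (rule tendsto_ennrealI)
  ultimately have "(\<lambda>n. L2_dist_sq Gs \<phi> h (g n)) \<longlonglongrightarrow> 0" by simp
  then show "h \<in> hardy2 \<Omega> Gs \<phi>"
    unfolding hardy2_def using sq g(1,3) by (auto simp: sq_integrable_def)
qed

end

section \<open>Multiplication and division by the proper map\<close>

lemma tendsto_zero_if_bounded_by:
  fixes a b :: "nat \<Rightarrow> real"
  assumes "b \<longlonglongrightarrow> 0" "\<And>n. a n \<le> b n" "\<And>n. 0 \<le> a n"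
  shows "a \<longlonglongrightarrow> 0"
  by (rule tendsto_sandwich[OF _ _ tendsto_const assms(1)]) (use assms(2,3) in auto)

text \<open>Lagrange polynomials. They correct approximants at the zeros of \<open>f\<close>, and
  they separate these points when the kernel matrix is shown to be invertible.\<close>

lemma interpolation_basis:
  fixes Z :: "'a::field set"
  assumes "finite Z"
  obtains L where "\<And>a b. a \<in> Z \<Longrightarrow> b \<in> Z \<Longrightarrow> poly (L a) b = (if a = b then 1 else 0)"
proof -
  define P where "P = (\<lambda>a. \<Prod>b\<in>Z - {a}. [:- b, 1:])"
  have P: "poly (P a) x = (\<Prod>b\<in>Z - {a}. x - b)" for a x by (simp add: P_def poly_prod)
  have "poly (P a) a \<noteq> 0" for a using assms by (auto simp: P prod_zero_iff)
  moreover have "poly (P a) b = 0" if "a \<noteq> b" "b \<in> Z" for a b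
    unfolding P by (rule prod_zero) (use assms that in auto)
  ultimately show ?thesis by (intro that[of "\<lambda>a. Polynomial.smult (1 / poly (P a) a) (P a)"]) auto
qed

lemma (in smooth_domain) uniform_approx_closure:
  assumes k: "k holomorphic_on \<Omega>" and M: "\<And>z. z \<in> \<Omega> \<Longrightarrow> norm (deriv k z) \<le> M"
    and b: "continuous_on (closure \<Omega>) b" "\<And>z. z \<in> \<Omega> \<Longrightarrow> b z = k z" and e: "e > 0"
  shows "\<exists>H. A_infty \<Omega> H \<and> (\<forall>z\<in>closure \<Omega>. norm (H z - b z) \<le> e)"
proof -
  obtain k' where k': "continuous_on (closure \<Omega>) k'" "\<And>z. z \<in> \<Omega> \<Longrightarrow> k' z = k z"
    "\<And>e. e > 0 \<Longrightarrow> \<exists>H. A_infty \<Omega> H \<and> (\<forall>z\<in>closure \<Omega>. norm (H z - k' z) \<le> e)"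
    using uniform_approx[OF k M] by metis
  obtain H where H: "A_infty \<Omega> H" "\<And>z. z \<in> closure \<Omega> \<Longrightarrow> norm (H z - k' z) \<le> e" using k'(3)[OF e] by blast
  have "norm (H z - b z) \<le> e" if "z \<in> closure \<Omega>" for z
  proof (rule continuous_on_closure_norm_le[OF _ _ that])
    show "continuous_on (closure \<Omega>) (\<lambda>z. H z - b z)"
      using H(1) b(1) by (intro continuous_intros) (auto simp: A_infty_def)
    show "\<forall>z\<in>\<Omega>. norm (H z - b z) \<le> e" using H(2) k'(2) b(2) closure_subset by fastforce
  qed
  then show ?thesis using H(1) by blast
qed

text \<open>A diagonal choice: \<open>F n\<close> is taken within 1/(n + 1) of \<open>b n\<close> on
  the closure, hence close to it both in norm on the frontier and pointwise inside.\<close>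

lemma (in weighted_domain) approximating_sequence:
  assumes b: "\<And>n. continuous_on (closure \<Omega>) (b n)"
    and ap: "\<And>n e. e > 0 \<Longrightarrow> \<exists>H. A_infty \<Omega> H \<and> (\<forall>z\<in>closure \<Omega>. norm (H z - b n z) \<le> e)"
    and u: "sq_integrable u" and lim: "(\<lambda>n. norm_sq (\<lambda>w. u w - b n w)) \<longlonglongrightarrow> 0"
  obtains F where "\<And>n. A_infty \<Omega> (F n)" "(\<lambda>n. norm_sq (\<lambda>w. u w - F n w)) \<longlonglongrightarrow> 0"
    "\<And>z. z \<in> closure \<Omega> \<Longrightarrow> (\<lambda>n. F n z - b n z) \<longlonglongrightarrow> 0"
proof -
  define r where "r = (\<lambda>n. inverse (real (Suc n)))"
  have "\<exists>H. A_infty \<Omega> H \<and> (\<forall>z\<in>closure \<Omega>. norm (H z - b n z) \<le> r n)" for n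
    by (rule ap) (simp add: r_def)
  then obtain F where F: "\<And>n. A_infty \<Omega> (F n)" "\<And>n z. z \<in> closure \<Omega> \<Longrightarrow> norm (F n z - b n z) \<le> r n" by metis
  have r0: "r \<longlonglongrightarrow> 0" unfolding r_def by (rule LIMSEQ_inverse_real_of_nat)
  have fc: "frontier \<Omega> \<subseteq> closure \<Omega>" by (auto simp: frontier_def)
  have cF: "continuous_on (closure \<Omega>) (F n)" for n using F(1) by (simp add: A_infty_def)
  have sb: "sq_integrable (b n)" for n by (rule sq_integrable_continuous[OF continuous_on_subset[OF b fc]])
  have cbF: "continuous_on (frontier \<Omega>) (\<lambda>w. b n w - F n w)" for n
    by (intro continuous_intros continuous_on_subset[OF b fc] continuous_on_subset[OF cF fc])
  have le: "norm_sq (\<lambda>w. u w - F n w) \<le> 2 * norm_sq (\<lambda>w. u w - b n w) + 2 * ((r n)\<^sup>2 * norm_sq (\<lambda>_. 1))" for n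
  proof -
    have "norm_sq (\<lambda>w. b n w - F n w) \<le> (r n)\<^sup>2 * norm_sq (\<lambda>_. 1)"
      by (rule norm_sq_bounded[OF cbF]) (use F(2) fc in \<open>force simp: norm_minus_commute\<close>)
    moreover have "norm_sq (\<lambda>w. (u w - b n w) + (b n w - F n w)) \<le> 2 * norm_sq (\<lambda>w. u w - b n w) + 2 * norm_sq (\<lambda>w. b n w - F n w)"
      by (rule sq_integrable_add(2)[OF sq_integrable_diff[OF u sb] sq_integrable_continuous[OF cbF]])
    ultimately show ?thesis by simp
  qed
  have "(\<lambda>n. 2 * norm_sq (\<lambda>w. u w - b n w) + 2 * ((r n)\<^sup>2 * norm_sq (\<lambda>_. 1))) \<longlonglongrightarrow> 2 * 0 + 2 * (0\<^sup>2 * norm_sq (\<lambda>_. 1))"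
    by (intro tendsto_intros lim r0)
  then have "(\<lambda>n. norm_sq (\<lambda>w. u w - F n w)) \<longlonglongrightarrow> 0"
    using tendsto_zero_if_bounded_by[OF _ le norm_sq_nonneg] by simp
  moreover have "(\<lambda>n. F n z - b n z) \<longlonglongrightarrow> 0" if "z \<in> closure \<Omega>" for z
    by (rule Lim_null_comparison[OF _ r0]) (use F(2)[OF that] in auto)
  ultimately show ?thesis using that F(1) by blast
qed

section \<open>The Szego kernel as a reproducing kernel\<close>

locale szego_kernel = weighted_domain +
  fixes \<sigma> :: "complex \<Rightarrow> complex \<Rightarrow> complex"
  assumes szego: "is_szego_kernel \<Omega> Gs \<phi> \<sigma>"
begin

abbreviation "H2 \<equiv> hardy2 \<Omega> Gs \<phi>"

definition ker :: "complex \<Rightarrow> complex \<Rightarrow> complex" where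
  "ker z w = cnj (\<sigma> z w)"

lemma ker_hardy2: "z \<in> \<Omega> \<Longrightarrow> ker z \<in> H2"
  using szego by (simp add: is_szego_kernel_def ker_def[abs_def])

lemma hardy2_sq_integrable: "h \<in> H2 \<Longrightarrow> sq_integrable h"
  by (simp add: hardy2_iff)

lemma reproducing: "h \<in> H2 \<Longrightarrow> z \<in> \<Omega> \<Longrightarrow> h z = ip h (ker z)"
  using szego bdry_integral_ip[of "\<sigma> z" h] by (simp add: is_szego_kernel_def ker_def[abs_def])

text \<open>Hermitian symmetry at interior points: reproduce each kernel function at the other point
  and compare.\<close>

lemma ker_swap:
  assumes "z \<in> \<Omega>" "w \<in> \<Omega>"
  shows "ker z w = \<sigma> w z"
proof -
  have "ker z w = ip (ker z) (ker w)" by (rule reproducing[OF ker_hardy2[OF assms(1)] assms(2)])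
  also have "\<dots> = cnj (ip (ker w) (ker z))" by (rule ip_commute)
  also have "ip (ker w) (ker z) = ker w z" by (rule reproducing[OF ker_hardy2[OF assms(2)] assms(1), symmetric])
  finally show ?thesis by (simp add: ker_def)
qed

lemma A_infty_hardy2: "A_infty \<Omega> g \<Longrightarrow> g \<in> H2"
  unfolding hardy2_iff
proof (intro conjI exI[of _ "\<lambda>_. g"] allI ballI)
  have "norm_sq (\<lambda>w. 0) = 0" using norm_sq_bounded[of "\<lambda>_. 0" 0] norm_sq_nonneg[of "\<lambda>w. 0"] by simp
  then show "(\<lambda>n. norm_sq (\<lambda>w. g w - g w)) \<longlonglongrightarrow> 0" by simp
qed (auto intro: A_infty_sq_integrable)

lemma hardy2_lincomb:
  assumes "h \<in> H2" "k \<in> H2"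
  shows "(\<lambda>w. h w + c * k w) \<in> H2"
proof -
  obtain g where g: "\<And>n. A_infty \<Omega> (g n)" "(\<lambda>n. norm_sq (\<lambda>w. h w - g n w)) \<longlonglongrightarrow> 0" "\<And>z. z\<in>\<Omega> \<Longrightarrow> (\<lambda>n. g n z) \<longlonglongrightarrow> h z"
    using assms(1) unfolding hardy2_iff by blast
  obtain g' where g': "\<And>n. A_infty \<Omega> (g' n)" "(\<lambda>n. norm_sq (\<lambda>w. k w - g' n w)) \<longlonglongrightarrow> 0" "\<And>z. z\<in>\<Omega> \<Longrightarrow> (\<lambda>n. g' n z) \<longlonglongrightarrow> k z"
    using assms(2) unfolding hardy2_iff by blast
  note sq = hardy2_sq_integrable[OF assms(1)] hardy2_sq_integrable[OF assms(2)]
  have le: "norm_sq (\<lambda>w. (h w + c * k w) - (g n w + c * g' n w)) \<le> 2 * norm_sq (\<lambda>w. h w - g n w) + 2 * ((norm c)\<^sup>2 * norm_sq (\<lambda>w. k w - g' n w))" for n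
  proof -
    have d: "sq_integrable (\<lambda>w. h w - g n w)" "sq_integrable (\<lambda>w. k w - g' n w)"
      by (intro sq_integrable_diff sq A_infty_sq_integrable g g')+
    have "norm_sq (\<lambda>w. (h w - g n w) + c * (k w - g' n w)) \<le> 2 * norm_sq (\<lambda>w. h w - g n w) + 2 * norm_sq (\<lambda>w. c * (k w - g' n w))"
      by (rule sq_integrable_add(2)[OF d(1) sq_integrable_cmult[OF d(2)]])
    moreover have "norm_sq (\<lambda>w. c * (k w - g' n w)) \<le> (norm c)\<^sup>2 * norm_sq (\<lambda>w. k w - g' n w)"
      by (rule sq_integrable_bounded_mult(2)[OF d(2)]) auto
    moreover have "(\<lambda>w. (h w + c * k w) - (g n w + c * g' n w)) = (\<lambda>w. (h w - g n w) + c * (k w - g' n w))"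
      by (simp add: fun_eq_iff algebra_simps)
    ultimately show ?thesis by simp
  qed
  have "(\<lambda>n. 2 * norm_sq (\<lambda>w. h w - g n w) + 2 * ((norm c)\<^sup>2 * norm_sq (\<lambda>w. k w - g' n w))) \<longlonglongrightarrow> 2 * 0 + 2 * ((norm c)\<^sup>2 * 0)"
    by (intro tendsto_intros g g')
  then have "(\<lambda>n. norm_sq (\<lambda>w. (h w + c * k w) - (g n w + c * g' n w))) \<longlonglongrightarrow> 0"
    using tendsto_zero_if_bounded_by[OF _ le norm_sq_nonneg] by simp
  then show ?thesis
    unfolding hardy2_iff
    using g g' A_infty_lincomb[OF g(1) g'(1) open_dom] sq_integrable_add(1)[OF sq(1) sq_integrable_cmult[OF sq(2)]]
    by (intro conjI exI[of _ "\<lambda>n w. g n w + c * g' n w"]) (auto intro!: tendsto_intros)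
qed

lemma hardy2_zero: "(\<lambda>_. 0) \<in> H2"
  by (intro A_infty_hardy2 A_infty_if_holomorphic_nbhd[of UNIV]) auto

lemma hardy2_sum:
  assumes "finite I" "\<And>i. i \<in> I \<Longrightarrow> k i \<in> H2"
  shows "(\<lambda>w. \<Sum>i\<in>I. c i * k i w) \<in> H2"
  using assms
proof (induction I)
  case empty
  then show ?case by (simp add: hardy2_zero)
next
  case (insert j I)
  then have "(\<lambda>w. (\<Sum>i\<in>I. c i * k i w) + c j * k j w) \<in> H2" by (intro hardy2_lincomb) auto
  then show ?case using insert by (simp add: add.commute)
qed

text \<open>Interior values are recorded separately from boundary values; the reproducing property
  ties them to the boundary norm.\<close>

lemma hardy2_null:
  assumes "h \<in> H2" "ip h h = 0" "z \<in> \<Omega>"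
  shows "h z = 0"
  using reproducing[OF assms(1,3)] ip_zero_norm[of h "ker z"] assms ip_self[of h]
    hardy2_sq_integrable ker_hardy2 by simp

text \<open>The limit \<open>u\<close> is meaningful on the frontier only. Pairing it with
  \<open>ker w\<close> defines interior values, and these are the pointwise limits because the
  pairing is continuous in the norm.\<close>

lemma hardy2_limit:
  assumes F: "\<And>n. A_infty \<Omega> (F n)" and u: "sq_integrable u"
    and lim: "(\<lambda>n. norm_sq (\<lambda>w. u w - F n w)) \<longlonglongrightarrow> 0"
  defines "v \<equiv> \<lambda>w. if w \<in> \<Omega> then ip u (ker w) else u w"
  shows "v \<in> H2" "\<And>z. z \<in> \<Omega> \<Longrightarrow> (\<lambda>n. F n z) \<longlonglongrightarrow> v z" "\<And>w. w \<in> frontier \<Omega> \<Longrightarrow> v w = u w"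
proof -
  show fr: "v w = u w" if "w \<in> frontier \<Omega>" for w
    using that frontier_disjoint by (auto simp: v_def)
  show pt: "(\<lambda>n. F n z) \<longlonglongrightarrow> v z" if z: "z \<in> \<Omega>" for z
  proof -
    have "F n z = ip (F n) (ker z)" for n by (rule reproducing[OF A_infty_hardy2[OF F] z])
    moreover have "(\<lambda>n. ip (F n) (ker z)) \<longlonglongrightarrow> ip u (ker z)"
      by (rule ip_tendsto[OF A_infty_sq_integrable[OF F] u hardy2_sq_integrable[OF ker_hardy2[OF z]] lim])
    ultimately show ?thesis using z by (simp add: v_def)
  qed
  have "norm_sq (\<lambda>w. v w - F n w) = norm_sq (\<lambda>w. u w - F n w)" for n
    by (rule norm_sq_cong) (simp add: fr)
  moreover have "sq_integrable v" using sq_integrable_cong[of v u] fr u by blast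
  ultimately show "v \<in> H2"
    unfolding hardy2_iff using F lim pt by (intro conjI exI[of _ F]) simp_all
qed

end

locale szego_proper = szego_kernel + proper_disc_map
begin

text \<open>For approximants \<open>g n\<close> of \<open>h\<close>, the product of \<open>f\<close>
  and \<open>g n\<close> has bounded derivative and so is a uniform limit of \<open>A_infty\<close>
  functions. A factor of modulus 1 does not change distances on the frontier.\<close>

lemma hardy2_mult_boundary:
  assumes f': "continuous_on (closure \<Omega>) f'" "\<And>z. z \<in> \<Omega> \<Longrightarrow> f' z = f z" "\<And>z. z \<in> frontier \<Omega> \<Longrightarrow> norm (f' z) = 1"
    and h: "h \<in> H2"
  shows "(\<lambda>w. f' w * h w) \<in> H2"
proof -
  obtain g where g: "\<And>n. A_infty \<Omega> (g n)" "(\<lambda>n. norm_sq (\<lambda>w. h w - g n w)) \<longlonglongrightarrow> 0" "\<And>z. z\<in>\<Omega> \<Longrightarrow> (\<lambda>n. g n z) \<longlonglongrightarrow> h z"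
    using h unfolding hardy2_iff by blast
  note sq = hardy2_sq_integrable[OF h]
  have cf: "continuous_on (frontier \<Omega>) f'" by (rule continuous_on_subset[OF f'(1)]) (auto simp: frontier_def)
  have cg: "continuous_on (closure \<Omega>) (\<lambda>w. f' w * g n w)" for n
    using g(1)[of n] f'(1) by (intro continuous_intros) (auto simp: A_infty_def)
  have su: "sq_integrable (\<lambda>w. f' w * h w)"
    by (rule sq_integrable_bounded_mult(1)[OF sq cf, of 1]) (simp add: f'(3))
  have ap: "\<exists>H. A_infty \<Omega> H \<and> (\<forall>z\<in>closure \<Omega>. norm (H z - f' z * g n z) \<le> e)" if e: "e > 0" for n e
  proof -
    obtain M where "\<And>z. z \<in> \<Omega> \<Longrightarrow> norm (deriv (\<lambda>z. f z * g n z) z) \<le> M" using mult_bounded_deriv(2)[OF g(1)] by blast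
    from uniform_approx_closure[OF mult_bounded_deriv(1)[OF g(1)] this cg _ e] show ?thesis using f'(2) by simp
  qed
  have "norm_sq (\<lambda>w. f' w * h w - f' w * g n w) \<le> norm_sq (\<lambda>w. h w - g n w)" for n
  proof -
    have "norm_sq (\<lambda>w. f' w * (h w - g n w)) \<le> 1\<^sup>2 * norm_sq (\<lambda>w. h w - g n w)"
      by (rule sq_integrable_bounded_mult(2)[OF sq_integrable_diff[OF sq A_infty_sq_integrable[OF g(1)]] cf]) (simp add: f'(3))
    then show ?thesis by (simp add: right_diff_distrib)
  qed
  from tendsto_zero_if_bounded_by[OF g(2) this norm_sq_nonneg]
  have "(\<lambda>n. norm_sq (\<lambda>w. f' w * h w - f' w * g n w)) \<longlonglongrightarrow> 0" .
  from approximating_sequence[where b="\<lambda>n w. f' w * g n w", OF cg ap su this]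
  obtain F where F: "\<And>n. A_infty \<Omega> (F n)" "(\<lambda>n. norm_sq (\<lambda>w. f' w * h w - F n w)) \<longlonglongrightarrow> 0"
    "\<And>z. z \<in> closure \<Omega> \<Longrightarrow> (\<lambda>n. F n z - f' z * g n z) \<longlonglongrightarrow> 0"
    by blast
  have "(\<lambda>n. F n z) \<longlonglongrightarrow> f' z * h z" if z: "z \<in> \<Omega>" for z
  proof -
    have "(\<lambda>n. (F n z - f' z * g n z) + f' z * g n z) \<longlonglongrightarrow> 0 + f' z * h z"
      using z closure_subset by (intro tendsto_intros F(3) g(3)) auto
    then show ?thesis by simp
  qed
  then show ?thesis unfolding hardy2_iff using su F(1,2) by blast
qed

text \<open>Approximants \<open>g n\<close> of \<open>h\<close> need not vanish at the zeros of
  \<open>f\<close>, but their values there tend to 0. Subtracting the Lagrange interpolant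
  \<open>p n\<close> therefore keeps the limit, and the corrected \<open>g1 n\<close> can be
  divided. On the frontier division by \<open>f'\<close> is multiplication by its conjugate, which
  preserves norms.\<close>

lemma hardy2_divide_boundary:
  assumes f': "continuous_on (closure \<Omega>) f'" "\<And>z. z \<in> \<Omega> \<Longrightarrow> f' z = f z" "\<And>z. z \<in> frontier \<Omega> \<Longrightarrow> norm (f' z) = 1"
    and Z: "finite {z \<in> \<Omega>. f z = 0}" "\<And>z. z \<in> \<Omega> \<Longrightarrow> f z = 0 \<Longrightarrow> deriv f z \<noteq> 0"
    and h: "h \<in> H2" "\<And>z. z \<in> \<Omega> \<Longrightarrow> f z = 0 \<Longrightarrow> h z = 0"
  obtains v where "v \<in> H2" "\<And>z. z \<in> \<Omega> \<Longrightarrow> f z * v z = h z" "\<And>w. w \<in> frontier \<Omega> \<Longrightarrow> v w = cnj (f' w) * h w"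
proof -
  define Z where "Z = {z \<in> \<Omega>. f z = 0}"
  have finZ: "finite Z" using Z(1) by (simp add: Z_def)
  obtain g where g: "\<And>n. A_infty \<Omega> (g n)" "(\<lambda>n. norm_sq (\<lambda>w. h w - g n w)) \<longlonglongrightarrow> 0" "\<And>z. z\<in>\<Omega> \<Longrightarrow> (\<lambda>n. g n z) \<longlonglongrightarrow> h z"
    using h(1) unfolding hardy2_iff by blast
  note sq = hardy2_sq_integrable[OF h(1)]
  have fc: "frontier \<Omega> \<subseteq> closure \<Omega>" by (auto simp: frontier_def)
  obtain L where L: "\<And>a b. a \<in> Z \<Longrightarrow> b \<in> Z \<Longrightarrow> poly (L a) b = (if a = b then 1 else 0)"
    using interpolation_basis[OF finZ] by blast
  define p where "p = (\<lambda>n. \<Sum>a\<in>Z. Polynomial.smult (g n a) (L a))"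
  have p: "poly (p n) z = (\<Sum>a\<in>Z. g n a * poly (L a) z)" for n z by (simp add: p_def poly_sum)
  define g1 where "g1 = (\<lambda>n z. g n z - poly (p n) z)"
  have g1A: "A_infty \<Omega> (g1 n)" for n unfolding g1_def by (rule A_infty_diff_poly[OF g(1) open_dom])
  have g1c: "continuous_on (closure \<Omega>) (g1 n)" for n using g1A by (simp add: A_infty_def)
  have g1Z: "g1 n z = 0" if "z \<in> Z" for n z
  proof -
    have "poly (p n) z = (\<Sum>a\<in>Z. if a = z then g n a else 0)"
      unfolding p by (rule sum.cong) (use L that in auto)
    then show ?thesis using finZ that by (simp add: g1_def)
  qed
  have p0: "(\<lambda>n. poly (p n) z) \<longlonglongrightarrow> 0" for z
  proof -
    have "(\<lambda>n. \<Sum>a\<in>Z. g n a * poly (L a) z) \<longlonglongrightarrow> (\<Sum>a\<in>Z. h a * poly (L a) z)"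
      by (intro tendsto_intros g(3)) (auto simp: Z_def)
    moreover have "(\<Sum>a\<in>Z. h a * poly (L a) z) = 0" by (rule sum.neutral) (auto simp: Z_def h(2))
    ultimately show ?thesis by (simp add: p)
  qed
  have "\<forall>a\<in>Z. \<exists>C. \<forall>z\<in>frontier \<Omega>. norm (poly (L a) z) \<le> C"
  proof
    fix a
    have "compact (poly (L a) ` frontier \<Omega>)"
      by (intro compact_continuous_image compact_frontier_bounded bounded_dom continuous_intros)
    then show "\<exists>C. \<forall>z\<in>frontier \<Omega>. norm (poly (L a) z) \<le> C"
      by (drule_tac compact_imp_bounded) (simp add: bounded_iff)
  qed
  then obtain C where C: "\<And>a z. a \<in> Z \<Longrightarrow> z \<in> frontier \<Omega> \<Longrightarrow> norm (poly (L a) z) \<le> C a" by metis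
  \<comment> \<open>Bounds the interpolant uniformly on the frontier through its finitely many nodal
    values, each of which tends to 0.\<close>
  define q where "q = (\<lambda>n. \<Sum>a\<in>Z. norm (g n a) * C a)"
  have q0: "q \<longlonglongrightarrow> 0"
  proof -
    have "(\<lambda>n. \<Sum>a\<in>Z. norm (g n a) * C a) \<longlonglongrightarrow> (\<Sum>a\<in>Z. norm (h a) * C a)"
      by (intro tendsto_intros g(3)) (auto simp: Z_def)
    moreover have "(\<Sum>a\<in>Z. norm (h a) * C a) = 0" by (rule sum.neutral) (auto simp: Z_def h(2))
    ultimately show ?thesis by (simp add: q_def)
  qed
  have pq: "norm (poly (p n) w) \<le> q n" if "w \<in> frontier \<Omega>" for n w
    unfolding p q_def by (rule sum_norm_le) (use C that in \<open>auto simp: norm_mult intro!: mult_left_mono\<close>)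
  have cp: "continuous_on S (poly (p n))" for S n by (intro continuous_intros)
  have lim1: "(\<lambda>n. norm_sq (\<lambda>w. h w - g1 n w)) \<longlonglongrightarrow> 0"
  proof -
    have le: "norm_sq (\<lambda>w. h w - g1 n w) \<le> 2 * norm_sq (\<lambda>w. h w - g n w) + 2 * ((q n)\<^sup>2 * norm_sq (\<lambda>_. 1))" for n
    proof -
      have "norm_sq (\<lambda>w. (h w - g n w) + poly (p n) w) \<le> 2 * norm_sq (\<lambda>w. h w - g n w) + 2 * norm_sq (poly (p n))"
        by (rule sq_integrable_add(2)[OF sq_integrable_diff[OF sq A_infty_sq_integrable[OF g(1)]] sq_integrable_continuous[OF cp]])
      moreover have "norm_sq (poly (p n)) \<le> (q n)\<^sup>2 * norm_sq (\<lambda>_. 1)" by (rule norm_sq_bounded[OF cp pq])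
      moreover have "(\<lambda>w. h w - g1 n w) = (\<lambda>w. (h w - g n w) + poly (p n) w)" by (simp add: g1_def fun_eq_iff)
      ultimately show ?thesis by simp
    qed
    have "(\<lambda>n. 2 * norm_sq (\<lambda>w. h w - g n w) + 2 * ((q n)\<^sup>2 * norm_sq (\<lambda>_. 1))) \<longlonglongrightarrow> 2 * 0 + 2 * (0\<^sup>2 * norm_sq (\<lambda>_. 1))"
      by (intro tendsto_intros g q0)
    then show ?thesis
      using tendsto_zero_if_bounded_by[OF _ le norm_sq_nonneg] by simp
  qed
  have "\<exists>b. continuous_on (closure \<Omega>) b \<and> (\<forall>z\<in>closure \<Omega>. f' z * b z = g1 n z) \<and>
     (\<forall>e>0. \<exists>H. A_infty \<Omega> H \<and> (\<forall>z\<in>closure \<Omega>. norm (H z - b z) \<le> e))" for n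
  proof -
    have zz: "deriv f z \<noteq> 0 \<and> g1 n z = 0" if "z \<in> \<Omega>" "f z = 0" for z using that Z(2) g1Z by (auto simp: Z_def)
    obtain k M where k: "k holomorphic_on \<Omega>" "\<And>z. z \<in> \<Omega> \<Longrightarrow> f z * k z = g1 n z" "\<And>z. z \<in> \<Omega> \<Longrightarrow> norm (deriv k z) \<le> M"
      using divide_bounded_deriv[OF g1A Z(1) zz] by metis
    obtain b where b: "continuous_on (closure \<Omega>) b" "\<And>z. z \<in> \<Omega> \<Longrightarrow> b z = k z"
      "\<And>e. e > 0 \<Longrightarrow> \<exists>H. A_infty \<Omega> H \<and> (\<forall>z\<in>closure \<Omega>. norm (H z - b z) \<le> e)"
      using uniform_approx[OF k(1,3)] by metis
    \<comment> \<open>The identity holds on \<Omega> and passes to the closure by continuity; it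
      identifies \<open>b\<close> on the frontier.\<close>
    have "f' z * b z - g1 n z = 0" if "z \<in> closure \<Omega>" for z
      by (rule continuous_constant_on_closure[of \<Omega> "\<lambda>z. f' z * b z - g1 n z", OF _ _ that])
        (use k(2) b(2) f'(2) in \<open>auto intro!: continuous_intros f'(1) b(1) g1c\<close>)
    then show ?thesis using b(1,3) by auto
  qed
  then obtain b where b: "\<And>n. continuous_on (closure \<Omega>) (b n)" "\<And>n z. z \<in> closure \<Omega> \<Longrightarrow> f' z * b n z = g1 n z"
    "\<And>n e. e > 0 \<Longrightarrow> \<exists>H. A_infty \<Omega> H \<and> (\<forall>z\<in>closure \<Omega>. norm (H z - b n z) \<le> e)" by metis
  define u where "u = (\<lambda>w. cnj (f' w) * h w)"
  have cf: "continuous_on (frontier \<Omega>) (\<lambda>w. cnj (f' w))"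
    by (intro continuous_intros continuous_on_subset[OF f'(1) fc])
  have su: "sq_integrable u" unfolding u_def
    by (rule sq_integrable_bounded_mult(1)[OF sq cf, of 1]) (simp add: f'(3))
  have ub: "b n w = cnj (f' w) * g1 n w" if w: "w \<in> frontier \<Omega>" for n w
  proof -
    have "cnj (f' w) * f' w = 1"
      using f'(3)[OF w] by (simp add: complex_norm_square[symmetric] mult.commute)
    moreover have "f' w * b n w = g1 n w" using b(2) fc w by blast
    ultimately show ?thesis by (metis mult.assoc mult_1)
  qed
  have "norm_sq (\<lambda>w. u w - b n w) \<le> norm_sq (\<lambda>w. h w - g1 n w)" for n
  proof -
    have "norm_sq (\<lambda>w. u w - b n w) = norm_sq (\<lambda>w. cnj (f' w) * (h w - g1 n w))"
      by (rule norm_sq_cong) (simp add: u_def ub right_diff_distrib)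
    also have "\<dots> \<le> 1\<^sup>2 * norm_sq (\<lambda>w. h w - g1 n w)"
      by (rule sq_integrable_bounded_mult(2)[OF sq_integrable_diff[OF sq A_infty_sq_integrable[OF g1A]] cf]) (simp add: f'(3))
    finally show ?thesis by simp
  qed
  from tendsto_zero_if_bounded_by[OF lim1 this norm_sq_nonneg]
  have "(\<lambda>n. norm_sq (\<lambda>w. u w - b n w)) \<longlonglongrightarrow> 0" .
  from approximating_sequence[where b=b, OF b(1,3) su this]
  obtain F where F: "\<And>n. A_infty \<Omega> (F n)" "(\<lambda>n. norm_sq (\<lambda>w. u w - F n w)) \<longlonglongrightarrow> 0"
    "\<And>z. z \<in> closure \<Omega> \<Longrightarrow> (\<lambda>n. F n z - b n z) \<longlonglongrightarrow> 0"
    by blast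
  \<comment> \<open>Boundary values are those of \<open>u\<close>, interior values come from the
    pairing. Multiplying the pointwise limit by \<open>f z\<close> recovers
    \<open>h\<close>.\<close>
  define v where "v = (\<lambda>w. if w \<in> \<Omega> then ip u (ker w) else u w)"
  have v: "v \<in> H2" "\<And>z. z \<in> \<Omega> \<Longrightarrow> (\<lambda>n. F n z) \<longlonglongrightarrow> v z" "\<And>w. w \<in> frontier \<Omega> \<Longrightarrow> v w = u w"
    unfolding v_def by (fact hardy2_limit[OF F(1) su F(2)])+
  have "f z * v z = h z" if z: "z \<in> \<Omega>" for z
  proof -
    have zc: "z \<in> closure \<Omega>" using z closure_subset by blast
    have "(\<lambda>n. f z * (F n z - b n z) + (g n z - poly (p n) z)) \<longlonglongrightarrow> f z * 0 + (h z - 0)"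
      by (intro tendsto_intros F(3) zc g(3) z p0)
    moreover have "f z * (F n z - b n z) + (g n z - poly (p n) z) = f z * F n z" for n
      using b(2)[OF zc, of n] f'(2)[OF z] by (simp add: g1_def right_diff_distrib)
    ultimately have "(\<lambda>n. f z * F n z) \<longlonglongrightarrow> h z" by simp
    moreover have "(\<lambda>n. f z * F n z) \<longlonglongrightarrow> f z * v z" by (rule tendsto_mult[OF tendsto_const v(2)[OF z]])
    ultimately show ?thesis using LIMSEQ_unique by blast
  qed
  then show ?thesis using that v(1,3) by (auto simp: u_def)
qed

end

section \<open>Inverse matrices indexed from 1\<close>

text \<open>A trivial kernel makes the determinant nonzero, and a unit of the matrix ring has a
  two-sided inverse. Entries of \<open>mat\<close> are counted from 0 and those of the statement
  from 1, hence the shifts.\<close>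

lemma matrix_inverse_exists:
  fixes S :: "nat \<Rightarrow> nat \<Rightarrow> 'a::field"
  assumes ker: "\<And>x. (\<And>k. k \<in> {1..N} \<Longrightarrow> (\<Sum>j=1..N. S k j * x j) = 0) \<Longrightarrow> \<forall>j\<in>{1..N}. x j = 0"
  shows "\<exists>c. \<forall>i\<in>{1..N}. \<forall>j\<in>{1..N}.
     (\<Sum>k=1..N. c i k * S k j) = (if i = j then 1 else 0) \<and>
     (\<Sum>k=1..N. S i k * c k j) = (if i = j then 1 else 0)"
proof -
  define A where "A = mat N N (\<lambda>(i, j). S (Suc i) (Suc j))"
  have A: "A \<in> carrier_mat N N" by (simp add: A_def)
  have sh: "(\<Sum>k=1..N. h k) = (\<Sum>k=0..<N. h (Suc k))" for h :: "nat \<Rightarrow> 'a"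
    by (rule sum.reindex_bij_witness[of _ Suc "\<lambda>k. k - 1"]) auto
  have "Determinant.det A \<noteq> 0"
  proof
    assume "Determinant.det A = 0"
    then obtain v where v: "v \<in> carrier_vec N" "v \<noteq> 0\<^sub>v N" "A *\<^sub>v v = 0\<^sub>v N"
      using det_0_iff_vec_prod_zero_field[OF A] by blast
    have "\<forall>j\<in>{1..N}. v $ (j - 1) = 0"
    proof (rule ker)
      fix k assume k: "k \<in> {1..N}"
      then obtain i where i: "k = Suc i" "i < N" by (cases k) auto
      have "(\<Sum>j=1..N. S k j * v $ (j - 1)) = (A *\<^sub>v v) $ (k - 1)"
        using i v(1) unfolding sh by (simp add: A_def scalar_prod_def)
      then show "(\<Sum>j=1..N. S k j * v $ (j - 1)) = 0" using v(3) i by simp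
    qed
    then have "v $ i = 0" if "i < N" for i using that by (metis Suc_leI atLeastAtMost_iff diff_Suc_1 le_add1 plus_1_eq_Suc)
    then have "v = 0\<^sub>v N" using v(1) by (intro eq_vecI) auto
    then show False using v(2) by simp
  qed
  from det_non_zero_imp_unit[OF A this] obtain B where B: "B \<in> carrier_mat N N" "B * A = 1\<^sub>m N" "A * B = 1\<^sub>m N"
    unfolding Units_def by (auto simp: ring_mat_def)
  define c where "c = (\<lambda>i j. B $$ (i - 1, j - 1))"
  have "(\<Sum>k=1..N. c i k * S k j) = (if i = j then 1 else 0) \<and> (\<Sum>k=1..N. S i k * c k j) = (if i = j then 1 else 0)"
    if ij: "i \<in> {1..N}" "j \<in> {1..N}" for i j
  proof -
    obtain i' where i': "i = Suc i'" "i' < N" using ij(1) by (cases i) auto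
    obtain j' where j': "j = Suc j'" "j' < N" using ij(2) by (cases j) auto
    have "(\<Sum>k=1..N. c i k * S k j) = (B * A) $$ (i - 1, j - 1)"
      using i' j' B(1) unfolding sh by (simp add: c_def A_def scalar_prod_def)
    moreover have "(\<Sum>k=1..N. S i k * c k j) = (A * B) $$ (i - 1, j - 1)"
      using i' j' B(1) unfolding sh by (simp add: c_def A_def scalar_prod_def)
    ultimately show ?thesis using B(2,3) i' j' by auto
  qed
  then show ?thesis by blast
qed

section \<open>The kernel formula\<close>

context szego_proper
begin

text \<open>Let u be the combination of the kernels with coefficients \<open>x j\<close>. The
  hypothesis says that u vanishes at all the points, so u is orthogonal to itself and hence to every
  h in the Hardy space. Pairing with a Lagrange polynomial isolates one coefficient.\<close>

lemma gram_kernel_trivial: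
  assumes a: "a ` I \<subseteq> \<Omega>" "inj_on a I" "finite I"
    and x: "\<And>k. k \<in> I \<Longrightarrow> (\<Sum>j\<in>I. \<sigma> (a k) (a j) * x j) = 0"
  shows "\<forall>j\<in>I. x j = 0"
proof
  fix i assume i: "i \<in> I"
  define u where "u = (\<lambda>w. \<Sum>j\<in>I. x j * ker (a j) w)"
  have aO: "a j \<in> \<Omega>" if "j \<in> I" for j using a(1) that by blast
  have kH: "ker (a j) \<in> H2" if "j \<in> I" for j using aO[OF that] by (rule ker_hardy2)
  have uH: "u \<in> H2" unfolding u_def by (rule hardy2_sum[OF a(3) kH])
  have ipu: "ip h u = (\<Sum>j\<in>I. cnj (x j) * h (a j))" if h: "h \<in> H2" for h
  proof -
    have "ip h u = (\<Sum>j\<in>I. ip h (\<lambda>w. x j * ker (a j) w))"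
      unfolding u_def
      by (rule ip_sum_right[OF a(3) sq_integrable_cmult[OF hardy2_sq_integrable[OF kH]] hardy2_sq_integrable[OF h]])
    also have "\<dots> = (\<Sum>j\<in>I. cnj (x j) * h (a j))"
      by (rule sum.cong) (simp_all add: reproducing[OF h] aO ip_cmult_right)
    finally show ?thesis .
  qed
  have "u (a k) = 0" if k: "k \<in> I" for k
  proof -
    have "u (a k) = (\<Sum>j\<in>I. \<sigma> (a k) (a j) * x j)"
      unfolding u_def by (rule sum.cong) (simp_all add: aO k ker_swap mult.commute)
    then show ?thesis using x[OF k] by simp
  qed
  then have "ip u u = 0" unfolding ipu[OF uH] by simp
  then have u0: "norm_sq u = 0" by (simp add: ip_self)
  obtain L where L: "\<And>b c. b \<in> a ` I \<Longrightarrow> c \<in> a ` I \<Longrightarrow> poly (L b) c = (if b = c then 1 else 0)"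
    using interpolation_basis[of "a ` I"] a(3) by auto
  define h where "h = poly (L (a i))"
  have hH: "h \<in> H2" unfolding h_def by (intro A_infty_hardy2 A_infty_polynomial)
  have "ip h u = cnj (ip u h)" by (rule ip_commute)
  also have "\<dots> = 0"
    using ip_zero_norm[OF hardy2_sq_integrable[OF uH] hardy2_sq_integrable[OF hH] u0] by simp
  finally have "(\<Sum>j\<in>I. cnj (x j) * h (a j)) = 0" using ipu[OF hH] by simp
  moreover have "(\<Sum>j\<in>I. cnj (x j) * h (a j)) = (\<Sum>j\<in>I. if j = i then cnj (x j) else 0)"
    by (rule sum.cong) (use L i inj_onD[OF a(2)] in \<open>auto simp: h_def\<close>)
  ultimately show "x i = 0" using a(3) i by simp
qed

text \<open>The difference \<open>e\<close> of the two sides vanishes at the zeros of \<open>f\<close>, so \<open>e / f\<close> is again in the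
  Hardy space, and \<open>\<langle>e, f k\<^sub>z\<rangle> = \<langle>e / f, k\<^sub>z\<rangle>\<close> because \<open>\<bar>f\<bar> = 1\<close> on the boundary. This makes
  \<open>e\<close> orthogonal to itself.\<close>
lemma szego_kernel_formula:
  assumes zeros: "{z \<in> \<Omega>. f z = 0} = a ` I" and fin: "finite I"
    and simple: "\<And>k. k \<in> I \<Longrightarrow> deriv f (a k) \<noteq> 0"
    and c: "\<And>k j. k \<in> I \<Longrightarrow> j \<in> I \<Longrightarrow> (\<Sum>i\<in>I. \<sigma> (a k) (a i) * c i j) = (if k = j then 1 else 0)"
    and z: "z \<in> \<Omega>" and w: "w \<in> \<Omega>"
  shows "\<sigma> z w = (1 / (1 - f z * cnj (f w))) *
    (\<Sum>i\<in>I. \<Sum>j\<in>I. c i j * \<sigma> z (a i) * cnj (\<sigma> w (a j)))"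
proof -
  have aO: "a k \<in> \<Omega>" "f (a k) = 0" if "k \<in> I" for k using zeros that by auto
  obtain f' where f': "continuous_on (closure \<Omega>) f'" "\<And>z. z \<in> \<Omega> \<Longrightarrow> f' z = f z"
    "\<And>z. z \<in> frontier \<Omega> \<Longrightarrow> norm (f' z) = 1"
    using boundary_extension by blast
  \<comment> \<open>The inverse matrix applied to the values of \<open>ker w\<close> at the points
    makes \<open>s\<close> agree with \<open>ker w\<close> there. The base point is w; z is the
    variable at which the identity is finally evaluated.\<close>
  define \<alpha> where "\<alpha> = (\<lambda>i. \<Sum>j\<in>I. c i j * ker w (a j))"
  define fk where "fk = (\<lambda>x. f' x * ker w x)"
  define s where "s = (\<lambda>x. \<Sum>i\<in>I. \<alpha> i * ker (a i) x)"
  define e where "e = (\<lambda>x. (ker w x - cnj (f w) * fk x) - s x)"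
  have kH: "ker w \<in> H2" "\<And>i. i \<in> I \<Longrightarrow> ker (a i) \<in> H2" using w aO by (auto intro: ker_hardy2)
  have fkH: "fk \<in> H2" unfolding fk_def by (rule hardy2_mult_boundary[OF f' kH(1)])
  have sH: "s \<in> H2" unfolding s_def by (rule hardy2_sum[OF fin kH(2)])
  have eH: "e \<in> H2"
    using hardy2_lincomb[OF hardy2_lincomb[OF kH(1) fkH, of "- cnj (f w)"] sH, of "-1"] by (simp add: e_def)
  note sq = hardy2_sq_integrable
  have sa: "s (a k) = ker w (a k)" if k: "k \<in> I" for k
  proof -
    have "s (a k) = (\<Sum>i\<in>I. \<Sum>j\<in>I. \<sigma> (a k) (a i) * c i j * ker w (a j))"
      unfolding s_def \<alpha>_def sum_distrib_right
      by (intro sum.cong refl) (use ker_swap aO k in \<open>auto simp: mult_ac\<close>)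
    also have "\<dots> = (\<Sum>j\<in>I. (\<Sum>i\<in>I. \<sigma> (a k) (a i) * c i j) * ker w (a j))"
      unfolding sum_distrib_right by (rule sum.swap)
    also have "\<dots> = (\<Sum>j\<in>I. if j = k then ker w (a j) else 0)"
      by (rule sum.cong) (use c[OF k] in auto)
    finally show ?thesis using fin k by simp
  qed
  have zero: "\<exists>k\<in>I. x = a k" if "x \<in> \<Omega>" "f x = 0" for x
  proof -
    have "x \<in> a ` I" unfolding zeros[symmetric] using that by simp
    then show ?thesis by blast
  qed
  have e0: "e x = 0" if x: "x \<in> \<Omega>" "f x = 0" for x
  proof -
    obtain k where k: "k \<in> I" "x = a k" using zero[OF x] by blast
    show ?thesis unfolding k(2) e_def fk_def by (simp add: sa[OF k(1)] f'(2) aO[OF k(1)])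
  qed
  have dz: "deriv f x \<noteq> 0" if x: "x \<in> \<Omega>" "f x = 0" for x
    using zero[OF x] simple by auto
  have finZ: "finite {z \<in> \<Omega>. f z = 0}" unfolding zeros using fin by simp
  obtain v where v: "v \<in> H2" "\<And>x. x \<in> \<Omega> \<Longrightarrow> f x * v x = e x" "\<And>x. x \<in> frontier \<Omega> \<Longrightarrow> v x = cnj (f' x) * e x"
    using hardy2_divide_boundary[OF f' finZ dz eH e0] by metis
  \<comment> \<open>On the frontier e times the conjugate of \<open>f'\<close> is v, so this factor
    moves from the second argument to the other one.\<close>
  have efk: "ip e fk = v w"
  proof -
    have "ip e fk = ip v (ker w)"
      by (rule ip_cong) (simp add: fk_def v(3))
    then show ?thesis using reproducing[OF v(1) w] by simp
  qed
  \<comment> \<open>Each pairing with \<open>ker (a i)\<close> evaluates e at a zero of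
    \<open>f\<close>.\<close>
  have es: "ip e s = 0"
  proof -
    have "ip e s = (\<Sum>i\<in>I. ip e (\<lambda>x. \<alpha> i * ker (a i) x))"
      unfolding s_def by (rule ip_sum_right[OF fin sq_integrable_cmult[OF sq[OF kH(2)]] sq[OF eH]])
    also have "\<dots> = 0"
      by (rule sum.neutral) (use reproducing[OF eH] aO e0 in \<open>auto simp: ip_cmult_right\<close>)
    finally show ?thesis .
  qed
  have "ip e e = ip e (\<lambda>x. ker w x - cnj (f w) * fk x) - ip e s"
    using ip_diff_right[OF sq[OF eH] sq_integrable_diff[OF sq[OF kH(1)] sq_integrable_cmult[OF sq[OF fkH]]] sq[OF sH]]
    by (simp add: e_def)
  also have "ip e (\<lambda>x. ker w x - cnj (f w) * fk x) = ip e (ker w) - f w * ip e fk"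
    using ip_diff_right[OF sq[OF eH] sq[OF kH(1)] sq_integrable_cmult[OF sq[OF fkH]]] ip_cmult_right[of e "cnj (f w)" fk]
    by simp
  also have "ip e (ker w) = e w" using reproducing[OF eH w] by simp
  \<comment> \<open>What remains is \<open>e w - f w * v w\<close>, and v was chosen as the quotient
    of e by \<open>f\<close>.\<close>
  finally have "ip e e = 0" using efk es v(2)[OF w] by simp
  then have "e z = 0" by (rule hardy2_null[OF eH _ z])
  then have "ker w z * (1 - f z * cnj (f w)) = s z"
    using f'(2)[OF z] by (simp add: e_def fk_def algebra_simps)
  moreover have "s z = (\<Sum>i\<in>I. \<Sum>j\<in>I. c i j * \<sigma> z (a i) * cnj (\<sigma> w (a j)))"
    unfolding s_def \<alpha>_def sum_distrib_right
    by (intro sum.cong refl) (use ker_swap aO z in \<open>auto simp: ker_def mult_ac\<close>)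
  moreover have "1 - f z * cnj (f w) \<noteq> 0"
  proof
    assume "1 - f z * cnj (f w) = 0"
    then have "norm (f z) * norm (f w) = 1" by (metis complex_mod_cnj eq_iff_diff_eq_0 norm_mult norm_one)
    moreover have "norm (f z) * norm (f w) \<le> norm (f z) * 1"
      using norm_f_less[OF w] by (intro mult_left_mono) auto
    ultimately show False using norm_f_less[OF z] by simp
  qed
  ultimately show ?thesis using ker_swap[OF w z] by (simp add: field_simps)
qed

end

theorem theorem8p2:
  fixes \<Omega> :: "complex set" and Gs :: "(real \<Rightarrow> complex) list"
    and \<phi> :: "complex \<Rightarrow> real" and \<sigma> :: "complex \<Rightarrow> complex \<Rightarrow> complex"
    and f :: "complex \<Rightarrow> complex" and a :: "nat \<Rightarrow> complex" and N :: nat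
  assumes dom: "smooth_bounded_domain \<Omega> Gs"
    and wt: "smooth_pos_weight Gs \<phi>"
    and szego: "is_szego_kernel \<Omega> Gs \<phi> \<sigma>"
    and hol: "f holomorphic_on \<Omega>"
    and onto: "f ` \<Omega> = ball 0 1"
    and proper: "proper_map (top_of_set \<Omega>) (top_of_set (ball 0 1)) f"
    and zeros: "{z \<in> \<Omega>. f z = 0} = a ` {1..N}"
    and inj: "inj_on a {1..N}"
    and simple: "\<forall>k\<in>{1..N}. deriv f (a k) \<noteq> 0"
  shows "\<exists>c :: nat \<Rightarrow> nat \<Rightarrow> complex.
           (\<forall>i\<in>{1..N}. \<forall>j\<in>{1..N}.
              (\<Sum>k=1..N. c i k * \<sigma> (a k) (a j)) = (if i = j then 1 else 0) \<and>
              (\<Sum>k=1..N. \<sigma> (a i) (a k) * c k j) = (if i = j then 1 else 0)) \<and>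
           (\<forall>z\<in>\<Omega>. \<forall>w\<in>\<Omega>.
              \<sigma> z w = (1 / (1 - f z * cnj (f w))) *
                 (\<Sum>i=1..N. \<Sum>j=1..N. c i j * \<sigma> z (a i) * cnj (\<sigma> w (a j))))"
proof -
  interpret szego_proper \<Omega> Gs \<phi> \<sigma> f
    by unfold_locales (fact dom wt szego hol onto proper)+
  have aO: "a ` {1..N} \<subseteq> \<Omega>" using zeros by blast
  obtain c where c: "\<forall>i\<in>{1..N}. \<forall>j\<in>{1..N}.
      (\<Sum>k=1..N. c i k * \<sigma> (a k) (a j)) = (if i = j then 1 else 0) \<and>
      (\<Sum>k=1..N. \<sigma> (a i) (a k) * c k j) = (if i = j then 1 else 0)"
    using matrix_inverse_exists[of N "\<lambda>i j. \<sigma> (a i) (a j)"] gram_kernel_trivial[OF aO inj finite_atLeastAtMost]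
    by blast
  have "\<sigma> z w = (1 / (1 - f z * cnj (f w))) *
      (\<Sum>i=1..N. \<Sum>j=1..N. c i j * \<sigma> z (a i) * cnj (\<sigma> w (a j)))" if "z \<in> \<Omega>" "w \<in> \<Omega>" for z w
    by (rule szego_kernel_formula[OF zeros finite_atLeastAtMost _ _ that]) (use simple c in auto)
  then show ?thesis using c by blast
qed

end
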